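(* Let $\Omega\subset\mathbb{R}^n$ be open and bounded, let $d:=\dim_b(\partial\Omega)$, and assume $n-1\le d<n$. Let $\alpha\in\left(\frac{d}{n},1\right]$. Then for every pair $(\beta,p)$ with $p\ge 1$ and $0\le\beta<\frac{n}{p}-\frac{d}{\alpha}$ there is a constant $C=C(\Omega,n,\alpha,\beta,p)$ such that for every $v\in C^{0,\alpha}(\Omega,\mathbb{R}^n)$ the Brouwer degree satisfies $$[\deg(v,\Omega,\cdot)]_{W^{\beta,p}}\le C\,[v]_{C^{0,\alpha}}^{\frac{n}{p}-\beta}.$$
   Context: $n$ is a positive integer. $\dim_b$ is the box counting (Minkowski) dimension: $\dim_b(K)=\limsup_{\varepsilon\to0}\frac{\log N_\varepsilon(K)}{\log(1/\varepsilon)}$, where $N_\varepsilon(K)$ is the minimal number of balls of radius $\varepsilon$ covering the bounded set $K$ (it is the limit whenever the limit exists). $C^{0,\alpha}(\Omega,\mathbb{R}^n)$ is the space of Hölder maps, with seminorm $[v]_{C^{0,\alpha}}=\sup_{x\ne y\in\Omega}\frac{|v(x)-v(y)|}{|x-y|^\alpha}$. Such $v$ extends uniquely to a continuous map on $\overline\Omega$, still denoted $v$, and $\deg(v,\Omega,y)$ is the Brouwer degree, defined for $y\in\mathbb{R}^n\setminus v(\partial\Omega)$ (it vanishes for $y\notin v(\overline\Omega)$). Under the hypotheses here $v(\partial\Omega)$ is Lebesgue-null, so $\deg(v,\Omega,\cdot)$ is regarded as an a.e. defined function on $\mathbb{R}^n$. $[f]_{W^{\beta,p}}$ is the $L^p(\mathbb{R}^n)$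 norm if $\beta=0$, and for $0<\beta<1$ it is the Gagliardo seminorm $\left(\int_{\mathbb{R}^n}\int_{\mathbb{R}^n}\frac{|f(x)-f(y)|^p}{|x-y|^{n+\beta p}}\,dx\,dy\right)^{1/p}$. (In the stated range one always has $\beta<1$.) *)

theory Defs
  imports "HOL-Analysis.Analysis"
begin

section \<open>Box counting dimension\<close>

definition covering_number :: "real \<Rightarrow> 'a::metric_space set \<Rightarrow> nat" where
  "covering_number \<epsilon> K = (LEAST m. \<exists>S. finite S \<and> card S = m \<and> K \<subseteq> (\<Union>x\<in>S. ball x \<epsilon>))"

text \<open>Meant for totally bounded \<open>K\<close>, where the \<open>LEAST\<close> exists. The limes superior is taken in
  \<^typ>\<open>ereal\<close>, so that it always exists. Pitfall: since \<open>ln 0 = 0\<close> in HOL, the empty set has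
  dimension \<open>0\<close> (and not minus infinity).\<close>

definition box_dim :: "'a::metric_space set \<Rightarrow> ereal" where
  "box_dim K = Limsup (at_right 0) (\<lambda>\<epsilon>. ereal (ln (real (covering_number \<epsilon> K)) / ln (1 / \<epsilon>)))"


section \<open>Hoelder maps\<close>

text \<open>On \<^typ>\<open>ennreal\<close> the supremum over the empty set is \<open>0\<close>.\<close>

definition holder_seminorm ::
    "real \<Rightarrow> 'a::real_normed_vector set \<Rightarrow> ('a \<Rightarrow> 'b::real_normed_vector) \<Rightarrow> ennreal" where
  "holder_seminorm \<alpha> \<Omega> v =
     (SUP (x, y) \<in> {(x, y). x \<in> \<Omega> \<and> y \<in> \<Omega> \<and> x \<noteq> y}. ennreal (norm (v x - v y) / norm (x - y) powr \<alpha>))"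

definition holder_space ::
    "real \<Rightarrow> 'a::real_normed_vector set \<Rightarrow> ('a \<Rightarrow> 'b::real_normed_vector) set" where
  "holder_space \<alpha> \<Omega> = {v. holder_seminorm \<alpha> \<Omega> v < \<infinity>}"

text \<open>For open \<open>\<Omega>\<close>, if \<open>v\<close> has a continuous extension from \<open>\<Omega>\<close> to \<open>closure \<Omega>\<close>, then
  \<open>closure_extension \<Omega> v\<close> is that extension on \<open>closure \<Omega>\<close>. Values of \<open>v\<close> outside \<open>\<Omega>\<close> play no role.\<close>

definition closure_extension ::
    "'a::t2_space set \<Rightarrow> ('a \<Rightarrow> 'b::t2_space) \<Rightarrow> 'a \<Rightarrow> 'b" where
  "closure_extension \<Omega> v x = Lim (at x within \<Omega>) v"


section \<open>Brouwer degree\<close>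

text \<open>A map \<open>w\<close> is admissible for \<open>(v, \<Omega>, y)\<close> if it is continuous on \<open>closure \<Omega>\<close>, continuously
  differentiable in \<open>\<Omega>\<close>, closer to \<open>v\<close> on all of \<open>closure \<Omega>\<close> than \<open>y\<close> is to \<open>v ` frontier \<Omega>\<close>, and
  has \<open>y\<close> as a regular value. Writing the distance condition pointwise (instead of with
  \<open>infdist y (v ` frontier \<Omega>)\<close>) makes no difference for compact nonempty \<open>frontier \<Omega>\<close>,
  and is the right convention for \<open>\<Omega> = {}\<close>.\<close>

definition degree_admissible ::
    "(real^'n \<Rightarrow> real^'n) \<Rightarrow> (real^'n) set \<Rightarrow> real^'n \<Rightarrow> (real^'n \<Rightarrow> real^'n) \<Rightarrow> bool" where
  "degree_admissible v \<Omega> y w \<longleftrightarrow>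
     continuous_on (closure \<Omega>) w \<and>
     (\<forall>x\<in>\<Omega>. w differentiable (at x)) \<and>
     continuous_on \<Omega> (\<lambda>x. jacobian w (at x)) \<and>
     (\<forall>x\<in>closure \<Omega>. \<forall>z\<in>frontier \<Omega>. dist (w x) (v x) < dist y (v z)) \<and>
     (\<forall>x\<in>\<Omega>. w x = y \<longrightarrow> det (jacobian w (at x)) \<noteq> 0)"

text \<open>For admissible \<open>w\<close> the sum below is finite: the preimage of \<open>y\<close> in \<open>closure \<Omega>\<close> is compact,
  does not meet the frontier, and consists of isolated points.\<close>

definition regular_degree ::
    "(real^'n \<Rightarrow> real^'n) \<Rightarrow> (real^'n) set \<Rightarrow> real^'n \<Rightarrow> real" where
  "regular_degree w \<Omega> y = (\<Sum>x | x \<in> \<Omega> \<and> w x = y. sgn (det (jacobian w (at x))))"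

text \<open>The Brouwer degree of a map \<open>v\<close> that is continuous on \<open>closure \<Omega>\<close>, with \<open>\<Omega>\<close> open and bounded:
  the common value of \<open>regular_degree w \<Omega> y\<close> over all admissible \<open>w\<close>. (By the Weierstrass and Sard
  theorems admissible maps exist if \<open>y \<notin> v ` frontier \<Omega>\<close>; that the value does not depend on \<open>w\<close> is
  homotopy invariance.) On \<open>v ` frontier \<Omega>\<close>, where the degree is not defined, the value is set
  to \<open>0\<close>.\<close>

definition brouwer_degree ::
    "(real^'n \<Rightarrow> real^'n) \<Rightarrow> (real^'n) set \<Rightarrow> real^'n \<Rightarrow> real" where
  "brouwer_degree v \<Omega> y =
     (if y \<in> v ` frontier \<Omega> then 0
      else (THE k. \<forall>w. degree_admissible v \<Omega> y w \<longrightarrow> regular_degree w \<Omega> y = k))"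


section \<open>Fractional Sobolev seminorm\<close>

text \<open>\<open>x\<^sup>a\<close> for \<open>a > 0\<close>.\<close>

definition ennreal_powr :: "ennreal \<Rightarrow> real \<Rightarrow> ennreal" where
  "ennreal_powr x a = (if x = \<infinity> then \<infinity> else ennreal (enn2real x powr a))"

text \<open>Meant for \<open>0 \<le> \<beta> < 1\<close> and \<open>1 \<le> p\<close>. On the diagonal the integrand is \<open>0 / 0 = 0\<close>.\<close>

definition sobolev_seminorm ::
    "real \<Rightarrow> real \<Rightarrow> ('a::euclidean_space \<Rightarrow> real) \<Rightarrow> ennreal" where
  "sobolev_seminorm \<beta> p f =
     (if \<beta> = 0
      then ennreal_powr (\<integral>\<^sup>+x. ennreal (\<bar>f x\<bar> powr p) \<partial>lborel) (1 / p)
      else ennreal_powr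
             (\<integral>\<^sup>+x. \<integral>\<^sup>+y. ennreal (\<bar>f x - f y\<bar> powr p / norm (x - y) powr (real DIM('a) + \<beta> * p))
                \<partial>lborel \<partial>lborel) (1 / p))"

end

theory Submission
  imports Defs "Jordan_Normal_Form.Determinant" "HOL-Combinatorics.Multiset_Permutations"
begin

text \<open>
  Let \<open>f\<^sub>k(y)\<close> be the degree at \<open>y\<close> of the map that interpolates \<open>v\<close> on the Kuhn triangulations of
  the dyadic cubes of side \<open>2 powr - k\<close> contained in \<open>\<Omega>\<close>. It is a sum of signed indicators of simplices
  whose vertices are values of \<open>v\<close>, hence almost everywhere well defined. The signed indicator of a simplex
  is a cocycle: the alternating sum over the facets of an \<open>n + 1\<close> simplex vanishes for generic \<open>y\<close>. By the
  prism decomposition, replacing one vertex map by another changes the degree on a set of cubes only by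
  prisms over the boundary faces. This has two consequences.

  First, comparing \<open>v\<close> with an admissible map and the latter with its linearizations at the
  preimages of \<open>y\<close> shows that \<open>f\<^sub>k\<close> converges almost everywhere to the Brouwer degree, which
  thereby is well defined.

  Second, \<open>f\<^sub>k\<close> is the degree of \<open>v\<close> composed with the rounding of the finer grid to the coarser
  one. So \<open>f\<^bsub>k+1\<^esub> - f\<^sub>k\<close> is a sum of signed indicators of simplices that live near \<open>\<partial>\<Omega>\<close>: about \<open>2 powr (k d)\<close>
  of them, each of diameter at most a constant times \<open>[v] 2 powr (- k \<alpha>)\<close>. The seminorm of the indicator of a convex set of
  diameter \<open>r\<close> is at most a constant times \<open>r powr (n / p - \<beta>)\<close>, because \<open>\<beta> p < 1\<close>, and the sum of these bounds over \<open>k\<close>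
  converges exactly if \<open>\<beta> < n / p - d / \<alpha>\<close>.
\<close>

section \<open>Oriented simplices\<close>

no_notation vec_index (infixl "$" 100)
no_notation scalar_prod (infix "\<bullet>" 70)

text \<open>The degree is given by a definite description, so its independence of the admissible map
  is part of what has to be shown. Invariance and estimate both rest on one identity for arbitrary
  vertex maps on the integer lattice. Samples of \<open>v\<close>, of an admissible map, of an
  affine map, and of \<open>v\<close> after rounding are instances; no interpolated map is ever
  formed.

  The price is genericity: the identity may fail if \<open>y\<close> lies on a face of a simplex.
  The vertex values are countable, so such \<open>y\<close> form a null set, but a given
  \<open>y\<close> may be exceptional at every scale. Hence the degree at \<open>y\<close> is
  detected at almost all points near \<open>y\<close>.

  In the estimate, Jensen's inequality for the p-th power of the seminorm, with weights
  \<open>r powr \<gamma>\<close> where \<open>\<gamma> = n / p - \<beta>\<close>, does the work of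
  the triangle inequality: only the sum of the weights over all simplices has to be controlled, and
  Fatou's lemma passes to the limit. Scale \<open>k\<close> contributes about
  \<open>2 powr (k * d')\<close> times \<open>([v] * 2 powr (- k * \<alpha>)) powr \<gamma>\<close>,
  with \<open>d'\<close> slightly above \<open>d\<close>, because a limes superior controls covering
  numbers only for exponents above the dimension.\<close>

lemma sum_skip:
  fixes f :: "nat \<Rightarrow> 'b::comm_monoid_add"
  assumes "i \<le> N"
  shows "(\<Sum>j\<in>{..<Suc N} - {i}. f j) = (\<Sum>j<N. f (if j < i then j else Suc j))"
proof (rule sum.reindex_bij_witness[where i="\<lambda>j. if j < i then j else Suc j" and j="\<lambda>j. if j < i then j else j - 1"])
qed (use assms in auto)

definition remove_nth :: "nat \<Rightarrow> 'a list \<Rightarrow> 'a list" where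
  "remove_nth i xs = take i xs @ drop (Suc i) xs"

lemma length_remove_nth: "i < length xs \<Longrightarrow> length (remove_nth i xs) = length xs - 1"
  by (auto simp: remove_nth_def)

lemma nth_remove_nth:
  assumes "i < length xs" "j < length xs - 1"
  shows "remove_nth i xs ! j = xs ! (if j < i then j else Suc j)"
  using assms by (auto simp: remove_nth_def nth_append min_def)

text \<open>Matrices indexed by natural numbers require an order of the coordinates. The order is
  arbitrary and affects \<open>vol\<close> by a sign, which the factor \<open>orient\<close> undoes
  later.\<close>

definition dirs :: "'n::finite list" where
  "dirs = (SOME xs. distinct xs \<and> set xs = UNIV)"

lemma
  shows distinct_dirs: "distinct (dirs :: 'n::finite list)"
    and set_dirs: "set (dirs :: 'n::finite list) = UNIV"
proof -
  have "\<exists>xs::'n list. distinct xs \<and> set xs = UNIV"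
    using finite_distinct_list[of "UNIV :: 'n set"] by auto
  then have "distinct (dirs :: 'n list) \<and> set (dirs :: 'n list) = UNIV"
    unfolding dirs_def by (rule someI_ex)
  then show "distinct (dirs :: 'n list)" "set (dirs :: 'n list) = UNIV" by auto
qed

lemma length_dirs: "length (dirs :: 'n::finite list) = CARD('n)"
  using distinct_card[OF distinct_dirs[where 'n='n]] by (simp add: set_dirs)

lemma bij_betw_dirs: "bij_betw ((!) (dirs :: 'n::finite list)) {0..<CARD('n)} UNIV"
  using bij_betw_nth[OF distinct_dirs[where 'n='n], of "{0..<CARD('n)}" UNIV]
  by (auto simp: length_dirs set_dirs atLeast0LessThan)

lemma ex_dirs_nth: "\<exists>k<CARD('n). dirs ! k = (x :: 'n::finite)"
  using set_dirs[where 'n='n] by (metis UNIV_I in_set_conv_nth length_dirs)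

section \<open>Signed volume and affine dependencies\<close>

definition hcoord :: "real^'n \<Rightarrow> nat \<Rightarrow> real" where
  "hcoord p j = (if j = 0 then 1 else p $ (dirs ! (j - 1)))"

text \<open>The rows are homogeneous coordinates, so up to the order chosen in \<open>dirs\<close>
  this is n! times the signed volume of the simplex spanned by the first n + 1 entries.\<close>

definition vol :: "(real^'n) list \<Rightarrow> real" where
  "vol ps = Determinant.det (mat (Suc CARD('n)) (Suc CARD('n)) (\<lambda>(i, j). hcoord (ps ! i) j))"

text \<open>Column 0 carries the condition on the sum of the coefficients, the other columns carry
  the vector identity. So linear dependencies between rows are affine dependencies between
  points.\<close>

lemma hcoord_dependency_iff:
  fixes q :: "nat \<Rightarrow> real^'n"
  shows "(\<forall>j<Suc CARD('n). (\<Sum>i\<in>I. c i * hcoord (q i) j) = 0)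
     \<longleftrightarrow> sum c I = 0 \<and> (\<Sum>i\<in>I. c i *\<^sub>R q i) = 0" (is "?l \<longleftrightarrow> ?r")
proof
  assume l: ?l
  have "sum c I = 0" using l[rule_format, of 0] by (simp add: hcoord_def)
  moreover have "(\<Sum>i\<in>I. c i *\<^sub>R q i) $ x = 0" for x
  proof -
    obtain k where "k < CARD('n)" "dirs ! k = x"
      using ex_dirs_nth by blast
    then show ?thesis using l[rule_format, of "Suc k"] by (simp add: hcoord_def)
  qed
  then have "(\<Sum>i\<in>I. c i *\<^sub>R q i) = 0"
    by (simp add: Finite_Cartesian_Product.vec_eq_iff)
  ultimately show ?r by blast
next
  assume r: ?r
  show ?l
  proof (intro allI impI)
    fix j assume "j < Suc CARD('n)"
    show "(\<Sum>i\<in>I. c i * hcoord (q i) j) = 0"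
    proof (cases j)
      case 0 then show ?thesis using r by (simp add: hcoord_def)
    next
      case (Suc k)
      have "(\<Sum>i\<in>I. c i *\<^sub>R q i) $ (dirs ! k) = 0" using r by simp
      then show ?thesis using Suc by (simp add: hcoord_def)
    qed
  qed
qed

text \<open>Cramer's rule. This is how orientations enter the cocycle identity: the signed facet
  volumes become the direction of a line in barycentric coordinates.\<close>

lemma vol_dependency:
  fixes ps :: "(real^'n) list"
  assumes len: "length ps = CARD('n) + 2"
  defines "\<mu> \<equiv> \<lambda>i. (-1)^i * vol (remove_nth i ps)"
  shows "(\<Sum>i<CARD('n) + 2. \<mu> i) = 0" and "(\<Sum>i<CARD('n) + 2. \<mu> i *\<^sub>R (ps ! i)) = 0"
proof -
  let ?N = "CARD('n) + 2"
  have "(\<Sum>i<?N. \<mu> i * hcoord (ps ! i) j) = 0" if j: "j < Suc CARD('n)" for j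
  proof -
    \<comment> \<open>column \<open>0\<close> repeats column \<open>Suc j\<close>; expand along it\<close>
    define M where "M = mat ?N ?N (\<lambda>(i, c). if c = 0 then hcoord (ps ! i) j else hcoord (ps ! i) (c - 1))"
    have M: "M \<in> carrier_mat ?N ?N" by (simp add: M_def)
    have "Determinant.det M = 0"
      by (rule Determinant.det_identical_columns[OF M, of 0 "Suc j"]) (use j in \<open>auto simp: M_def intro!: eq_vecI\<close>)
    then have "(\<Sum>i<?N. M $$ (i,0) * cofactor M i 0) = 0"
      using laplace_expansion_column[OF M, of 0] by simp
    moreover have "M $$ (i,0) * cofactor M i 0 = \<mu> i * hcoord (ps ! i) j" if i: "i < ?N" for i
    proof -
      have "mat_delete M i 0 = mat (Suc CARD('n)) (Suc CARD('n)) (\<lambda>(i', j). hcoord (remove_nth i ps ! i') j)"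
        using i len by (intro eq_matI) (auto simp: mat_delete_def M_def nth_remove_nth)
      then show ?thesis using i by (simp add: cofactor_def \<mu>_def vol_def M_def)
    qed
    ultimately show ?thesis by simp
  qed
  then show "(\<Sum>i<?N. \<mu> i) = 0" "(\<Sum>i<?N. \<mu> i *\<^sub>R (ps ! i)) = 0"
    using hcoord_dependency_iff[where I="{..<?N}" and c=\<mu> and q="\<lambda>i. ps ! i"] by blast+
qed

lemma vol_nonzero_independent:
  fixes ps :: "(real^'n) list"
  assumes "vol ps \<noteq> 0" and "(\<Sum>i<Suc CARD('n). c i) = 0"
    and "(\<Sum>i<Suc CARD('n). c i *\<^sub>R (ps ! i)) = 0" and "i < Suc CARD('n)"
  shows "c i = 0"
proof (rule ccontr)
  assume ci: "c i \<noteq> 0"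
  let ?N = "Suc CARD('n)"
  define M where "M = mat ?N ?N (\<lambda>(i, j). hcoord (ps ! i) j)"
  have M: "M \<in> carrier_mat ?N ?N" by (simp add: M_def)
  have T: "transpose_mat M \<in> carrier_mat ?N ?N" using M by simp
  have dep: "(\<Sum>i<?N. c i * hcoord (ps ! i) j) = 0" if "j < ?N" for j
    using hcoord_dependency_iff[where I="{..<?N}" and c=c and q="\<lambda>i. ps ! i"] assms that by blast
  have "transpose_mat M *\<^sub>v Matrix.vec ?N c = 0\<^sub>v ?N"
  proof (intro eq_vecI)
    fix j assume "j < dim_vec (0\<^sub>v ?N)"
    then have j: "j < ?N" by simp
    then have "vec_index (transpose_mat M *\<^sub>v Matrix.vec ?N c) j = (\<Sum>i<?N. c i * hcoord (ps ! i) j)"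
      by (simp add: M_def scalar_prod_def atLeast0LessThan mult.commute)
    then show "vec_index (transpose_mat M *\<^sub>v Matrix.vec ?N c) j = vec_index (0\<^sub>v ?N) j" using dep j by simp
  qed (simp add: M_def)
  moreover have "Matrix.vec ?N c \<noteq> 0\<^sub>v ?N"
  proof
    assume "Matrix.vec ?N c = 0\<^sub>v ?N"
    then have "vec_index (Matrix.vec ?N c) i = vec_index (0\<^sub>v ?N) i" by simp
    then show False using ci assms by simp
  qed
  moreover have "Matrix.vec ?N c \<in> carrier_vec ?N" by simp
  ultimately have "Determinant.det (transpose_mat M) = 0"
    using det_0_iff_vec_prod_zero_field[OF T] by metis
  then show False using assms(1) Determinant.det_transpose[OF M] by (simp add: vol_def M_def)
qed

lemma independent_skip:
  fixes ps :: "(real^'n) list"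
  assumes len: "length ps = CARD('n) + 2" and m: "m < CARD('n) + 2" and "vol (remove_nth m ps) \<noteq> 0"
    and "c m = 0" and "(\<Sum>i<CARD('n) + 2. c i) = 0" and "(\<Sum>i<CARD('n) + 2. c i *\<^sub>R (ps ! i)) = 0"
    and i: "i < CARD('n) + 2"
  shows "c i = 0"
proof -
  let ?s = "\<lambda>j. if j < m then j else Suc j"
  have "(\<Sum>i\<in>{..<Suc (Suc CARD('n))} - {m}. c i) = 0"
    using assms sum.remove[of "{..<Suc (Suc CARD('n))}" m c] by simp
  then have 1: "(\<Sum>j<Suc CARD('n). c (?s j)) = 0"
    using sum_skip[of m "Suc CARD('n)" c] m by simp
  have "(\<Sum>i\<in>{..<Suc (Suc CARD('n))} - {m}. c i *\<^sub>R (ps ! i)) = 0"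
    using assms sum.remove[of "{..<Suc (Suc CARD('n))}" m "\<lambda>i. c i *\<^sub>R (ps ! i)"] by simp
  then have 2: "(\<Sum>j<Suc CARD('n). c (?s j) *\<^sub>R (remove_nth m ps ! j)) = 0"
    using sum_skip[of m "Suc CARD('n)" "\<lambda>i. c i *\<^sub>R (ps ! i)"] m len by (simp add: nth_remove_nth)
  have "c (?s j) = 0" if "j < Suc CARD('n)" for j
    using vol_nonzero_independent[OF assms(3) 1 2 that] .
  note z = this
  consider "i < m" | "i = m" | "m < i" by linarith
  then show ?thesis
  proof cases
    case 1 then show ?thesis using z[of i] m by simp
  next
    case 2 then show ?thesis using assms(4) by simp
  next
    case 3
    then obtain i' where "i = Suc i'" by (cases i) auto
    then show ?thesis using z[of i'] i 3 by simp
  qed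
qed

text \<open>Once some facet is nondegenerate, a dependency that vanishes at the opposite vertex is
  zero, so the dependencies form a line spanned by the signed facet volumes. If all facets are
  degenerate, both sides are zero.\<close>

lemma dependency_proportional:
  fixes ps :: "(real^'n) list"
  assumes len: "length ps = CARD('n) + 2"
    and c: "(\<Sum>i<CARD('n) + 2. c i) = 0" "(\<Sum>i<CARD('n) + 2. c i *\<^sub>R (ps ! i)) = 0"
    and "i < CARD('n) + 2" "k < CARD('n) + 2"
  shows "c i * ((-1)^k * vol (remove_nth k ps)) = c k * ((-1)^i * vol (remove_nth i ps))"
proof (cases "\<forall>m<CARD('n) + 2. vol (remove_nth m ps) = 0")
  case True then show ?thesis using assms by simp
next
  case False
  then obtain m where m: "m < CARD('n) + 2" "vol (remove_nth m ps) \<noteq> 0" by auto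
  define \<mu> where "\<mu> i = (-1)^i * vol (remove_nth i ps)" for i
  have \<mu>m: "\<mu> m \<noteq> 0" using m by (simp add: \<mu>_def)
  note d = vol_dependency[OF len, folded \<mu>_def]
  define e where "e i = c i - c m / \<mu> m * \<mu> i" for i
  have "(\<Sum>i<CARD('n) + 2. e i) = 0"
    unfolding e_def sum_subtractf sum_distrib_left[symmetric] c(1) d(1) by simp
  moreover have "(\<Sum>i<CARD('n) + 2. e i *\<^sub>R (ps ! i)) = 0"
  proof -
    have "(\<Sum>i<CARD('n) + 2. e i *\<^sub>R (ps ! i)) = (\<Sum>i<CARD('n) + 2. c i *\<^sub>R (ps ! i)) - (c m / \<mu> m) *\<^sub>R (\<Sum>i<CARD('n) + 2. \<mu> i *\<^sub>R (ps ! i))"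
      by (simp only: e_def scaleR_diff_left sum_subtractf scaleR_sum_right scaleR_scaleR)
    then show ?thesis using c(2) d(2) by simp
  qed
  moreover have "e m = 0" using \<mu>m by (simp add: e_def)
  ultimately have "e i = 0" "e k = 0"
    using independent_skip[OF len m] assms by blast+
  then have "c i = c m / \<mu> m * \<mu> i" "c k = c m / \<mu> m * \<mu> k" by (auto simp: e_def)
  then show ?thesis by (simp add: \<mu>_def)
qed

text \<open>Append \<open>y\<close> to the facet opposite \<open>ps ! m\<close> and solve the
  resulting dependency for \<open>y\<close>, whose coefficient is up to sign the nonzero volume of
  that facet.\<close>

lemma barycentric_exists:
  fixes ps :: "(real^'n) list"
  assumes len: "length ps = CARD('n) + 2" and m: "m < CARD('n) + 2" and v: "vol (remove_nth m ps) \<noteq> 0"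
  obtains c where "c m = 0" "(\<Sum>i<CARD('n) + 2. c i) = 1" "(\<Sum>i<CARD('n) + 2. c i *\<^sub>R (ps ! i)) = y"
proof -
  let ?qs = "remove_nth m ps @ [y]"
  have lr: "length (remove_nth m ps) = Suc CARD('n)" using len m by (simp add: length_remove_nth)
  have lq: "length ?qs = CARD('n) + 2" using lr by simp
  define \<mu> where "\<mu> i = (-1)^i * vol (remove_nth i ?qs)" for i
  note d = vol_dependency[OF lq, folded \<mu>_def]
  let ?n = "Suc CARD('n)"
  have rl: "remove_nth ?n ?qs = remove_nth m ps" using lr by (subst remove_nth_def) simp
  then have \<mu>n: "\<mu> ?n \<noteq> 0" using v by (simp add: \<mu>_def)
  define a where "a i = - \<mu> i / \<mu> ?n" for i
  have "(\<Sum>i<?n. \<mu> i) = - \<mu> ?n" using d(1) by simp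
  then have a1: "(\<Sum>i<?n. a i) = 1" using \<mu>n by (simp add: a_def sum_negf sum_divide_distrib[symmetric])
  have "(\<Sum>i<?n. \<mu> i *\<^sub>R (?qs ! i)) + \<mu> ?n *\<^sub>R y = 0" using d(2) lr by (simp add: nth_append)
  then have "(- 1 / \<mu> ?n) *\<^sub>R ((\<Sum>i<?n. \<mu> i *\<^sub>R (?qs ! i)) + \<mu> ?n *\<^sub>R y) = 0" by simp
  then have "(\<Sum>i<?n. a i *\<^sub>R (?qs ! i)) - y = 0"
    using \<mu>n by (simp add: a_def scaleR_add_right scaleR_sum_right del: sum.lessThan_Suc)
  moreover have "(\<Sum>i<?n. a i *\<^sub>R (?qs ! i)) = (\<Sum>i<?n. a i *\<^sub>R (remove_nth m ps ! i))"
    using lr by (intro sum.cong) (auto simp: nth_append)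
  ultimately have a2: "(\<Sum>i<?n. a i *\<^sub>R (remove_nth m ps ! i)) = y" by simp
  define c where "c i = (if i = m then 0 else if i < m then a i else a (i - 1))" for i
  have 1: "c (if j < m then j else Suc j) = a j" for j by (auto simp: c_def)
  have "(\<Sum>i<Suc ?n. c i) = (\<Sum>i\<in>{..<Suc ?n} - {m}. c i)"
    using m by (subst sum.remove[of _ m]) (auto simp: c_def)
  also have "\<dots> = 1" using sum_skip[of m ?n c] m a1 by (simp add: 1 del: sum.lessThan_Suc)
  finally have c1: "(\<Sum>i<CARD('n)+2. c i) = 1" by simp
  have "(\<Sum>i<Suc ?n. c i *\<^sub>R (ps ! i)) = (\<Sum>i\<in>{..<Suc ?n} - {m}. c i *\<^sub>R (ps ! i))"
    using m by (subst sum.remove[of _ m]) (auto simp: c_def)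
  also have "\<dots> = (\<Sum>j<?n. a j *\<^sub>R (remove_nth m ps ! j))"
    using sum_skip[of m ?n "\<lambda>i. c i *\<^sub>R (ps ! i)"] m len by (simp add: 1 nth_remove_nth del: sum.lessThan_Suc)
  finally have c2: "(\<Sum>i<CARD('n)+2. c i *\<^sub>R (ps ! i)) = y" using a2 by simp
  show ?thesis by (rule that[OF _ c1 c2]) (simp add: c_def)
qed

text \<open>Weights belong to positions and not to points, because the vertex list of a degenerate
  simplex may repeat a point.\<close>

lemma convex_hull_set_nth:
  fixes ps :: "'a::real_vector list"
  shows "convex hull (set ps) = {(\<Sum>i<length ps. c i *\<^sub>R (ps ! i)) |c. (\<forall>i<length ps. 0 \<le> c i) \<and> (\<Sum>i<length ps. c i) = 1}"
  (is "_ = ?R")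
proof
  show "convex hull (set ps) \<subseteq> ?R"
  proof (rule hull_minimal)
    show "set ps \<subseteq> ?R"
    proof
      fix x assume "x \<in> set ps"
      then obtain k where k: "k < length ps" "x = ps ! k" by (auto simp: in_set_conv_nth)
      have "(\<Sum>i<length ps. (if i = k then 1 else 0) *\<^sub>R (ps ! i)) = (\<Sum>i<length ps. if i = k then ps ! i else 0)"
        by (intro sum.cong) auto
      then have "(\<Sum>i<length ps. (if i = k then 1 else 0) *\<^sub>R (ps ! i)) = x" using k by simp
      moreover have "(\<Sum>i<length ps. (if i = k then 1 else 0::real)) = 1" using k by simp
      ultimately show "x \<in> ?R" by (auto intro!: exI[of _ "\<lambda>i. if i = k then 1 else 0"])
    qed
    show "convex ?R"
    proof (rule convexI)
      fix x y u v assume "x \<in> ?R" "y \<in> ?R" and uv: "0 \<le> (u::real)" "0 \<le> v" "u + v = 1"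
      then obtain c d where c: "x = (\<Sum>i<length ps. c i *\<^sub>R (ps ! i))" "\<forall>i<length ps. 0 \<le> c i" "(\<Sum>i<length ps. c i) = 1"
        and d: "y = (\<Sum>i<length ps. d i *\<^sub>R (ps ! i))" "\<forall>i<length ps. 0 \<le> d i" "(\<Sum>i<length ps. d i) = 1"
        by blast
      have "u *\<^sub>R x + v *\<^sub>R y = (\<Sum>i<length ps. (u * c i + v * d i) *\<^sub>R (ps ! i))"
        by (simp add: c(1) d(1) scaleR_sum_right scaleR_add_left sum.distrib)
      moreover have "(\<Sum>i<length ps. u * c i + v * d i) = 1"
        using c(3) d(3) uv by (simp add: sum.distrib sum_distrib_left[symmetric])
      moreover have "\<forall>i<length ps. 0 \<le> u * c i + v * d i" using c(2) d(2) uv by simp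
      ultimately show "u *\<^sub>R x + v *\<^sub>R y \<in> ?R"
        unfolding mem_Collect_eq by (intro exI[of _ "\<lambda>i. u * c i + v * d i"] conjI)
    qed
  qed
  show "?R \<subseteq> convex hull (set ps)"
  proof
    fix x assume "x \<in> ?R"
    then obtain c where c: "x = (\<Sum>i<length ps. c i *\<^sub>R (ps ! i))" "\<forall>i<length ps. 0 \<le> c i" "(\<Sum>i<length ps. c i) = 1"
      by blast
    show "x \<in> convex hull (set ps)" unfolding c(1)
      by (rule convex_sum) (use c in \<open>auto intro: hull_inc\<close>)
  qed
qed

text \<open>A line meets the boundary of a simplex in an entry and in an exit facet.\<close>

lemma entry_facet_count:
  fixes l \<mu> :: "nat \<Rightarrow> real"
  assumes pos: "\<exists>j<N. \<mu> j > 0"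
    and G: "\<And>t i j. \<forall>j<N. l j + t * \<mu> j \<ge> 0 \<Longrightarrow> i < N \<Longrightarrow> j < N \<Longrightarrow> l i + t * \<mu> i = 0 \<Longrightarrow> l j + t * \<mu> j = 0 \<Longrightarrow> i = j"
  shows "(\<Sum>i | i < N \<and> \<mu> i > 0. if \<forall>j<N. l j + (- l i / \<mu> i) * \<mu> j \<ge> 0 then 1 else (0::real))
     = (if \<exists>t. \<forall>j<N. l j + t * \<mu> j \<ge> 0 then 1 else 0)"
proof (cases "\<exists>t. \<forall>j<N. l j + t * \<mu> j \<ge> 0")
  case False
  then have "\<not> (\<forall>j<N. l j + (- l i / \<mu> i) * \<mu> j \<ge> 0)" for i by blast
  then show ?thesis using False by (simp only: if_False sum.neutral_const)
next
  case True
  then obtain s where s: "\<And>j. j < N \<Longrightarrow> l j + s * \<mu> j \<ge> 0" by blast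
  define P where "P = {i. i < N \<and> \<mu> i > 0}"
  define t where "t i = - l i / \<mu> i" for i
  have P: "finite P" "P \<noteq> {}" using pos by (auto simp: P_def)
  have lb: "t i \<le> r" if "i \<in> P" "\<And>j. j < N \<Longrightarrow> l j + r * \<mu> j \<ge> 0" for i r
  proof -
    have "l i + r * \<mu> i \<ge> 0" "\<mu> i > 0" using that by (auto simp: P_def)
    then show ?thesis by (simp add: t_def field_simps)
  qed
  have z: "l i + t i * \<mu> i = 0" if "i \<in> P" for i using that by (simp add: t_def P_def)
  \<comment> \<open>A coordinate with positive slope becomes nonnegative at time \<open>t i\<close>.
    The line can be inside only after the last of these times, so the maximizer is the entry facet;
    by \<open>G\<close> no other facet shares its time.\<close>
  obtain a where a: "a \<in> P" "\<And>i. i \<in> P \<Longrightarrow> t i \<le> t a"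
    using P obtains_MAX[of P t] by (metis Max_ge finite_imageI imageI)
  have J: "l j + t a * \<mu> j \<ge> 0" if j: "j < N" for j
  proof (cases "\<mu> j > 0")
    case True
    then have "j \<in> P" using j by (simp add: P_def)
    then have "t j * \<mu> j \<le> t a * \<mu> j" using a(2) True by simp
    then show ?thesis using z[OF \<open>j \<in> P\<close>] by linarith
  next
    case False
    have "t a \<le> s" using lb[OF a(1)] s by blast
    then have "s * \<mu> j \<le> t a * \<mu> j" using False by (simp add: mult_right_mono_neg)
    then show ?thesis using s[OF j] by linarith
  qed
  have uniq: "i = a" if "i \<in> P" "\<forall>j<N. l j + t i * \<mu> j \<ge> 0" for i
  proof -
    have "t a \<le> t i" using lb[OF a(1)] that by blast
    then have "t i = t a" using a(2)[OF that(1)] by simp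
    then show "i = a" using G[of "t a" i a] J z[OF that(1)] z[OF a(1)] that(1) a(1)
      by (auto simp: P_def)
  qed
  have "(\<Sum>i\<in>P. if \<forall>j<N. l j + t i * \<mu> j \<ge> 0 then 1 else (0::real)) = (\<Sum>i\<in>P. if i = a then 1 else 0)"
  proof (rule sum.cong[OF refl])
    fix i assume "i \<in> P"
    then have iff: "(\<forall>j<N. l j + t i * \<mu> j \<ge> 0) \<longleftrightarrow> i = a" using uniq J by blast
    show "(if \<forall>j<N. l j + t i * \<mu> j \<ge> 0 then 1 else (0::real)) = (if i = a then 1 else 0)"
      unfolding iff ..
  qed
  also have "\<dots> = 1" using a P by simp
  finally have "(\<Sum>i\<in>P. if \<forall>j<N. l j + (- l i / \<mu> i) * \<mu> j \<ge> 0 then 1 else (0::real)) = 1" unfolding t_def .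
  moreover have "(if \<exists>t. \<forall>j<N. l j + t * \<mu> j \<ge> 0 then 1 else (0::real)) = 1" using True by (rule if_P)
  ultimately show ?thesis unfolding P_def by simp
qed

text \<open>Negating \<open>\<mu>\<close> reverses the line and turns exits into entries, so entries
  and exits are both counted by whether the line meets the simplex. An index with
  \<open>\<mu> i = 0\<close> has weight \<open>sgn 0 = 0\<close>, whatever the quotient by zero
  yields.\<close>

lemma line_simplex_count:
  fixes l \<mu> :: "nat \<Rightarrow> real"
  assumes s0: "(\<Sum>i<N. \<mu> i) = 0" and nz: "\<exists>j<N. \<mu> j \<noteq> 0"
    and G: "\<And>t i j. \<forall>j<N. l j + t * \<mu> j \<ge> 0 \<Longrightarrow> i < N \<Longrightarrow> j < N \<Longrightarrow> l i + t * \<mu> i = 0 \<Longrightarrow> l j + t * \<mu> j = 0 \<Longrightarrow> i = j"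
  shows "(\<Sum>i<N. sgn (\<mu> i) * (if \<forall>j<N. l j + (- l i / \<mu> i) * \<mu> j \<ge> 0 then 1 else 0)) = 0"
proof -
  let ?X = "\<lambda>i. if \<forall>j<N. l j + (- l i / \<mu> i) * \<mu> j \<ge> 0 then 1 else (0::real)"
  have pos: "\<exists>j<N. \<mu> j > 0"
  proof (rule ccontr)
    assume "\<not> ?thesis"
    then have "\<forall>i\<in>{..<N}. - \<mu> i \<ge> 0" by force
    moreover have "(\<Sum>i<N. - \<mu> i) = 0" using s0 by (simp add: sum_negf)
    ultimately have "\<forall>i\<in>{..<N}. - \<mu> i = 0" using sum_nonneg_eq_0_iff[of "{..<N}" "\<lambda>i. - \<mu> i"] by simp
    then show False using nz by auto
  qed
  have neg: "\<exists>j<N. - \<mu> j > 0"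
  proof (rule ccontr)
    assume "\<not> ?thesis"
    then have "\<forall>i\<in>{..<N}. \<mu> i \<ge> 0" by force
    then have "\<forall>i\<in>{..<N}. \<mu> i = 0" using s0 sum_nonneg_eq_0_iff[of "{..<N}" \<mu>] by simp
    then show False using nz by auto
  qed
  have 1: "(\<Sum>i | i < N \<and> \<mu> i > 0. ?X i) = (if \<exists>t. \<forall>j<N. l j + t * \<mu> j \<ge> 0 then 1 else 0)"
    by (rule entry_facet_count[OF pos G])
  have "(\<Sum>i | i < N \<and> - \<mu> i > 0. if \<forall>j<N. l j + (- l i / (- \<mu> i)) * (- \<mu> j) \<ge> 0 then 1 else (0::real))
    = (if \<exists>t. \<forall>j<N. l j + t * (- \<mu> j) \<ge> 0 then 1 else 0)"
  proof (rule entry_facet_count[OF neg])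
    fix t i j assume "\<forall>j<N. l j + t * - \<mu> j \<ge> 0" "i < N" "j < N" "l i + t * - \<mu> i = 0" "l j + t * - \<mu> j = 0"
    then show "i = j" using G[of "- t" i j] by simp
  qed
  moreover have "(\<exists>t. \<forall>j<N. l j + t * (- \<mu> j) \<ge> 0) \<longleftrightarrow> (\<exists>t. \<forall>j<N. l j + t * \<mu> j \<ge> 0)"
    (is "(\<exists>t. ?J t) \<longleftrightarrow> (\<exists>t. ?K t)")
  proof -
    have "?J t = ?K (- t)" for t by simp
    then show ?thesis by (metis minus_minus)
  qed
  ultimately have 2: "(\<Sum>i | i < N \<and> \<mu> i < 0. ?X i) = (if \<exists>t. \<forall>j<N. l j + t * \<mu> j \<ge> 0 then 1 else 0)"
    by simp
  have "(\<Sum>i<N. sgn (\<mu> i) * ?X i) = (\<Sum>i<N. (if \<mu> i > 0 then ?X i else 0) - (if \<mu> i < 0 then ?X i else 0))"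
    by (intro sum.cong) (auto simp: sgn_if)
  also have "\<dots> = (\<Sum>i | i < N \<and> \<mu> i > 0. ?X i) - (\<Sum>i | i < N \<and> \<mu> i < 0. ?X i)"
    by (simp only: sum_subtractf sum.inter_filter[symmetric] finite_lessThan) (simp add: lessThan_def)
  finally show ?thesis using 1 2 by simp
qed

section \<open>The cocycle identity at generic points\<close>

definition chi :: "real^'n \<Rightarrow> (real^'n) list \<Rightarrow> real" where
  "chi y ps = (if y \<in> convex hull (set ps) then sgn (vol ps) else 0)"

text \<open>Hulls of at most n points are flat. So \<open>y\<close> avoids the boundaries of all
  simplices with vertices in \<open>P\<close> at once, and for countable \<open>P\<close> this holds
  almost everywhere.\<close>

definition generic :: "(real^'n) set \<Rightarrow> real^'n \<Rightarrow> bool" where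
  "generic P y \<longleftrightarrow> (\<forall>S\<subseteq>P. finite S \<and> card S \<le> CARD('n) \<longrightarrow> y \<notin> convex hull S)"

lemma convex_hull_remove_nth_iff:
  fixes ps :: "(real^'n) list"
  assumes len: "length ps = Suc N" and i: "i < Suc N"
  shows "y \<in> convex hull (set (remove_nth i ps)) \<longleftrightarrow>
    (\<exists>c. c i = 0 \<and> (\<forall>j<Suc N. 0 \<le> c j) \<and> (\<Sum>j<Suc N. c j) = 1 \<and> (\<Sum>j<Suc N. c j *\<^sub>R (ps ! j)) = y)"
    (is "_ \<longleftrightarrow> (\<exists>c. ?P c)")
proof -
  let ?s = "\<lambda>j. if j < i then j else Suc j"
  have l: "length (remove_nth i ps) = N" using len i by (simp add: length_remove_nth)
  have key: "(\<Sum>j<Suc N. c j) = (\<Sum>j<N. c (?s j))" 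
    "(\<Sum>j<Suc N. c j *\<^sub>R (ps ! j)) = (\<Sum>j<N. c (?s j) *\<^sub>R (remove_nth i ps ! j))" if "c i = 0" for c :: "nat \<Rightarrow> real"
  proof -
    have "(\<Sum>j<Suc N. c j) = (\<Sum>j\<in>{..<Suc N} - {i}. c j)"
      using i that by (subst sum.remove[of _ i]) auto
    then show "(\<Sum>j<Suc N. c j) = (\<Sum>j<N. c (?s j))" using sum_skip[of i N c] i by simp
    have "(\<Sum>j<Suc N. c j *\<^sub>R (ps ! j)) = (\<Sum>j\<in>{..<Suc N} - {i}. c j *\<^sub>R (ps ! j))"
      using i that by (subst sum.remove[of _ i]) auto
    then show "(\<Sum>j<Suc N. c j *\<^sub>R (ps ! j)) = (\<Sum>j<N. c (?s j) *\<^sub>R (remove_nth i ps ! j))"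
      using sum_skip[of i N "\<lambda>j. c j *\<^sub>R (ps ! j)"] i len
      by (simp add: nth_remove_nth)
  qed
  show ?thesis
  proof
    assume "y \<in> convex hull (set (remove_nth i ps))"
    then obtain a where a: "y = (\<Sum>j<N. a j *\<^sub>R (remove_nth i ps ! j))" "\<forall>j<N. 0 \<le> a j" "(\<Sum>j<N. a j) = 1"
      unfolding convex_hull_set_nth l by blast
    define c where "c j = (if j = i then 0 else if j < i then a j else a (j - 1))" for j
    have c: "c i = 0" "\<And>j. c (?s j) = a j" by (auto simp: c_def)
    have "\<forall>j<Suc N. 0 \<le> c j" using a(2) i by (auto simp: c_def)
    then have "?P c" using key(1)[where c=c] key(2)[where c=c] a c by simp
    then show "\<exists>c. ?P c" by blast
  next
    assume "\<exists>c. ?P c"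
    then obtain c where c: "?P c" by blast
    show "y \<in> convex hull (set (remove_nth i ps))"
      unfolding convex_hull_set_nth l using key[where c=c] c
      by (auto intro!: exI[of _ "\<lambda>j. c (?s j)"])
  qed
qed

text \<open>The weights that represent \<open>y\<close> by the n + 2 points form a line with
  direction \<open>\<mu>\<close>. It meets the boundary of the standard simplex in the nondegenerate
  facets whose hulls contain \<open>y\<close>. The sign of \<open>\<mu> i\<close> is the alternating
  sign times the orientation of facet \<open>i\<close>, and it also tells entry from exit; so the
  sum counts entries minus exits.\<close>

proposition chi_cocycle:
  fixes ps :: "(real^'n) list"
  assumes len: "length ps = CARD('n) + 2" and gen: "generic (set ps) y"
  shows "(\<Sum>i<CARD('n) + 2. (-1)^i * chi y (remove_nth i ps)) = 0"
proof (cases "\<forall>m<CARD('n) + 2. vol (remove_nth m ps) = 0")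
  case True then show ?thesis by (intro sum.neutral) (auto simp: chi_def)
next
  case False
  then obtain m where m: "m < CARD('n) + 2" "vol (remove_nth m ps) \<noteq> 0" by auto
  let ?N = "CARD('n) + 2"
  define \<mu> where "\<mu> i = (-1)^i * vol (remove_nth i ps)" for i
  note d = vol_dependency[OF len, folded \<mu>_def]
  obtain l where l: "(\<Sum>i<?N. l i) = 1" "(\<Sum>i<?N. l i *\<^sub>R (ps ! i)) = y"
    using barycentric_exists[OF len m] by blast
  have lin: "(\<Sum>j<?N. l j + t * \<mu> j) = 1" "(\<Sum>j<?N. (l j + t * \<mu> j) *\<^sub>R (ps ! j)) = y" for t
  proof -
    show "(\<Sum>j<?N. l j + t * \<mu> j) = 1" unfolding sum.distrib l d sum_distrib_left[symmetric] by simp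
    have "(\<Sum>j<?N. (l j + t * \<mu> j) *\<^sub>R (ps ! j)) = (\<Sum>j<?N. l j *\<^sub>R (ps ! j)) + t *\<^sub>R (\<Sum>j<?N. \<mu> j *\<^sub>R (ps ! j))"
      by (simp only: scaleR_add_left sum.distrib scaleR_sum_right scaleR_scaleR)
    then show "(\<Sum>j<?N. (l j + t * \<mu> j) *\<^sub>R (ps ! j)) = y" by (simp only: l d) simp
  qed
  have N: "?N = Suc (Suc CARD('n))" by simp
  \<comment> \<open>The line has exactly one point with weight 0 at \<open>i\<close>, at time
    \<open>- l i / \<mu> i\<close>. Facet \<open>i\<close> is nondegenerate, so the weights there
    are the barycentric coordinates of \<open>y\<close> in the facet.\<close>
  have iff: "y \<in> convex hull (set (remove_nth i ps)) \<longleftrightarrow> (\<forall>j<?N. l j + (- l i / \<mu> i) * \<mu> j \<ge> 0)"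
    if i: "i < ?N" "\<mu> i \<noteq> 0" for i
  proof
    assume "y \<in> convex hull (set (remove_nth i ps))"
    then obtain c where c: "c i = 0" "\<forall>j<?N. 0 \<le> c j" "(\<Sum>j<?N. c j) = 1" "(\<Sum>j<?N. c j *\<^sub>R (ps ! j)) = y"
      using convex_hull_remove_nth_iff[of ps "Suc CARD('n)" i y] len i unfolding N by auto
    define e where "e j = c j - (l j + (- l i / \<mu> i) * \<mu> j)" for j
    have "e i = 0" using c(1) i by (simp add: e_def)
    moreover have "(\<Sum>j<?N. e j) = 0" unfolding e_def sum_subtractf c lin by simp
    moreover have "(\<Sum>j<?N. e j *\<^sub>R (ps ! j)) = 0" unfolding e_def scaleR_diff_left sum_subtractf c lin by simp
    moreover have "vol (remove_nth i ps) \<noteq> 0" using i by (simp add: \<mu>_def)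
    ultimately have "e j = 0" if "j < ?N" for j using independent_skip[OF len i(1)] that by blast
    then show "\<forall>j<?N. l j + (- l i / \<mu> i) * \<mu> j \<ge> 0" using c(2) by (simp add: e_def)
  next
    assume J: "\<forall>j<?N. l j + (- l i / \<mu> i) * \<mu> j \<ge> 0"
    show "y \<in> convex hull (set (remove_nth i ps))"
      using convex_hull_remove_nth_iff[of ps "Suc CARD('n)" i y] len i lin J unfolding N
      by (auto intro!: exI[of _ "\<lambda>j. l j + (- l i / \<mu> i) * \<mu> j"] simp del: sum.lessThan_Suc)
  qed
  have "(\<Sum>i<?N. (-1)^i * chi y (remove_nth i ps))
    = (\<Sum>i<?N. sgn (\<mu> i) * (if \<forall>j<?N. l j + (- l i / \<mu> i) * \<mu> j \<ge> 0 then 1 else 0))"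
  proof (rule sum.cong)
    fix i assume "i \<in> {..<?N}"
    then have i: "i < ?N" by simp
    have s: "sgn (\<mu> i) = (-1)^i * sgn (vol (remove_nth i ps))" by (cases "even i") (simp_all add: \<mu>_def)
    show "(-1)^i * chi y (remove_nth i ps) = sgn (\<mu> i) * (if \<forall>j<?N. l j + (- l i / \<mu> i) * \<mu> j \<ge> 0 then 1 else 0)"
    proof (cases "\<mu> i = 0")
      case True then show ?thesis by (simp add: chi_def \<mu>_def)
    next
      case False
      have *: "(-1)^i * (if C then r else 0) = ((-1)^i * r) * (if C then 1 else 0)" for C and r :: real by simp
      show ?thesis unfolding chi_def iff[OF i False] s by (rule *)
    qed
  qed simp
  also have "\<dots> = 0"
  proof (rule line_simplex_count)
    show "(\<Sum>i<?N. \<mu> i) = 0" by (rule d)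
    show "\<exists>j<?N. \<mu> j \<noteq> 0" using m by (auto simp: \<mu>_def)
    fix t i j assume J: "\<forall>j<?N. l j + t * \<mu> j \<ge> 0" and ij: "i < ?N" "j < ?N"
      and z: "l i + t * \<mu> i = 0" "l j + t * \<mu> j = 0"
    \<comment> \<open>Two vanishing weights would place \<open>y\<close> in the hull of the n
      remaining vertices, against genericity.\<close>
    show "i = j"
    proof (rule ccontr)
      assume "i \<noteq> j"
      define S where "S = (\<lambda>k. ps ! k) ` ({..<?N} - {i, j})"
      have "card S \<le> card ({..<?N} - {i, j})" unfolding S_def by (rule card_image_le) simp
      also have "\<dots> = CARD('n)" using ij \<open>i \<noteq> j\<close> by simp
      finally have "card S \<le> CARD('n)" .
      moreover have "S \<subseteq> set ps" using len by (auto simp: S_def)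
      moreover have "finite S" by (simp add: S_def)
      ultimately have "y \<notin> convex hull S" using gen by (auto simp: generic_def)
      moreover have "(\<Sum>k\<in>{..<?N} - {i, j}. (l k + t * \<mu> k) *\<^sub>R (ps ! k)) \<in> convex hull S"
      proof (rule convex_sum)
        have "(\<Sum>k\<in>{..<?N} - {i, j}. l k + t * \<mu> k) = (\<Sum>k<?N. l k + t * \<mu> k)"
          by (rule sum.mono_neutral_left) (use z in auto)
        then show "(\<Sum>k\<in>{..<?N} - {i, j}. l k + t * \<mu> k) = 1" using lin by simp
      qed (use J in \<open>auto simp: S_def intro: hull_inc\<close>)
      moreover have "(\<Sum>k\<in>{..<?N} - {i, j}. (l k + t * \<mu> k) *\<^sub>R (ps ! k)) = (\<Sum>k<?N. (l k + t * \<mu> k) *\<^sub>R (ps ! k))"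
        by (rule sum.mono_neutral_left) (use z in auto)
      ultimately show False using lin by simp
    qed
  qed
  finally show ?thesis .
qed

section \<open>The signed volume under affine maps and flips\<close>

lemma det_mat_dirs:
  fixes A :: "real^'n^'n"
  shows "Determinant.det (mat CARD('n) CARD('n) (\<lambda>(i, j). A $ (dirs ! i) $ (dirs ! j))) = Determinants.det A"
proof -
  let ?n = "CARD('n)" and ?d = "(!) (dirs :: 'n list)"
  let ?M = "mat ?n ?n (\<lambda>(i, j). A $ (?d i) $ (?d j))"
  note bij = bij_betw_dirs[where 'n='n]
  have inj: "inj_on ?d {0..<?n}" and img: "?d ` {0..<?n} = UNIV"
    using bij by (auto simp: bij_betw_def)
  have "Determinant.det ?M = (\<Sum>p | p permutes {0..<?n}. signof p * (\<Prod>i=0..<?n. A $ ?d i $ ?d (p i)))"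
  proof -
    have "(\<Prod>i=0..<?n. ?M $$ (i, p i)) = (\<Prod>i=0..<?n. A $ ?d i $ ?d (p i))" if "p permutes {0..<?n}" for p
      by (intro prod.cong) (use permutes_in_image[OF that] in auto)
    then show ?thesis by (simp add: Determinant.det_def)
  qed
  also have "\<dots> = (\<Sum>q | q permutes (UNIV::'n set). of_int (sign q) * (\<Prod>i\<in>UNIV. A $ i $ q i))"
  proof -
    \<comment> \<open>Conjugation with the enumeration is a bijection between the two permutation
      groups that preserves signs, so the two Leibniz sums agree term by term.\<close>
    have "map_permutation {0..<?n} ?d = (\<lambda>\<pi> x. if x \<in> UNIV then ?d (\<pi> (inv_into {0..<?n} ?d x)) else x)"
      by (intro ext) (simp add: map_permutation_def restrict_id_def img)
    then have bp: "bij_betw (map_permutation {0..<?n} ?d) {p. p permutes {0..<?n}} {q. q permutes (UNIV::'n set)}"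
      using bij_betw_permutations[OF bij] by simp
    have eq: "signof p * (\<Prod>i=0..<?n. A $ ?d i $ ?d (p i))
      = of_int (sign (map_permutation {0..<?n} ?d p)) * (\<Prod>i\<in>UNIV. A $ i $ map_permutation {0..<?n} ?d p i)"
      if "p permutes {0..<?n}" for p
    proof -
      have "(\<Prod>i\<in>UNIV. A $ i $ map_permutation {0..<?n} ?d p i)
        = (\<Prod>i=0..<?n. A $ ?d i $ map_permutation {0..<?n} ?d p (?d i))"
        by (rule prod.reindex_bij_betw[OF bij, symmetric])
      also have "\<dots> = (\<Prod>i=0..<?n. A $ ?d i $ ?d (p i))"
        by (intro prod.cong) (simp_all add: map_permutation_apply[OF inj])
      finally show ?thesis using sign_map_permutation[OF inj that] by simp
    qed
    have "(\<Sum>q | q permutes (UNIV::'n set). of_int (sign q) * (\<Prod>i\<in>UNIV. A $ i $ q i))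
      = (\<Sum>p | p permutes {0..<?n}. of_int (sign (map_permutation {0..<?n} ?d p)) * (\<Prod>i\<in>UNIV. A $ i $ map_permutation {0..<?n} ?d p i))"
      by (rule sum.reindex_bij_betw[OF bp, symmetric])
    then show ?thesis using eq by simp
  qed
  also have "\<dots> = Determinants.det A" by (simp add: Determinants.det_def)
  finally show ?thesis .
qed




text \<open>In homogeneous coordinates an affine map is multiplication from the right by the block
  triangular matrix \<open>B\<close>, whose determinant is that of the transposed linear
  part.\<close>

lemma vol_affine:
  fixes A :: "real^'n^'n"
  assumes len: "length ps = Suc CARD('n)"
  shows "vol (map (\<lambda>x. c + A *v x) ps) = Determinants.det A * vol ps"
proof -
  let ?n = "CARD('n)" let ?N = "Suc ?n"
  define P where "P = mat ?N ?N (\<lambda>(i, j). hcoord (ps ! i) j)"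
  define B where "B = mat ?N ?N (\<lambda>(i, j). if i = 0 then hcoord c j
     else if j = 0 then 0 else A $ (dirs ! (j - 1)) $ (dirs ! (i - 1)))"
  have P: "P \<in> carrier_mat ?N ?N" and B: "B \<in> carrier_mat ?N ?N" by (auto simp: P_def B_def)
  have mv: "(A *v x) $ k = (\<Sum>i<?n. A $ k $ (dirs ! i) * x $ (dirs ! i))" for x k
  proof -
    have "(A *v x) $ k = (\<Sum>l\<in>UNIV. A $ k $ l * x $ l)" by (simp add: matrix_vector_mult_def)
    also have "\<dots> = (\<Sum>i\<in>{0..<?n}. A $ k $ (dirs ! i) * x $ (dirs ! i))"
      by (rule sum.reindex_bij_betw[OF bij_betw_dirs, symmetric])
    finally show ?thesis by (simp add: atLeast0LessThan)
  qed
  have "mat ?N ?N (\<lambda>(i, j). hcoord (map (\<lambda>x. c + A *v x) ps ! i) j) = P * B"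
  proof (rule eq_matI)
    fix i j assume "i < dim_row (P * B)" "j < dim_col (P * B)"
    then have ij: "i < ?N" "j < ?N" by (auto simp: P_def B_def)
    have "(P * B) $$ (i, j) = (\<Sum>k<?N. hcoord (ps ! i) k * B $$ (k, j))"
      using ij P B by (simp add: scalar_prod_def P_def atLeast0LessThan B_def del: sum.lessThan_Suc)
    also have "\<dots> = hcoord (ps ! i) 0 * B $$ (0, j) + (\<Sum>k<?n. hcoord (ps ! i) (Suc k) * B $$ (Suc k, j))"
      by (rule sum.lessThan_Suc_shift)
    also have "\<dots> = hcoord (c + A *v (ps ! i)) j"
      using ij by (cases j) (auto simp: B_def hcoord_def mv mult.commute intro!: sum.cong)
    finally show "mat ?N ?N (\<lambda>(i, j). hcoord (map (\<lambda>x. c + A *v x) ps ! i) j) $$ (i, j) = (P * B) $$ (i, j)"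
      using ij len by simp
  qed (auto simp: P_def B_def)
  then have "vol (map (\<lambda>x. c + A *v x) ps) = Determinant.det P * Determinant.det B"
    unfolding vol_def by (simp only: Determinant.det_mult[OF P B])
  moreover have "Determinant.det B = Determinants.det A"
  proof -
    have "Determinant.det B = (\<Sum>i<?N. B $$ (i,0) * cofactor B i 0)"
      by (rule laplace_expansion_column[OF B]) simp
    also have "\<dots> = B $$ (0,0) * cofactor B 0 0 + (\<Sum>i<?n. B $$ (Suc i,0) * cofactor B (Suc i) 0)"
      by (rule sum.lessThan_Suc_shift)
    also have "\<dots> = cofactor B 0 0" by (simp add: B_def hcoord_def)
    also have "\<dots> = Determinant.det (mat_delete B 0 0)" by (simp add: cofactor_def)
    also have "mat_delete B 0 0 = mat ?n ?n (\<lambda>(i, j). Finite_Cartesian_Product.transpose A $ (dirs ! i) $ (dirs ! j))"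
      by (rule eq_matI) (auto simp: mat_delete_def B_def Finite_Cartesian_Product.transpose_def)
    also have "Determinant.det \<dots> = Determinants.det A" by (simp add: det_mat_dirs)
    finally show ?thesis .
  qed
  ultimately show ?thesis by (simp add: vol_def P_def)
qed

lemma vol_repeated:
  fixes ps :: "(real^'n) list"
  assumes "i < j" "j < Suc CARD('n)" "ps ! i = ps ! j"
  shows "vol ps = 0"
proof -
  have "mat (Suc CARD('n)) (Suc CARD('n)) (\<lambda>(i, j). hcoord (ps ! i) j) \<in> carrier_mat (Suc CARD('n)) (Suc CARD('n))"
    by simp
  then show ?thesis unfolding vol_def
    by (rule Determinant.det_identical_rows[of _ _ i j]) (use assms in \<open>auto intro!: eq_vecI\<close>)
qed

text \<open>The relation \<open>a - b - c + d = 0\<close> is an affine dependency of the n + 2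
  points with equal coefficients at \<open>b\<close> and \<open>c\<close>. The facets opposite to
  these two neighbours therefore have opposite orientations. Kuhn simplices of words that differ by
  an adjacent swap are related by such a flip.\<close>

lemma vol_parallelogram:
  fixes us vs :: "(real^'n) list"
  assumes len: "length us + length vs + 3 = Suc CARD('n)" and "a + d = b + c"
  shows "vol (us @ [a, b, d] @ vs) = - vol (us @ [a, c, d] @ vs)"
proof -
  let ?k = "length us"
  let ?ps = "us @ [a, b, c, d] @ vs"
  have l: "length ?ps = CARD('n) + 2" using len by simp
  define e where "e i = (if i = ?k \<or> i = ?k + 3 then 1 else if i = ?k + 1 \<or> i = ?k + 2 then - 1 else (0::real))" for i
  have sub: "{?k, ?k+1, ?k+2, ?k+3} \<subseteq> {..<CARD('n) + 2}" using len by auto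
  have z: "e i = 0" if "i \<notin> {?k, ?k+1, ?k+2, ?k+3}" for i using that by (auto simp: e_def)
  have "(\<Sum>i<CARD('n) + 2. e i) = (\<Sum>i\<in>{?k, ?k+1, ?k+2, ?k+3}. e i)"
    by (rule sum.mono_neutral_right) (use sub z in auto)
  then have 1: "(\<Sum>i<CARD('n) + 2. e i) = 0" by (simp add: e_def)
  have "(\<Sum>i<CARD('n) + 2. e i *\<^sub>R (?ps ! i)) = (\<Sum>i\<in>{?k, ?k+1, ?k+2, ?k+3}. e i *\<^sub>R (?ps ! i))"
    by (rule sum.mono_neutral_right) (use sub z in auto)
  also have "\<dots> = a - b - c + d" by (simp add: e_def nth_append)
  finally have 2: "(\<Sum>i<CARD('n) + 2. e i *\<^sub>R (?ps ! i)) = 0" using assms(2) by (simp add: algebra_simps)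
  have r: "remove_nth (?k + 1) ?ps = us @ [a, c, d] @ vs" "remove_nth (?k + 2) ?ps = us @ [a, b, d] @ vs"
    by (auto simp: remove_nth_def)
  have "e (?k + 1) * ((-1)^(?k + 2) * vol (remove_nth (?k + 2) ?ps)) = e (?k + 2) * ((-1)^(?k + 1) * vol (remove_nth (?k + 1) ?ps))"
    by (rule dependency_proportional[OF l 1 2]) (use len in auto)
  then show ?thesis unfolding r by (cases "even (length us)") (simp_all add: e_def)
qed

section \<open>Signed words and lattice paths\<close>

text \<open>The order of the letters is arbitrary; only the change of sign under adjacent swaps matters.\<close>

primrec wsign :: "'l::countable list \<Rightarrow> real" where
  "wsign [] = 1"
| "wsign (x # xs) = (-1) ^ card {y \<in> set xs. to_nat y < to_nat x} * wsign xs"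

lemma wsign_swap:
  fixes x y :: "'l::countable"
  assumes "distinct (u @ x # y # v)"
  shows "wsign (u @ y # x # v) = - wsign (u @ x # y # v)"
  using assms
proof (induction u)
  case Nil
  have c: "card {z. (z = a \<or> z \<in> set v) \<and> to_nat z < to_nat b}
    = (if to_nat a < to_nat b then 1 else 0) + card {z \<in> set v. to_nat z < to_nat b}"
    if "a \<notin> set v" for a b :: 'l
  proof (cases "to_nat a < to_nat b")
    case True
    then have "{z. (z = a \<or> z \<in> set v) \<and> to_nat z < to_nat b} = insert a {z \<in> set v. to_nat z < to_nat b}" by auto
    then show ?thesis using that True by simp
  next
    case False
    then have "{z. (z = a \<or> z \<in> set v) \<and> to_nat z < to_nat b} = {z \<in> set v. to_nat z < to_nat b}" by auto
    then show ?thesis using False by simp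
  qed
  have "to_nat x \<noteq> to_nat y" using Nil by simp
  then consider "to_nat x < to_nat y" | "to_nat y < to_nat x" by linarith
  then show ?case using Nil by cases (simp_all add: c)
next
  case (Cons a u)
  have "set (u @ y # x # v) = set (u @ x # y # v)" by auto
  then show ?case using Cons by simp
qed

lemma wsign_move:
  "distinct (x # w) \<Longrightarrow> wsign (x # w) = (-1) ^ length w * wsign (w @ [x])"
proof (induction w)
  case (Cons y w)
  have "distinct ([] @ y # x # w)" using Cons.prems by auto
  then have "wsign (x # y # w) = - wsign (y # x # w)" by (metis wsign_swap append_Nil)
  also have "\<dots> = - ((-1) ^ card {z \<in> set (x # w). to_nat z < to_nat y} * ((-1) ^ length w * wsign (w @ [x])))"
    using Cons by simp
  also have "set (x # w) = set (w @ [x])" by auto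
  finally show ?case by simp
qed simp

lemma wsign_nonzero: "wsign w \<noteq> 0" "\<bar>wsign w\<bar> = 1"
  by (induction w) (auto simp: abs_mult)

lemma wsign_square: "wsign w * wsign w = 1"
  using wsign_nonzero(2)[of w] by (metis abs_mult_self_eq mult_1)

text \<open>The letters are added one by one, so a word that lists all letters once traces a maximal
  chain of subsets. Its values are the vertices of one simplex in the Kuhn triangulation of the cube
  with corners \<open>V T\<close>.\<close>

primrec vertex_path :: "('l set \<Rightarrow> 'a) \<Rightarrow> 'l set \<Rightarrow> 'l list \<Rightarrow> 'a list" where
  "vertex_path V S [] = [V S]"
| "vertex_path V S (x # xs) = V S # vertex_path V (insert x S) xs"

lemma length_vertex_path [simp]: "length (vertex_path V S w) = Suc (length w)"
  by (induction w arbitrary: S) auto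

lemma vertex_path_not_Nil [simp]: "vertex_path V S w \<noteq> []"
  by (cases w) auto

lemma vertex_path_append: "vertex_path V S (u @ v) = butlast (vertex_path V S u) @ vertex_path V (S \<union> set u) v"
  by (induction u arbitrary: S) (auto simp: Un_insert_right)

lemma vertex_path_butlast: "vertex_path V S w = butlast (vertex_path V S w) @ [V (S \<union> set w)]"
  using vertex_path_append[of V S w "[]"] by simp

lemma vertex_path_cong:
  "(\<And>T. S \<subseteq> T \<Longrightarrow> T \<subseteq> S \<union> set w \<Longrightarrow> V T = W T) \<Longrightarrow> vertex_path V S w = vertex_path W S w"
proof (induction w arbitrary: S)
  case (Cons x w)
  have "V S = W S" by (rule Cons.prems) auto
  moreover have "vertex_path V (insert x S) w = vertex_path W (insert x S) w"
    by (rule Cons.IH, rule Cons.prems) auto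
  ultimately show ?case by simp
qed auto

lemma vertex_path_map: "map f (vertex_path V S w) = vertex_path (\<lambda>T. f (V T)) S w"
  by (induction w arbitrary: S) auto

lemma set_vertex_path_subset: "(\<And>T. S \<subseteq> T \<Longrightarrow> T \<subseteq> S \<union> set w \<Longrightarrow> V T \<in> X) \<Longrightarrow> set (vertex_path V S w) \<subseteq> X"
proof (induction w arbitrary: S)
  case (Cons x w)
  have "V S \<in> X" by (rule Cons.prems) auto
  moreover have "set (vertex_path V (insert x S) w) \<subseteq> X"
    by (rule Cons.IH, rule Cons.prems) auto
  ultimately show ?case by simp
qed auto

lemma vertex_path_insert_shift:
  "vertex_path V (insert i S) w = vertex_path (\<lambda>T. V (insert i T)) S w"
  by (induction w arbitrary: S) (simp_all, metis insert_commute)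

lemma vertex_path_relabel:
  "vertex_path V (f ` S) (map f w) = vertex_path (\<lambda>T. V (f ` T)) S w"
  by (induction w arbitrary: S) (auto simp flip: image_insert)

lemma remove_nth_path_interior:
  "remove_nth (Suc (length u)) (vertex_path V S (u @ x # y # v))
    = butlast (vertex_path V S u) @ V (S \<union> set u) # vertex_path V (insert y (insert x (S \<union> set u))) v"
  by (simp add: vertex_path_append remove_nth_def)

lemma sum_permutations_Cons:
  assumes "finite A" "A \<noteq> {}"
  shows "(\<Sum>w\<in>permutations_of_set A. f w) = (\<Sum>x\<in>A. \<Sum>w\<in>permutations_of_set (A - {x}). f (x # w))"
proof -
  have "(\<Sum>w\<in>permutations_of_set A. f w) = (\<Sum>x\<in>A. \<Sum>w\<in>(#) x ` permutations_of_set (A - {x}). f w)"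
    unfolding permutations_of_set_nonempty[OF assms(2)]
    by (rule sum.UNION_disjoint) (use assms in auto)
  also have "\<dots> = (\<Sum>x\<in>A. \<Sum>w\<in>permutations_of_set (A - {x}). f (x # w))"
    by (rule sum.cong[OF refl]) (simp add: sum.reindex)
  finally show ?thesis .
qed

lemma sum_permutations_rev:
  "(\<Sum>w\<in>permutations_of_set A. f w) = (\<Sum>w\<in>permutations_of_set A. f (rev w))"
  by (rule sum.reindex_bij_witness[where i=rev and j=rev]) (auto simp: permutations_of_set_def)

lemma sum_permutations_snoc:
  assumes "finite A" "A \<noteq> {}"
  shows "(\<Sum>w\<in>permutations_of_set A. f w) = (\<Sum>x\<in>A. \<Sum>w\<in>permutations_of_set (A - {x}). f (w @ [x]))"
  by (subst sum_permutations_rev, subst sum_permutations_Cons[OF assms])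
     (simp add: sum_permutations_rev[of "\<lambda>w. f (w @ [_])"])

text \<open>Removing an interior vertex of a path gives the same list for the two words that differ by an
  adjacent swap, and these have opposite signs. So only the first and the last vertex contribute.\<close>

proposition signed_paths_boundary:
  fixes V :: "'l::finite set \<Rightarrow> 'a" and c :: "'a list \<Rightarrow> real"
  assumes cocycle: "\<And>w. w \<in> permutations_of_set UNIV \<Longrightarrow>
      (\<Sum>t\<le>CARD('l). (-1)^t * c (remove_nth t (vertex_path V {} w))) = 0"
  shows "(\<Sum>i\<in>UNIV. \<Sum>w\<in>permutations_of_set (UNIV - {i}).
      wsign (i # w) * (c (vertex_path V {i} w) - c (vertex_path V {} w))) = 0"
proof -
  let ?P = "permutations_of_set (UNIV :: 'l set)"
  let ?N = "CARD('l)"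
  define f where "f t w = wsign w * ((-1)^t * c (remove_nth t (vertex_path V {} w)))" for t and w :: "'l list"
  have len: "length w = ?N" and dist: "distinct w" and setw: "set w = UNIV" if "w \<in> ?P" for w
    using that by (auto simp: permutations_of_set_def distinct_card[symmetric])
  have interior: "(\<Sum>w\<in>?P. f (Suc t) w) = 0" if t: "Suc t < ?N" for t
  proof -
    define sw where "sw w = take t w @ [w ! Suc t, w ! t] @ drop (Suc (Suc t)) w" for w :: "'l list"
    have ex: "\<exists>u x y v. w = u @ x # y # v \<and> length u = t" if "w \<in> ?P" for w
      using t len[OF that] id_take_nth_drop[of t w] Cons_nth_drop_Suc[of "Suc t" w]
      by (metis Suc_lessD length_take min.absorb4)
    have swp: "sw (u @ x # y # v) = u @ y # x # v" if "length u = t" for u x y v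
      using that by (simp add: sw_def nth_append)
    have inP: "sw w \<in> ?P" "sw (sw w) = w" "f (Suc t) (sw w) = - f (Suc t) w" if w: "w \<in> ?P" for w
    proof -
      obtain u x y v where e: "w = u @ x # y # v" "length u = t" using ex[OF w] by blast
      have s: "sw w = u @ y # x # v" using swp e by simp
      show "sw w \<in> ?P" using w unfolding s unfolding e by (auto simp: permutations_of_set_def)
      show "sw (sw w) = w" unfolding s using swp[OF e(2)] e by simp
      have "wsign (sw w) = - wsign w" using wsign_swap[of u x y v] dist[OF w] unfolding s unfolding e(1) by simp
      moreover have "remove_nth (Suc t) (vertex_path V {} (sw w)) = remove_nth (Suc t) (vertex_path V {} w)"
        unfolding s unfolding e(1) using remove_nth_path_interior[of u V "{}"] e(2) by (simp add: insert_commute)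
      ultimately show "f (Suc t) (sw w) = - f (Suc t) w" by (simp add: f_def)
    qed
    have "(\<Sum>w\<in>?P. f (Suc t) w) = (\<Sum>w\<in>?P. f (Suc t) (sw w))"
      by (rule sum.reindex_bij_witness[where i=sw and j=sw]) (use inP in auto)
    also have "\<dots> = - (\<Sum>w\<in>?P. f (Suc t) w)" using inP by (simp add: sum_negf)
    finally show ?thesis by simp
  qed
  have N: "?N \<ge> 1" by (simp add: Suc_le_eq)
  have "(\<Sum>t\<le>?N. \<Sum>w\<in>?P. f t w) = (\<Sum>w\<in>?P. wsign w * (\<Sum>t\<le>?N. (-1)^t * c (remove_nth t (vertex_path V {} w))))"
    by (subst sum.swap) (simp only: f_def sum_distrib_left)
  also have "\<dots> = 0" using cocycle by simp
  finally have "(\<Sum>t\<le>?N. \<Sum>w\<in>?P. f t w) = 0" .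
  moreover have "(\<Sum>t\<le>?N. \<Sum>w\<in>?P. f t w) = (\<Sum>t\<in>{0, ?N}. \<Sum>w\<in>?P. f t w)"
  proof (rule sum.mono_neutral_right)
    show "\<forall>t\<in>{..?N} - {0, ?N}. (\<Sum>w\<in>?P. f t w) = 0"
    proof
      fix t assume "t \<in> {..?N} - {0, ?N}"
      then obtain t' where "t = Suc t'" "Suc t' < ?N" by (cases t) auto
      then show "(\<Sum>w\<in>?P. f t w) = 0" using interior by simp
    qed
  qed auto
  ultimately have 0: "(\<Sum>w\<in>?P. f 0 w) + (\<Sum>w\<in>?P. f ?N w) = 0" using N by auto
  \<comment> \<open>Without its first vertex, a path that begins with the letter \<open>i\<close>
    lies in the face of the cube where \<open>i\<close> is present.\<close>
  have first: "(\<Sum>w\<in>?P. f 0 w) = (\<Sum>i\<in>UNIV. \<Sum>w\<in>permutations_of_set (UNIV - {i}). wsign (i # w) * c (vertex_path V {i} w))"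
    by (subst sum_permutations_Cons) (simp_all add: f_def remove_nth_def)
  \<comment> \<open>Without its last vertex, a path that ends with \<open>i\<close> lies in the face
    where \<open>i\<close> is absent. The factor (-1)^N and the factor (-1)^(N - 1) from moving
    \<open>i\<close> to the front combine to -1.\<close>
  have last: "(\<Sum>w\<in>?P. f ?N w) = - (\<Sum>i\<in>UNIV. \<Sum>w\<in>permutations_of_set (UNIV - {i}). wsign (i # w) * c (vertex_path V {} w))"
  proof -
    have "f ?N (w @ [i]) = - (wsign (i # w) * c (vertex_path V {} w))" if w: "w \<in> permutations_of_set (UNIV - {i})" for i :: 'l and w
    proof -
      have d: "distinct (i # w)" and l: "?N = Suc (length w)"
        using w by (auto simp: permutations_of_set_def distinct_card[symmetric] card_Suc_Diff1)
      have "vertex_path V {} (w @ [i]) = vertex_path V {} w @ [V (insert i (set w))]"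
        using vertex_path_butlast[of V "{}" w] by (simp add: vertex_path_append)
      then have "remove_nth ?N (vertex_path V {} (w @ [i])) = vertex_path V {} w"
        using l by (simp add: remove_nth_def)
      then show ?thesis using wsign_move[OF d] l
        by (cases "even (length w)") (simp_all add: f_def)
    qed
    then show ?thesis by (subst sum_permutations_snoc) (simp_all add: sum_negf)
  qed
  show ?thesis using 0 unfolding first last by (simp add: right_diff_distrib sum_subtractf)
qed

section \<open>The degree of a map on a grid cube\<close>

definition corner :: "int^'n \<Rightarrow> 'n set \<Rightarrow> int^'n" where
  "corner z S = (\<chi> i. z $ i + (if i \<in> S then 1 else 0))"

text \<open>The factor that makes the identity have degree \<open>1\<close> on every cube.\<close>

definition orient :: "'n::finite itself \<Rightarrow> real" where
  "orient _ = wsign (None # map Some (dirs :: 'n list))"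

text \<open>Each of the n! words is a Kuhn simplex of the cube. The letter \<open>None\<close>
  enters only the sign, so that the sum matches the \<open>None\<close> part of the boundary of the
  prism over the cube.\<close>

definition cube_degree :: "(int^'n \<Rightarrow> real^'n) \<Rightarrow> int^'n \<Rightarrow> real^'n \<Rightarrow> real" where
  "cube_degree a z y = (\<Sum>w\<in>permutations_of_set (UNIV - {None :: 'n option}).
     orient TYPE('n) * wsign (None # w) * chi y (vertex_path (\<lambda>S. a (corner z (Some -` S))) {} w))"

text \<open>The letter \<^const>\<open>None\<close> is the direction of the homotopy from \<open>a\<close> to \<open>b\<close>.\<close>

definition prism_vertex :: "(int^'n \<Rightarrow> 'b) \<Rightarrow> (int^'n \<Rightarrow> 'b) \<Rightarrow> int^'n \<Rightarrow> 'n option set \<Rightarrow> 'b" where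
  "prism_vertex a b z S = (if None \<in> S then b else a) (corner z (Some -` S))"

text \<open>The words omit \<open>Some j\<close> but contain \<open>None\<close>: they triangulate
  the prism over the lower face normal to \<open>j\<close>. The minus sign turns the change of
  \<open>cube_degree\<close> into a discrete divergence.\<close>

definition face_flux :: "'n \<Rightarrow> (int^'n \<Rightarrow> real^'n) \<Rightarrow> (int^'n \<Rightarrow> real^'n) \<Rightarrow> int^'n \<Rightarrow> real^'n \<Rightarrow> real" where
  "face_flux j a b z y = (\<Sum>w\<in>permutations_of_set (UNIV - {Some j}).
     - (orient TYPE('n) * wsign (Some j # w)) * chi y (vertex_path (prism_vertex a b z) {} w))"

definition unit_step :: "'n \<Rightarrow> int^'n" where
  "unit_step j = (\<chi> i. if i = j then 1 else 0)"

lemma corner_insert: "j \<notin> S \<Longrightarrow> corner z (insert j S) = corner (z + unit_step j) S"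
  by (auto simp: corner_def unit_step_def Finite_Cartesian_Product.vec_eq_iff)

text \<open>The words over all n + 1 letters triangulate the prism over the cube, and the boundary
  sum vanishes. The letter \<open>None\<close> yields bottom and top, the letter
  \<open>Some j\<close> the two walls normal to \<open>j\<close>; the far wall is the near wall of
  the neighbour \<open>z + unit_step j\<close>.\<close>

lemma cube_degree_diff:
  fixes a b :: "int^'n \<Rightarrow> real^'n"
  assumes gen: "generic (a ` range (corner z) \<union> b ` range (corner z)) y"
  shows "cube_degree b z y - cube_degree a z y
    = (\<Sum>j\<in>UNIV. face_flux j a b (z + unit_step j) y - face_flux j a b z y)"
proof -
  let ?V = "prism_vertex a b z"
  let ?P = "\<lambda>i. permutations_of_set (UNIV - {i :: 'n option})"
  have co: "CARD('n option) = Suc CARD('n)" by simp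
  have "(\<Sum>i\<in>UNIV. \<Sum>w\<in>?P i. wsign (i # w) * (chi y (vertex_path ?V {i} w) - chi y (vertex_path ?V {} w))) = 0"
  proof (rule signed_paths_boundary)
    fix w assume "w \<in> permutations_of_set (UNIV :: 'n option set)"
    then have l: "length (vertex_path ?V {} w) = CARD('n) + 2"
      using co by (auto simp: permutations_of_set_def distinct_card[symmetric])
    have "set (vertex_path ?V {} w) \<subseteq> a ` range (corner z) \<union> b ` range (corner z)"
      by (rule set_vertex_path_subset) (auto simp: prism_vertex_def)
    then have "generic (set (vertex_path ?V {} w)) y" using gen by (auto simp: generic_def)
    from chi_cocycle[OF l this]
    show "(\<Sum>t\<le>CARD('n option). (-1)^t * chi y (remove_nth t (vertex_path ?V {} w))) = 0"
      using co by (simp add: lessThan_Suc_atMost[symmetric])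
  qed
  then have 0: "orient TYPE('n) * (\<Sum>i\<in>UNIV. \<Sum>w\<in>?P i. wsign (i # w) * (chi y (vertex_path ?V {i} w) - chi y (vertex_path ?V {} w))) = 0"
    by simp
  have U: "(UNIV :: 'n option set) = insert None (range Some)" by (rule UNIV_option_conv)
  have split: "(\<Sum>i\<in>UNIV. h i) = h None + (\<Sum>j\<in>UNIV. h (Some j))" for h :: "'n option \<Rightarrow> real"
    unfolding U by (subst sum.insert) (auto simp: sum.reindex)
  have N: "vertex_path ?V {None} w = vertex_path (\<lambda>S. b (corner z (Some -` S))) {} w"
    "vertex_path ?V {} w = vertex_path (\<lambda>S. a (corner z (Some -` S))) {} w" if "w \<in> ?P None" for w
  proof -
    have "vertex_path ?V {None} w = vertex_path (\<lambda>T. ?V (insert None T)) {} w" by (rule vertex_path_insert_shift)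
    also have "\<dots> = vertex_path (\<lambda>S. b (corner z (Some -` S))) {} w"
      by (rule vertex_path_cong) (auto simp: prism_vertex_def vimage_def)
    finally show "vertex_path ?V {None} w = vertex_path (\<lambda>S. b (corner z (Some -` S))) {} w" .
    show "vertex_path ?V {} w = vertex_path (\<lambda>S. a (corner z (Some -` S))) {} w"
      by (rule vertex_path_cong) (use that in \<open>auto simp: prism_vertex_def permutations_of_set_def\<close>)
  qed
  have S: "vertex_path ?V {Some j} w = vertex_path (prism_vertex a b (z + unit_step j)) {} w" if w: "w \<in> ?P (Some j)" for w j
  proof -
    have "vertex_path ?V {Some j} w = vertex_path (\<lambda>T. ?V (insert (Some j) T)) {} w" by (rule vertex_path_insert_shift)
    also have "\<dots> = vertex_path (prism_vertex a b (z + unit_step j)) {} w"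
    proof (rule vertex_path_cong)
      fix T :: "'n option set" assume "T \<subseteq> {} \<union> set w"
      then have "Some j \<notin> T" using w by (auto simp: permutations_of_set_def)
      then have "j \<notin> Some -` T" by simp
      moreover have "Some -` insert (Some j) T = insert j (Some -` T)" by auto
      ultimately show "?V (insert (Some j) T) = prism_vertex a b (z + unit_step j) T"
        by (simp add: prism_vertex_def corner_insert)
    qed
    finally show ?thesis .
  qed
  have 1: "orient TYPE('n) * (\<Sum>w\<in>?P None. wsign (None # w) * (chi y (vertex_path ?V {None} w) - chi y (vertex_path ?V {} w)))
     = cube_degree b z y - cube_degree a z y"
    unfolding cube_degree_def sum_subtractf[symmetric] sum_distrib_left
    by (rule sum.cong[OF refl]) (simp add: N algebra_simps)
  have 2: "orient TYPE('n) * (\<Sum>w\<in>?P (Some j). wsign (Some j # w) * (chi y (vertex_path ?V {Some j} w) - chi y (vertex_path ?V {} w)))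
     = - (face_flux j a b (z + unit_step j) y - face_flux j a b z y)" for j
    unfolding face_flux_def sum_subtractf[symmetric] sum_distrib_left sum_negf[symmetric]
    by (rule sum.cong[OF refl]) (simp add: S algebra_simps)
  show ?thesis using 0 unfolding split distrib_left 1 sum_distrib_left[of _ _ UNIV] 2 by (simp add: sum_subtractf)
qed

text \<open>A discrete divergence theorem in one direction: contributions of cells common to
  \<open>Z\<close> and its translate cancel, and boundary faces remain.\<close>

lemma sum_shift_diff:
  fixes g :: "'a::ab_group_add \<Rightarrow> real"
  assumes "finite Z"
  shows "(\<Sum>z\<in>Z. g (z + e) - g z) = (\<Sum>z\<in>(\<lambda>z. z + e) ` Z - Z. g z) - (\<Sum>z\<in>Z - (\<lambda>z. z + e) ` Z. g z)"
proof -
  let ?Y = "(\<lambda>z. z + e) ` Z"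
  have fY: "finite ?Y" using assms by simp
  have "(\<Sum>z\<in>Z. g (z + e)) = (\<Sum>z\<in>?Y. g z)" by (simp add: sum.reindex)
  moreover have "(\<Sum>z\<in>?Y. g z) = (\<Sum>z\<in>?Y - Z. g z) + (\<Sum>z\<in>?Y \<inter> Z. g z)"
    using sum.Int_Diff[OF fY, of g Z] by simp
  moreover have "(\<Sum>z\<in>Z. g z) = (\<Sum>z\<in>Z - ?Y. g z) + (\<Sum>z\<in>?Y \<inter> Z. g z)"
    using sum.Int_Diff[OF assms, of g ?Y] by (simp add: Int_commute)
  ultimately show ?thesis by (simp add: sum_subtractf)
qed

definition face_corners :: "'n \<Rightarrow> int^'n \<Rightarrow> (int^'n) set" where
  "face_corners j z = corner z ` {S. j \<notin> S}"

lemma face_corners_subset: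
  shows "face_corners j z \<subseteq> range (corner z)" and "face_corners j (z + unit_step j) \<subseteq> range (corner z)"
proof -
  show "face_corners j z \<subseteq> range (corner z)" unfolding face_corners_def by (rule image_mono) simp
  show "face_corners j (z + unit_step j) \<subseteq> range (corner z)"
  proof
    fix q assume "q \<in> face_corners j (z + unit_step j)"
    then obtain S where "j \<notin> S" "q = corner (z + unit_step j) S" unfolding face_corners_def by blast
    then have "q = corner z (insert j S)" by (simp only: corner_insert not_False_eq_True)
    then show "q \<in> range (corner z)" by (rule range_eqI)
  qed
qed

lemma cube_degree_zero:
  assumes "y \<notin> convex hull (a ` range (corner z))"
  shows "cube_degree a z y = 0"
  unfolding cube_degree_def
proof (intro sum.neutral ballI)
  fix w :: "'a option list"
  have "set (vertex_path (\<lambda>S. a (corner z (Some -` S))) {} w) \<subseteq> a ` range (corner z)"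
    by (rule set_vertex_path_subset) auto
  then have "y \<notin> convex hull (set (vertex_path (\<lambda>S. a (corner z (Some -` S))) {} w))"
    using assms hull_mono by blast
  then show "orient TYPE('a) * wsign (None # w) * chi y (vertex_path (\<lambda>S. a (corner z (Some -` S))) {} w) = 0"
    by (simp add: chi_def)
qed

lemma set_prism_path_subset:
  assumes "w \<in> permutations_of_set (UNIV - {Some j})"
  shows "set (vertex_path (prism_vertex a b z) {} w) \<subseteq> a ` face_corners j z \<union> b ` face_corners j z"
proof (rule set_vertex_path_subset)
  fix T :: "'a option set" assume "T \<subseteq> {} \<union> set w"
  then have "j \<notin> Some -` T" using assms by (auto simp: permutations_of_set_def)
  then show "prism_vertex a b z T \<in> a ` face_corners j z \<union> b ` face_corners j z"
    by (auto simp: prism_vertex_def face_corners_def)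
qed

lemma face_flux_zero:
  assumes "y \<notin> convex hull (a ` face_corners j z \<union> b ` face_corners j z)"
  shows "face_flux j a b z y = 0"
  unfolding face_flux_def
proof (intro sum.neutral ballI)
  fix w assume "w \<in> permutations_of_set (UNIV - {Some j})"
  then have "set (vertex_path (prism_vertex a b z) {} w) \<subseteq> a ` face_corners j z \<union> b ` face_corners j z"
    by (rule set_prism_path_subset)
  then have "y \<notin> convex hull (set (vertex_path (prism_vertex a b z) {} w))"
    using assms hull_mono by blast
  then show "- (orient TYPE('a) * wsign (Some j # w)) * chi y (vertex_path (prism_vertex a b z) {} w) = 0"
    by (simp add: chi_def)
qed

lemma sum_cube_degree_diff:
  fixes a b :: "int^'n \<Rightarrow> real^'n"
  assumes "finite Z" and gen: "\<And>z. z \<in> Z \<Longrightarrow> generic (a ` range (corner z) \<union> b ` range (corner z)) y"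
  shows "(\<Sum>z\<in>Z. cube_degree b z y) - (\<Sum>z\<in>Z. cube_degree a z y)
    = (\<Sum>j\<in>UNIV. (\<Sum>z\<in>(\<lambda>z. z + unit_step j) ` Z - Z. face_flux j a b z y)
        - (\<Sum>z\<in>Z - (\<lambda>z. z + unit_step j) ` Z. face_flux j a b z y))"
proof -
  have "(\<Sum>z\<in>Z. cube_degree b z y) - (\<Sum>z\<in>Z. cube_degree a z y)
    = (\<Sum>z\<in>Z. \<Sum>j\<in>UNIV. face_flux j a b (z + unit_step j) y - face_flux j a b z y)"
    unfolding sum_subtractf[symmetric] by (intro sum.cong refl cube_degree_diff gen)
  also have "\<dots> = (\<Sum>j\<in>UNIV. \<Sum>z\<in>Z. face_flux j a b (z + unit_step j) y - face_flux j a b z y)"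
    by (rule sum.swap)
  finally show ?thesis
    unfolding sum_shift_diff[OF assms(1), where g="\<lambda>z. face_flux _ a b z y"] .
qed

text \<open>Discrete homotopy invariance. The flux through a boundary face is a sum over simplices
  with vertices in a set whose hull misses \<open>y\<close>, hence zero.\<close>

proposition cube_degree_homotopy:
  fixes a b :: "int^'n \<Rightarrow> real^'n"
  assumes fin: "finite Z" and gen: "\<And>z. z \<in> Z \<Longrightarrow> generic (a ` range (corner z) \<union> b ` range (corner z)) y"
    and low: "\<And>z j. z \<in> Z \<Longrightarrow> z - unit_step j \<notin> Z \<Longrightarrow> y \<notin> convex hull (a ` face_corners j z \<union> b ` face_corners j z)"
    and high: "\<And>z j. z \<in> Z \<Longrightarrow> z + unit_step j \<notin> Z \<Longrightarrow>
       y \<notin> convex hull (a ` face_corners j (z + unit_step j) \<union> b ` face_corners j (z + unit_step j))"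
  shows "(\<Sum>z\<in>Z. cube_degree b z y) = (\<Sum>z\<in>Z. cube_degree a z y)"
proof -
  have "face_flux j a b z y = 0" if "z \<in> (\<lambda>z. z + unit_step j) ` Z - Z" for j z
    using that high by (intro face_flux_zero) auto
  moreover have "face_flux j a b z y = 0" if z: "z \<in> Z - (\<lambda>z. z + unit_step j) ` Z" for j z
  proof -
    have "z - unit_step j \<notin> Z"
    proof
      assume "z - unit_step j \<in> Z"
      then have "z - unit_step j + unit_step j \<in> (\<lambda>z. z + unit_step j) ` Z" by blast
      then show False using z by simp
    qed
    then show ?thesis using z low by (intro face_flux_zero) auto
  qed
  ultimately show ?thesis using sum_cube_degree_diff[OF fin gen] by simp
qed

section \<open>Kuhn triangulations and affine maps\<close>

definition emb :: "int^'n \<Rightarrow> real^'n" where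
  "emb z = (\<chi> i. real_of_int (z $ i))"

definition ind :: "'n set \<Rightarrow> real^'n" where
  "ind S = (\<chi> i. if i \<in> S then 1 else 0)"

lemma emb_corner: "emb (corner z S) = emb z + ind S"
  by (auto simp: emb_def ind_def corner_def Finite_Cartesian_Product.vec_eq_iff)

section \<open>Orientation and position of the Kuhn simplices\<close>

lemma nth_vertex_path: "t \<le> length w \<Longrightarrow> vertex_path V S w ! t = V (S \<union> set (take t w))"
  by (induction w arbitrary: S t) (auto simp: nth_Cons split: nat.split)

text \<open>The path adds the coordinates in the order of the columns, so the matrix is lower
  triangular with ones on the diagonal.\<close>

lemma vol_vertex_path_dirs: "vol (vertex_path ind {} (dirs :: 'n::finite list)) = 1"
proof -
  let ?N = "Suc CARD('n)"
  let ?M = "mat ?N ?N (\<lambda>(i, j). hcoord (vertex_path ind {} (dirs :: 'n list) ! i) j)"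
  have e: "hcoord (vertex_path ind {} (dirs :: 'n list) ! i) j = (if j \<le> i then 1 else 0)"
    if "i < ?N" "j < ?N" for i j
  proof (cases j)
    case (Suc k)
    have k: "k < length (dirs :: 'n list)" using that Suc by (simp add: length_dirs)
    have "dirs ! k \<in> set (take i (dirs :: 'n list)) \<longleftrightarrow> k < i"
    proof
      assume "dirs ! k \<in> set (take i (dirs :: 'n list))"
      then obtain m where "m < i" "m < length (dirs :: 'n list)" "dirs ! m = (dirs ! k :: 'n)"
        by (auto simp: in_set_conv_nth)
      then show "k < i" using nth_eq_iff_index_eq[OF distinct_dirs[where 'n='n]] k by metis
    next
      assume "k < i"
      then show "dirs ! k \<in> set (take i (dirs :: 'n list))" using k
        by (auto simp: in_set_conv_nth intro!: exI[of _ k])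
    qed
    then show ?thesis using that Suc by (simp add: hcoord_def nth_vertex_path length_dirs ind_def Suc_le_eq)
  qed (simp add: hcoord_def)
  have M: "?M \<in> carrier_mat ?N ?N" by simp
  have "Determinant.det ?M = prod_list (diag_mat ?M)"
    by (rule Determinant.det_lower_triangular[OF _ M]) (simp add: e)
  also have "\<dots> = 1" by (simp add: prod_list_diag_prod e)
  finally show ?thesis by (simp add: vol_def)
qed

text \<open>Sorting by adjacent swaps: the letter \<open>x\<close> is moved to its place right
  behind the prefix \<open>p\<close>, and the induction continues with the longer prefix.\<close>

lemma adjacent_swap_invariant:
  assumes inv: "\<And>u x y v. distinct (u @ x # y # v) \<Longrightarrow> set (u @ x # y # v) = A \<Longrightarrow> f (u @ x # y # v) = f (u @ y # x # v)"
  shows "distinct (p @ w) \<Longrightarrow> set (p @ w) = A \<Longrightarrow> distinct w' \<Longrightarrow> set w' = set w \<Longrightarrow> f (p @ w) = f (p @ w')"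
proof (induction w arbitrary: p w')
  case (Cons x w)
  have move: "f (p @ u @ x # v) = f (p @ x # u @ v)" if "distinct (p @ u @ x # v)" "set (p @ u @ x # v) = A" for u v
    using that
  proof (induction u arbitrary: v rule: rev_induct)
    case (snoc y u)
    have "f ((p @ u) @ y # x # v) = f ((p @ u) @ x # y # v)" by (rule inv) (use snoc.prems in auto)
    also have "\<dots> = f (p @ x # u @ y # v)" using snoc.IH[of "y # v"] snoc.prems by auto
    finally show ?case by simp
  qed simp
  have "x \<in> set w'" using Cons.prems by auto
  then obtain u v where w': "w' = u @ x # v" by (meson split_list)
  have sw: "set (u @ v) = set w" using Cons.prems w' by auto
  have dw: "distinct (p @ u @ x # v)" "set (p @ u @ x # v) = A" using Cons.prems w' by auto
  have "f ((p @ [x]) @ w) = f ((p @ [x]) @ (u @ v))"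
    by (rule Cons.IH) (use Cons.prems w' sw in auto)
  then show ?case using move[OF dw] w' by simp
qed simp

text \<open>An adjacent swap changes the sign of the word and, by the parallelogram flip, the sign
  of the volume. So the product is the same for all words and may be evaluated at
  \<open>dirs\<close>.\<close>

lemma vol_vertex_path_ind:
  fixes p :: "'n::finite list"
  assumes "distinct p" "set p = UNIV"
  shows "orient TYPE('n) * wsign (None # map Some p) * vol (vertex_path ind {} p) = 1"
proof -
  let ?f = "\<lambda>p :: 'n list. wsign (None # map Some p) * vol (vertex_path ind {} p)"
  have "?f ([] @ p) = ?f ([] @ dirs)"
  proof (rule adjacent_swap_invariant[where A=UNIV])
    fix u v :: "'n list" and x y
    assume d: "distinct (u @ x # y # v)" and s: "set (u @ x # y # v) = UNIV"
    have "distinct ((None # map Some u) @ Some x # Some y # map Some v)" using d by (auto simp: distinct_map)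
    from wsign_swap[OF this] have 1: "wsign (None # map Some (u @ y # x # v)) = - wsign (None # map Some (u @ x # y # v))"
      by simp
    have len: "length (u @ x # y # v) = CARD('n)" using distinct_card[OF d] s by simp
    let ?S = "set u"
    let ?c = "vertex_path ind (insert y (insert x ?S)) v"
    obtain cs where cs: "?c = ind (insert y (insert x ?S)) # cs" by (cases v) auto
    have l: "length cs = length v" using arg_cong[OF cs, of length] by simp
    have "ind ?S + ind (insert y (insert x ?S)) = ind (insert x ?S) + (ind (insert y ?S) :: real^'n)"
      using d by (auto simp: ind_def Finite_Cartesian_Product.vec_eq_iff)
    then have "vol (butlast (vertex_path ind {} u) @ [ind ?S, ind (insert x ?S), ind (insert y (insert x ?S))] @ cs)
      = - vol (butlast (vertex_path ind {} u) @ [ind ?S, ind (insert y ?S), ind (insert y (insert x ?S))] @ cs)"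
      by (intro vol_parallelogram) (use len l in auto)
    then have "vol (vertex_path ind {} (u @ x # y # v)) = - vol (vertex_path ind {} (u @ y # x # v))"
      using cs by (simp add: vertex_path_append insert_commute)
    then show "?f (u @ x # y # v) = ?f (u @ y # x # v)" using 1 by simp
  qed (use assms distinct_dirs set_dirs in auto)
  then have "?f p = orient TYPE('n)" by (simp add: orient_def vol_vertex_path_dirs)
  then show ?thesis by (simp add: mult.assoc orient_def wsign_square del: wsign.simps)
qed

lemma vol_vertex_path_corner:
  fixes p :: "'n::finite list" and A :: "real^'n^'n"
  assumes "distinct p" "set p = UNIV"
  shows "orient TYPE('n) * wsign (None # map Some p) * vol (vertex_path (\<lambda>S. c + A *v emb (corner z S)) {} p) = Determinants.det A"
proof -
  have l: "length p = CARD('n)" using distinct_card[OF assms(1)] assms(2) by simp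
  have "vertex_path (\<lambda>S. c + A *v emb (corner z S)) {} p = map (\<lambda>x. (c + A *v emb z) + A *v x) (vertex_path ind {} p)"
    by (simp add: vertex_path_map emb_corner matrix_vector_right_distrib add.assoc)
  then have "vol (vertex_path (\<lambda>S. c + A *v emb (corner z S)) {} p) = Determinants.det A * vol (vertex_path ind {} p)"
    using vol_affine[of "vertex_path ind {} p"] l by simp
  then show ?thesis using vol_vertex_path_ind[OF assms] by simp
qed

text \<open>Split off the largest coordinate \<open>g x\<close>: the point is the combination with
  weights \<open>1 - g x\<close> and \<open>g x\<close> of \<open>ind S\<close> and a point whose
  entry \<open>x\<close> is 1 and whose later entries, divided by \<open>g x\<close>, are still
  ordered and at most 1.\<close>

lemma mem_hull_ordered:
  fixes g :: "'n::finite \<Rightarrow> real"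
  assumes "distinct p" "S \<inter> set p = {}" "sorted_wrt (\<lambda>i j. g j \<le> g i) p" "\<And>i. i \<in> set p \<Longrightarrow> 0 \<le> g i \<and> g i \<le> 1"
  shows "(\<chi> i. if i \<in> S then 1 else if i \<in> set p then g i else 0) \<in> convex hull (set (vertex_path ind S p))"
  using assms
proof (induction p arbitrary: S g)
  case Nil
  then show ?case by (auto simp: ind_def Finite_Cartesian_Product.vec_eq_iff)
next
  case (Cons x p)
  let ?v = "(\<chi> i. if i \<in> S then 1 else if i \<in> set (x # p) then g i else 0) :: real^'n"
  show ?case
  proof (cases "g x = 0")
    case True
    then have "g i = 0" if "i \<in> set (x # p)" for i using Cons.prems that by (auto intro: antisym)
    then have "?v = ind S" by (auto simp: ind_def Finite_Cartesian_Product.vec_eq_iff)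
    then show ?thesis by (simp add: hull_inc)
  next
    case False
    then have gx: "0 < g x" "g x \<le> 1" using Cons.prems(4)[of x] by auto
    let ?u = "(\<chi> i. if i \<in> insert x S then 1 else if i \<in> set p then g i / g x else 0) :: real^'n"
    have u: "?u \<in> convex hull (set (vertex_path ind (insert x S) p))"
    proof (rule Cons.IH)
      show "sorted_wrt (\<lambda>i j. g j / g x \<le> g i / g x) p"
        using Cons.prems(3) gx by (auto simp: divide_right_mono elim: sorted_wrt_mono_rel[rotated])
      show "0 \<le> g i / g x \<and> g i / g x \<le> 1" if "i \<in> set p" for i
        using that Cons.prems gx by (auto simp: field_simps)
    qed (use Cons.prems in auto)
    have "?v = (1 - g x) *\<^sub>R ind S + g x *\<^sub>R ?u"
      using Cons.prems gx by (auto simp: ind_def Finite_Cartesian_Product.vec_eq_iff)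
    moreover have "(1 - g x) *\<^sub>R ind S + g x *\<^sub>R ?u \<in> convex hull (set (vertex_path ind S (x # p)))"
    proof (rule convexD[OF convex_convex_hull])
      show "?u \<in> convex hull (set (vertex_path ind S (x # p)))"
        using u hull_mono[of "set (vertex_path ind (insert x S) p)" "set (vertex_path ind S (x # p))"] by auto
    qed (use gx in \<open>auto intro: hull_inc\<close>)
    ultimately show ?thesis by simp
  qed
qed

text \<open>The box and order constraints define a convex set. It contains the vertices of the path
  because each of them is the indicator of an initial piece of \<open>p\<close>.\<close>

lemma hull_ordered_imp:
  fixes p :: "'n::finite list"
  assumes x: "x \<in> convex hull (set (vertex_path ind {} p))" and d: "distinct p"
  shows "0 \<le> x $ i \<and> x $ i \<le> 1" and "sorted_wrt (\<lambda>i j. x $ j \<le> x $ i) p"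
proof -
  let ?C = "{x :: real^'n. (\<forall>i. 0 \<le> x $ i \<and> x $ i \<le> 1) \<and> (\<forall>t<length p. \<forall>s<t. x $ (p ! t) \<le> x $ (p ! s))}"
  have "convex hull (set (vertex_path ind {} p)) \<subseteq> ?C"
  proof (rule hull_minimal)
    show "set (vertex_path ind {} p) \<subseteq> ?C"
    proof
      fix y assume "y \<in> set (vertex_path ind {} p)"
      then obtain k where k: "k \<le> length p" "y = ind (set (take k p))"
        by (auto simp: in_set_conv_nth nth_vertex_path less_Suc_eq_le)
      have "p ! s \<in> set (take k p)" if "t < length p" "s < t" "p ! t \<in> set (take k p)" for s t
      proof -
        obtain m where "m < k" "m < length p" "p ! m = p ! t" using \<open>p ! t \<in> _\<close> by (auto simp: in_set_conv_nth)
        then have "t < k" using d that by (metis nth_eq_iff_index_eq)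
        then show ?thesis using that by (auto simp: in_set_conv_nth intro!: exI[of _ s])
      qed
      then show "y \<in> ?C" by (auto simp: k ind_def)
    qed
    show "convex ?C"
    proof (rule convexI)
      fix x y u v assume xy: "x \<in> ?C" "y \<in> ?C" and uv: "0 \<le> (u::real)" "0 \<le> v" "u + v = 1"
      have "0 \<le> u * x $ i + v * y $ i" "u * x $ i + v * y $ i \<le> 1" for i
        using xy uv convex_bound_le[of "x $ i" 1 "y $ i" u v] by auto
      moreover have "u * x $ (p ! t) + v * y $ (p ! t) \<le> u * x $ (p ! s) + v * y $ (p ! s)" if "t < length p" "s < t" for s t
        using xy uv that by (intro add_mono mult_left_mono) auto
      ultimately show "u *\<^sub>R x + v *\<^sub>R y \<in> ?C" by simp
    qed
  qed
  then have "x \<in> ?C" using x by blast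
  then show "0 \<le> x $ i \<and> x $ i \<le> 1" "sorted_wrt (\<lambda>i j. x $ j \<le> x $ i) p"
    by (auto simp: sorted_wrt_iff_nth_less)
qed

text \<open>The excluded hyperplanes contain all walls of the Kuhn triangulation: those between
  cubes, and inside a cube those where two fractional parts agree.\<close>

definition off_grid :: "real^'n \<Rightarrow> bool" where
  "off_grid u \<longleftrightarrow> (\<forall>i. u $ i \<notin> \<int>) \<and> (\<forall>i j. i \<noteq> j \<longrightarrow> u $ i - u $ j \<notin> \<int>)"

definition floor_vec :: "real^'n \<Rightarrow> int^'n" where
  "floor_vec u = (\<chi> i. \<lfloor>u $ i\<rfloor>)"

lemma unique_ordering:
  fixes f :: "'n::finite \<Rightarrow> real"
  assumes "inj f"
  shows "\<exists>!p. distinct p \<and> set p = UNIV \<and> sorted_wrt (\<lambda>i j. f j \<le> f i) p"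
proof -
  obtain q where q: "set q = (UNIV :: 'n set)" "distinct q" using finite_distinct_list[of "UNIV :: 'n set"] by auto
  let ?p = "rev (sort_key f q)"
  have "sorted (map f (sort_key f q))" by simp
  then have "sorted_wrt (\<lambda>i j. f i \<le> f j) (sort_key f q)" by (simp add: sorted_map)
  then have "sorted_wrt (\<lambda>i j. f j \<le> f i) ?p" by (simp add: sorted_wrt_rev)
  then have ex: "distinct ?p \<and> set ?p = UNIV \<and> sorted_wrt (\<lambda>i j. f j \<le> f i) ?p" using q by simp
  have "p = p'" if "distinct p \<and> set p = UNIV \<and> sorted_wrt (\<lambda>i j. f j \<le> f i) p"
    "distinct p' \<and> set p' = UNIV \<and> sorted_wrt (\<lambda>i j. f j \<le> f i) p'" for p p'
  proof -
    have s: "sorted (map f (rev r))" "distinct (map f (rev r))" "set (map f (rev r)) = range f"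
      if "distinct r \<and> set r = UNIV \<and> sorted_wrt (\<lambda>i j. f j \<le> f i) r" for r
      using that assms by (auto simp: sorted_map sorted_wrt_rev distinct_map inj_on_def)
    have "map f (rev p) = map f (rev p')" by (rule sorted_distinct_set_unique) (use s that in auto)
    then show ?thesis using assms by (simp add: inj_map_eq_map rev_is_rev_conv)
  qed
  then show ?thesis using ex by blast
qed

text \<open>A point off the walls lies in exactly one Kuhn simplex: the floors of its coordinates
  select the cube, the decreasing order of the fractional parts selects the word. The affine map
  gives every simplex the orientation \<open>sgn (det A)\<close>.\<close>

lemma cube_degree_affine:
  fixes A :: "real^'n^'n" and u :: "real^'n"
  assumes det: "Determinants.det A \<noteq> 0" and u: "off_grid u"
  shows "cube_degree (\<lambda>z. c + A *v emb z) z (c + A *v u) = (if z = floor_vec u then sgn (Determinants.det A) else 0)"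
proof -
  let ?P = "permutations_of_set (UNIV :: 'n set)"
  let ?L = "\<lambda>x. c + A *v x"
  let ?g = "\<lambda>i. u $ i - of_int (z $ i)"
  define good where "good p \<longleftrightarrow> u - emb z \<in> convex hull (set (vertex_path ind {} p))" for p
  have perms: "permutations_of_set (UNIV - {None :: 'n option}) = map Some ` ?P"
  proof -
    have "UNIV - {None :: 'n option} = range Some" by (auto simp: UNIV_option_conv)
    moreover have "permutations_of_set (range Some) = map Some ` ?P"
      by (rule permutations_of_set_image_inj) simp
    ultimately show ?thesis by simp
  qed
  have summand: "orient TYPE('n) * wsign (None # map Some p) * chi (?L u) (vertex_path (\<lambda>S. ?L (emb (corner z (Some -` S)))) {} (map Some p))
     = sgn (Determinants.det A) * (if good p then 1 else 0)" if p: "p \<in> ?P" for p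
  proof -
    have dp: "distinct p" "set p = UNIV" using p by (auto simp: permutations_of_set_def)
    let ?ps = "vertex_path (\<lambda>S. ?L (emb (corner z S))) {} p"
    have r: "vertex_path (\<lambda>S. ?L (emb (corner z (Some -` S)))) {} (map Some p) = ?ps"
      using vertex_path_relabel[of "\<lambda>S. ?L (emb (corner z (Some -` S)))" Some "{}" p]
      by (simp add: inj_vimage_image_eq)
    let ?T = "\<lambda>x. ?L (emb z + x)"
    have "inj ((*v) A)" using det by (simp add: inj_matrix_vector_mult invertible_det_nz)
    then have inj: "inj ?T"
      unfolding inj_def by (metis add_left_cancel)
    have ps: "?ps = map ?T (vertex_path ind {} p)" by (simp add: vertex_path_map emb_corner)
    have "?T ` X = (\<lambda>x. (c + A *v emb z) + x) ` ((*v) A ` X)" for X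
      by (auto simp: image_image matrix_vector_right_distrib add.assoc)
    then have "convex hull (set ?ps) = ?T ` (convex hull (set (vertex_path ind {} p)))"
      by (simp add: ps convex_hull_translation convex_hull_linear_image matrix_vector_mul_linear)
    moreover have "?L u = ?T (u - emb z)" by simp
    ultimately have mem: "?L u \<in> convex hull (set ?ps) \<longleftrightarrow> good p"
      unfolding good_def by (metis inj inj_image_mem_iff)
    define e where "e = orient TYPE('n) * wsign (None # map Some p)"
    have "\<bar>e\<bar> = 1" by (simp add: e_def orient_def abs_mult wsign_nonzero del: wsign.simps)
    then have "e * sgn (vol ?ps) = sgn (e * vol ?ps)" by (auto simp: sgn_mult abs_if sgn_if split: if_splits)
    also have "\<dots> = sgn (Determinants.det A)" unfolding e_def using vol_vertex_path_corner[OF dp, of c A z] by simp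
    finally have "e * sgn (vol ?ps) = sgn (Determinants.det A)" .
    then show ?thesis unfolding r by (simp add: chi_def mem e_def[symmetric] del: wsign.simps)
  qed
  have "cube_degree (\<lambda>z. ?L (emb z)) z (?L u) = (\<Sum>p\<in>?P. sgn (Determinants.det A) * (if good p then 1 else 0))"
    unfolding cube_degree_def perms
    by (subst sum.reindex) (auto simp: inj_on_def summand simp del: wsign.simps)
  also have "\<dots> = sgn (Determinants.det A) * (\<Sum>p\<in>?P. if good p then 1 else 0)" by (simp add: sum_distrib_left)
  also have "(\<Sum>p\<in>?P. if good p then 1 else (0::real)) = (if z = floor_vec u then 1 else 0)"
  proof (cases "z = floor_vec u")
    case False
    have "\<not> good p" if "p \<in> ?P" for p
    proof
      assume g: "good p"
      have "z $ i = \<lfloor>u $ i\<rfloor>" for i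
      proof -
        have "0 \<le> u $ i - z $ i \<and> u $ i - z $ i \<le> 1"
          using hull_ordered_imp(1)[of "u - emb z" p i] g that by (auto simp: good_def emb_def permutations_of_set_def)
        moreover have "u $ i \<noteq> z $ i + 1" using u unfolding off_grid_def by (metis Ints_of_int of_int_add of_int_1)
        ultimately have "z $ i \<le> u $ i" "u $ i < z $ i + 1" by auto
        then show ?thesis by linarith
      qed
      then show False using False by (simp add: floor_vec_def Finite_Cartesian_Product.vec_eq_iff)
    qed
    then show ?thesis using False by simp
  next
    case True
    have gi: "0 \<le> ?g i \<and> ?g i \<le> 1" for i using True by (simp add: floor_vec_def) linarith
    have "inj ?g"
    proof (rule injI, rule ccontr)
      fix i j assume "?g i = ?g j" "i \<noteq> j"
      then have "u $ i - u $ j = of_int (z $ i - z $ j)" by simp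
      then show False using u \<open>i \<noteq> j\<close> unfolding off_grid_def by (metis Ints_of_int)
    qed
    from unique_ordering[OF this] obtain p where p: "distinct p" "set p = UNIV" "sorted_wrt (\<lambda>i j. ?g j \<le> ?g i) p"
      and uniq: "\<And>q. distinct q \<and> set q = UNIV \<and> sorted_wrt (\<lambda>i j. ?g j \<le> ?g i) q \<Longrightarrow> q = p" by blast
    have "good q \<longleftrightarrow> q = p" if q: "q \<in> ?P" for q
    proof
      assume "good q"
      then have "sorted_wrt (\<lambda>i j. (u - emb z) $ j \<le> (u - emb z) $ i) q"
        unfolding good_def by (rule hull_ordered_imp(2)) (use q in \<open>simp add: permutations_of_set_def\<close>)
      then show "q = p" using q by (intro uniq) (auto simp: permutations_of_set_def emb_def)
    next
      assume "q = p"
      have "(\<chi> i. if i \<in> {} then 1 else if i \<in> set p then ?g i else 0) \<in> convex hull (set (vertex_path ind {} p))"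
        by (rule mem_hull_ordered) (use p gi in auto)
      moreover have "(\<chi> i. if i \<in> {} then 1 else if i \<in> set p then ?g i else 0) = u - emb z"
        using p by (simp add: Finite_Cartesian_Product.vec_eq_iff emb_def)
      ultimately show "good q" using \<open>q = p\<close> by (simp add: good_def)
    qed
    then have "(\<Sum>q\<in>?P. if good q then 1 else (0::real)) = (\<Sum>q\<in>?P. if q = p then 1 else 0)"
      by (intro sum.cong) auto
    also have "\<dots> = 1"
    proof -
      have "p \<in> ?P" using p by (simp add: permutations_of_set_def)
      then show ?thesis by simp
    qed
    finally show ?thesis using True by simp
  qed
  finally show ?thesis by simp
qed

section \<open>Null sets of exceptional values\<close>

lemma AE_lborel_if_negligible:
  assumes "negligible {x. \<not> P x}"
  shows "AE x in lborel. P x"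
proof -
  have "{x. \<not> P x} \<in> null_sets lebesgue" using assms by (simp add: negligible_iff_null_sets)
  then have "AE x in lebesgue. P x" by (rule AE_I') auto
  then show ?thesis by (simp add: AE_completion_iff)
qed

lemma AE_generic:
  fixes P :: "(real^'n) set"
  assumes "countable P"
  shows "AE y in lborel. generic P y"
proof (rule AE_lborel_if_negligible)
  let ?F = "{S. S \<subseteq> P \<and> finite S \<and> card S \<le> CARD('n)}"
  have "?F \<subseteq> {A. finite A \<and> A \<subseteq> P}" by auto
  then have c: "countable ?F" using countable_Collect_finite_subset[OF assms] countable_subset by blast
  have "negligible (convex hull S)" if "S \<in> ?F" for S
    using that empty_interior_convex_hull[of S] negligible_convex_interior[of "convex hull S"] by auto
  then have "negligible (\<Union>((hull) convex ` ?F))"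
    using c by (intro negligible_countable_Union) auto
  moreover have "{y. \<not> generic P y} = \<Union>((hull) convex ` ?F)" by (auto simp: generic_def)
  ultimately show "negligible {y. \<not> generic P y}" by simp
qed

lemma AE_off_grid:
  fixes A :: "real^'n^'n"
  assumes det: "Determinants.det A \<noteq> 0"
  shows "AE y in lborel. \<exists>u. y = c + A *v u \<and> off_grid u"
proof (rule AE_lborel_if_negligible)
  let ?N = "{u :: real^'n. \<not> off_grid u}"
  have hyp: "negligible {u :: real^'n. a \<bullet> u \<in> \<int>}" if "a \<noteq> 0" for a
  proof -
    have "{u :: real^'n. a \<bullet> u \<in> \<int>} = (\<Union>k::int. {u. a \<bullet> u = of_int k})" by (auto elim: Ints_cases)
    also have "negligible \<dots>"
      by (rule negligible_countable_Union) (use negligible_hyperplane that in auto)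
    finally show ?thesis .
  qed
  have "?N = (\<Union>i. {u. axis i 1 \<bullet> u \<in> \<int>}) \<union> (\<Union>(i, j)\<in>{(i, j). i \<noteq> j}. {u. (axis i 1 - axis j 1) \<bullet> u \<in> \<int>})"
    by (auto simp: off_grid_def inner_axis' inner_diff_left)
  moreover have "negligible \<dots>"
    by (intro negligible_Un negligible_Union) (auto intro!: hyp simp: axis_eq_axis)
  ultimately have N: "negligible ?N" by simp
  have "negligible ((\<lambda>u. c + A *v u) ` ?N)"
    by (rule negligible_differentiable_image_negligible[OF order_refl N])
       (intro differentiable_on_add differentiable_on_const linear_imp_differentiable_on matrix_vector_mul_linear)
  moreover have "{y. \<not> (\<exists>u. y = c + A *v u \<and> off_grid u)} \<subseteq> (\<lambda>u. c + A *v u) ` ?N"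
  proof
    fix y assume y: "y \<in> {y. \<not> (\<exists>u. y = c + A *v u \<and> off_grid u)}"
    obtain B where "A ** B = Finite_Cartesian_Product.mat 1" using det invertible_det_nz[of A] by (auto simp: invertible_def)
    then have "y = c + A *v (B *v (y - c))" by (simp add: matrix_vector_mul_assoc)
    then show "y \<in> (\<lambda>u. c + A *v u) ` ?N" using y by blast
  qed
  ultimately show "negligible {y. \<not> (\<exists>u. y = c + A *v u \<and> off_grid u)}" by (rule negligible_subset)
qed

hide_const (open) Matrix.mat Matrix.vec Determinant.det
hide_fact (open) Matrix.vec_eq_iff

section \<open>Dyadic grids\<close>

lemma generic_mono: "generic P y \<Longrightarrow> Q \<subseteq> P \<Longrightarrow> generic Q y"
  unfolding generic_def by (meson subset_trans)

text \<open>Lower and upper boundary faces are treated alike as sets of corners shared by a cube in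
  \<open>Z\<close> and a cube outside \<open>Z\<close>.\<close>

lemma cube_degree_homotopy_boundary:
  fixes a b :: "int^'n \<Rightarrow> real^'n"
  assumes fin: "finite Z" and gen: "generic (range a \<union> range b) y"
    and boundary: "\<And>z z' X. z \<in> Z \<Longrightarrow> z' \<notin> Z \<Longrightarrow> X \<noteq> {} \<Longrightarrow> X \<subseteq> range (corner z) \<Longrightarrow> X \<subseteq> range (corner z') \<Longrightarrow>
       y \<notin> convex hull (a ` X \<union> b ` X)"
  shows "(\<Sum>z\<in>Z. cube_degree b z y) = (\<Sum>z\<in>Z. cube_degree a z y)"
proof (rule cube_degree_homotopy[OF fin])
  have ne: "face_corners j z \<noteq> {}" for j and z :: "int^'n" by (auto simp: face_corners_def)
  show "generic (a ` range (corner z) \<union> b ` range (corner z)) y" for z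
    by (rule generic_mono[OF gen]) (intro Un_mono image_mono subset_UNIV)
  show "y \<notin> convex hull (a ` face_corners j z \<union> b ` face_corners j z)" if "z \<in> Z" "z - unit_step j \<notin> Z" for z j
    using boundary[OF that ne] face_corners_subset[of j z] face_corners_subset(2)[of j "z - unit_step j"] by simp
  show "y \<notin> convex hull (a ` face_corners j (z + unit_step j) \<union> b ` face_corners j (z + unit_step j))"
    if "z \<in> Z" "z + unit_step j \<notin> Z" for z j
    using boundary[OF that ne] face_corners_subset(2)[of j z] face_corners_subset(1)[of j "z + unit_step j"] by simp
qed

definition vert :: "nat \<Rightarrow> int^'n \<Rightarrow> real^'n" where
  "vert k z = (1 / 2^k) *\<^sub>R emb z"

definition dcube :: "nat \<Rightarrow> int^'n \<Rightarrow> (real^'n) set" where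
  "dcube k z = {x. \<forall>i. of_int (z $ i) \<le> 2^k * x $ i \<and> 2^k * x $ i \<le> of_int (z $ i) + 1}"

definition inner_cubes :: "nat \<Rightarrow> (real^'n) set \<Rightarrow> (int^'n) set" where
  "inner_cubes k \<Omega> = {z. dcube k z \<subseteq> \<Omega>}"

definition grid_degree :: "(real^'n \<Rightarrow> real^'n) \<Rightarrow> (real^'n) set \<Rightarrow> nat \<Rightarrow> real^'n \<Rightarrow> real" where
  "grid_degree v \<Omega> k y = (\<Sum>z\<in>inner_cubes k \<Omega>. cube_degree (\<lambda>z. v (vert k z)) z y)"

section \<open>Geometry of dyadic cubes\<close>

lemma vert_corner_in_dcube: "vert k (corner z S) \<in> dcube k z"
  by (auto simp: vert_def dcube_def emb_def corner_def)

lemma corner_empty: "corner z {} = z"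
  by (simp add: corner_def vec_eq_iff)

lemma vert_in_dcube: "vert k z \<in> dcube k z"
  using vert_corner_in_dcube[of k z "{}"] by (simp add: corner_empty)

lemma vert_in_dcube_if_corner: "q \<in> range (corner z) \<Longrightarrow> vert k q \<in> dcube k z"
  using vert_corner_in_dcube by blast

lemma dist_dcube:
  fixes x y :: "real^'n"
  assumes "x \<in> dcube k z" "y \<in> dcube k z"
  shows "dist x y \<le> real CARD('n) / 2^k"
proof -
  have "\<bar>(x - y) $ i\<bar> \<le> 1 / 2^k" for i
  proof -
    have "of_int (z $ i) \<le> 2^k * x $ i" "2^k * x $ i \<le> of_int (z $ i) + 1"
      "of_int (z $ i) \<le> 2^k * y $ i" "2^k * y $ i \<le> of_int (z $ i) + 1"
      using assms unfolding dcube_def by auto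
    then have "2^k * x $ i - 2^k * y $ i \<le> 1" "2^k * y $ i - 2^k * x $ i \<le> 1" by linarith+
    then show ?thesis by (auto simp: field_simps abs_le_iff)
  qed
  then have "(\<Sum>i\<in>UNIV. \<bar>(x - y) $ i\<bar>) \<le> (\<Sum>i\<in>(UNIV::'n set). 1 / 2^k)" by (intro sum_mono) auto
  then show ?thesis using norm_le_l1_cart[of "x - y"] by (simp add: dist_norm)
qed

lemma convex_dcube: "convex (dcube k z)"
proof (rule convexI)
  fix x y :: "real^'a" and u v :: real
  assume xy: "x \<in> dcube k z" "y \<in> dcube k z" and uv: "0 \<le> u" "0 \<le> v" "u + v = 1"
  have eq: "2^k * (u * s + v * t) = u * (2^k * s) + v * (2^k * t)" for s t :: real by (simp add: algebra_simps)
  have "of_int (z $ i) \<le> 2^k * (u * x $ i + v * y $ i)" "2^k * (u * x $ i + v * y $ i) \<le> of_int (z $ i) + 1" for i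
  proof -
    have "2^k * x $ i \<le> of_int (z $ i) + 1" "2^k * y $ i \<le> of_int (z $ i) + 1"
      "- (2^k * x $ i) \<le> - of_int (z $ i)" "- (2^k * y $ i) \<le> - of_int (z $ i)" using xy by (auto simp: dcube_def)
    from convex_bound_le[OF this(1,2) uv] convex_bound_le[OF this(3,4) uv]
    show "of_int (z $ i) \<le> 2^k * (u * x $ i + v * y $ i)" "2^k * (u * x $ i + v * y $ i) \<le> of_int (z $ i) + 1"
      unfolding eq by auto
  qed
  then show "u *\<^sub>R x + v *\<^sub>R y \<in> dcube k z" by (simp add: dcube_def)
qed

lemma floor_vec_in_dcube: "x \<in> dcube k (floor_vec ((2^k) *\<^sub>R x))"
  unfolding dcube_def floor_vec_def by simp

lemma finite_inner_cubes:
  fixes \<Omega> :: "(real^'n) set"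
  assumes "bounded \<Omega>"
  shows "finite (inner_cubes k \<Omega>)"
proof -
  obtain B where B: "\<And>x. x \<in> \<Omega> \<Longrightarrow> norm x \<le> B" using assms by (auto simp: bounded_iff)
  define N where "N = \<lceil>2^k * B\<rceil>"
  have "z \<in> vec_lambda ` (UNIV \<rightarrow>\<^sub>E {-N..N})" if z: "z \<in> inner_cubes k \<Omega>" for z :: "int^'n"
  proof -
    have "vert k z \<in> \<Omega>" using z vert_in_dcube by (auto simp: inner_cubes_def)
    then have n: "norm (vert k z) \<le> B" by (rule B)
    have "z $ i \<in> {-N..N}" for i
    proof -
      have "\<bar>vert k z $ i\<bar> \<le> B" using n component_le_norm_cart[of "vert k z" i] by linarith
      then have "\<bar>of_int (z $ i)\<bar> \<le> 2^k * B" by (simp add: vert_def emb_def field_simps)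
      then show ?thesis unfolding N_def by (auto simp: abs_le_iff) linarith+
    qed
    then have "(\<lambda>i. z $ i) \<in> UNIV \<rightarrow>\<^sub>E {-N..N}" by auto
    moreover have "z = vec_lambda (\<lambda>i. z $ i)" by (simp add: vec_eq_iff)
    ultimately show ?thesis using image_eqI[of z vec_lambda "\<lambda>i. z $ i"] by blast
  qed
  then have "inner_cubes k \<Omega> \<subseteq> vec_lambda ` (UNIV \<rightarrow>\<^sub>E {-N..N})" by blast
  then show ?thesis by (rule finite_subset) (intro finite_imageI finite_PiE, auto)
qed

lemma countable_UNIV_int_vec: "countable (UNIV :: (int^'n) set)"
proof -
  have "countable ((UNIV :: 'n set) \<rightarrow>\<^sub>E (UNIV :: int set))" by (intro countable_PiE) auto
  then have "countable (vec_lambda ` ((UNIV :: 'n set) \<rightarrow>\<^sub>E (UNIV :: int set)))" by (rule countable_image)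
  moreover have "(UNIV :: (int^'n) set) \<subseteq> vec_lambda ` ((UNIV :: 'n set) \<rightarrow>\<^sub>E (UNIV :: int set))"
  proof
    fix z :: "int^'n"
    have "z = vec_lambda (\<lambda>i. z $ i)" by (simp add: vec_eq_iff)
    then show "z \<in> vec_lambda ` ((UNIV :: 'n set) \<rightarrow>\<^sub>E (UNIV :: int set))"
      using image_eqI[of z vec_lambda "\<lambda>i. z $ i"] by simp
  qed
  ultimately show ?thesis by (rule countable_subset[rotated])
qed

text \<open>The point \<open>y\<close> itself may be exceptional at every scale, so a property is
  tested at almost all points near it. The threshold \<open>K\<close> is common to these points;
  this allows passing to a smaller ball and evaluating two properties at one point.\<close>

definition near_AE :: "'a::euclidean_space \<Rightarrow> (nat \<Rightarrow> 'a \<Rightarrow> bool) \<Rightarrow> bool" where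
  "near_AE y P \<longleftrightarrow> (\<exists>\<epsilon>>0. \<exists>K. AE y' in lborel. dist y' y < \<epsilon> \<longrightarrow> (\<forall>k\<ge>K. P k y'))"

lemma near_AE_mono: "near_AE y P \<Longrightarrow> (\<And>k y'. P k y' \<Longrightarrow> Q k y') \<Longrightarrow> near_AE y Q"
  unfolding near_AE_def by (fast elim: eventually_mono)

lemma near_AE_conj:
  assumes "near_AE y P" "near_AE y Q" shows "near_AE y (\<lambda>k y'. P k y' \<and> Q k y')"
proof -
  obtain e K where 1: "e > 0" "AE y' in lborel. dist y' y < e \<longrightarrow> (\<forall>k\<ge>K. P k y')"
    using assms(1) by (auto simp: near_AE_def)
  obtain e' K' where 2: "e' > 0" "AE y' in lborel. dist y' y < e' \<longrightarrow> (\<forall>k\<ge>K'. Q k y')"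
    using assms(2) by (auto simp: near_AE_def)
  have "AE y' in lborel. dist y' y < min e e' \<longrightarrow> (\<forall>k\<ge>max K K'. P k y' \<and> Q k y')"
    using 1(2) 2(2) by eventually_elim auto
  then show ?thesis unfolding near_AE_def using 1(1) 2(1) by (intro exI[of _ "min e e'"] conjI exI[of _ "max K K'"]) auto
qed

lemma near_AE_ball_finite:
  assumes "finite S" "\<And>x. x \<in> S \<Longrightarrow> near_AE y (P x)"
  shows "near_AE y (\<lambda>k y'. \<forall>x\<in>S. P x k y')"
  using assms
proof (induction S)
  case empty
  show ?case unfolding near_AE_def by (intro exI[of _ 1]) auto
next
  case (insert x S)
  then have "near_AE y (\<lambda>k y'. P x k y' \<and> (\<forall>x\<in>S. P x k y'))" by (intro near_AE_conj) auto
  then show ?case by (rule near_AE_mono) auto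
qed

text \<open>The exceptional null set may depend on the scale, because countably many null sets are
  again null.\<close>

lemma near_AE_I:
  assumes "\<epsilon> > 0" "\<And>k y'. k \<ge> K \<Longrightarrow> dist y' y < \<epsilon> \<Longrightarrow> G k y' \<Longrightarrow> P k y'" "\<And>k. AE y' in lborel. G k y'"
  shows "near_AE y P"
proof -
  have "AE y' in lborel. \<forall>k. G k y'" using assms(3) by (simp add: AE_all_countable)
  then have "AE y' in lborel. dist y' y < \<epsilon> \<longrightarrow> (\<forall>k\<ge>K. P k y')"
    by eventually_elim (use assms(2) in auto)
  then show ?thesis unfolding near_AE_def using assms(1) by blast
qed

text \<open>A ball is not a null set. Thus two eventual values of the grid degree near the same
  point have to agree.\<close>

lemma near_AE_ex:
  fixes y :: "'a::euclidean_space"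
  assumes "near_AE y P"
  shows "\<exists>y' K. \<forall>k\<ge>K. P k y'"
proof -
  obtain e K where e: "e > 0" "AE y' in lborel. dist y' y < e \<longrightarrow> (\<forall>k\<ge>K. P k y')"
    using assms(1) by (auto simp: near_AE_def)
  have "\<exists>y'\<in>ball y (e). \<forall>k\<ge>K. P k y'"
  proof (rule ccontr)
    assume n: "\<not> ?thesis"
    from e(2) have "AE y' in lborel. y' \<notin> ball y (e)"
      by eventually_elim (use n in \<open>auto simp: dist_commute\<close>)
    then have "ball y (e) \<in> null_sets lborel" by (subst AE_iff_null_sets) auto
    then have "negligible (ball y (e))" by (simp add: negligible_iff_null_sets null_sets_completionI)
    then show False using e(1) by (simp add: open_not_negligible)
  qed
  then show ?thesis by blast
qed

lemma small_mesh:
  assumes "0 < (d::real)" shows "\<exists>K. \<forall>k\<ge>K. c / 2^k < d"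
proof -
  have "(\<lambda>k. c / 2^k) \<longlonglongrightarrow> 0" by (rule LIMSEQ_divide_realpow_zero) simp
  then have "eventually (\<lambda>k. c / 2^k < d) sequentially" using assms by (rule order_tendstoD(2))
  then show ?thesis by (simp add: eventually_sequentially)
qed

section \<open>The grid degree of differentiable maps\<close>

lemma det_scaleR_matrix:
  fixes A :: "real^'n^'n"
  shows "det (c *\<^sub>R A) = c ^ CARD('n) * det A"
proof -
  have "c *\<^sub>R A = (\<chi> i. c *s (A $ i))" by (simp add: vec_eq_iff)
  then show ?thesis using Determinants.det_rows_mul[of "\<lambda>_. c" "\<lambda>i. A $ i"] by simp
qed

lemma convex_hull_subset_cball: "S \<subseteq> cball x r \<Longrightarrow> convex hull S \<subseteq> cball x r"
  for x :: "'a::real_normed_vector"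
  by (rule hull_minimal) auto

lemma countable_range_vert: "countable (range (\<lambda>z :: int^'n. g z))"
  using countable_UNIV_int_vec by (rule countable_image)

text \<open>A quantitative stand-in for the inverse function theorem. The remainder is a quarter of
  what the linear part expands, which isolates the preimage and leaves room for the mesh in
  \<open>grid_degree_local\<close>.\<close>

lemma regular_point_expansion:
  fixes w :: "real^'n \<Rightarrow> real^'n"
  assumes "w differentiable (at x)" and det: "det (jacobian w (at x)) \<noteq> 0"
  obtains c d where "c > 0" "d > 0" "\<And>h. c * norm h \<le> norm (jacobian w (at x) *v h)"
    "\<And>x'. norm (x' - x) < d \<Longrightarrow> norm (w x' - w x - jacobian w (at x) *v (x' - x)) \<le> c / 4 * norm (x' - x)"
proof -
  let ?A = "jacobian w (at x)"
  have "inj ((*v) ?A)" using det by (simp add: inj_matrix_vector_mult invertible_det_nz)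
  then obtain c where c: "c > 0" "\<And>h. c * norm h \<le> norm (?A *v h)"
    using linear_inj_bounded_below_pos[OF matrix_vector_mul_linear[of ?A]] by blast
  have "(w has_derivative (*v) ?A) (at x)" using assms(1) jacobian_works by blast
  then obtain d where "d > 0" "\<And>x'. norm (x' - x) < d \<Longrightarrow> norm (w x' - w x - ?A *v (x' - x)) \<le> c / 4 * norm (x' - x)"
    unfolding has_derivative_at_alt using c(1) by (metis divide_pos_pos zero_less_numeral)
  then show ?thesis using that c by blast
qed

lemma outside_dcube_dist:
  fixes q :: "real^'n"
  assumes "q \<in> dcube k z" "\<not> dcube k z \<subseteq> ball x r"
  shows "dist x q \<ge> r - real CARD('n) / 2^k"
proof -
  obtain p where p: "p \<in> dcube k z" "dist x p \<ge> r" using assms(2) by (auto simp: subset_iff not_less)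
  have "dist x p \<le> dist x q + dist q p" by (rule dist_triangle)
  then show ?thesis using dist_dcube[OF assms(1) p(1)] p(2) by linarith
qed

text \<open>The claim holds for all small radii, so that one radius can serve all preimages of a
  value and keep their balls disjoint.\<close>

lemma grid_degree_local:
  fixes w :: "real^'n \<Rightarrow> real^'n"
  assumes dw: "w differentiable (at x)" and det: "det (jacobian w (at x)) \<noteq> 0"
  shows "eventually (\<lambda>r. near_AE (w x) (\<lambda>k y'. grid_degree w (ball x r) k y' = sgn (det (jacobian w (at x))))) (at_right 0)"
proof -
  let ?A = "jacobian w (at x)"
  obtain c d where cd: "c > 0" "d > 0" and lower: "\<And>h. c * norm h \<le> norm (?A *v h)"
    and approx: "\<And>x'. norm (x' - x) < d \<Longrightarrow> norm (w x' - w x - ?A *v (x' - x)) \<le> c / 4 * norm (x' - x)"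
    using regular_point_expansion[OF assms] by blast
  obtain B where B: "B > 0" "\<And>h. norm (?A *v h) \<le> B * norm h"
    using linear_bounded_pos[OF matrix_vector_mul_linear[of ?A]] by blast
  define c0 where "c0 = w x - ?A *v x"
  define L where "L = (\<lambda>x'. c0 + ?A *v x')"
  have Lx: "L x' = w x + ?A *v (x' - x)" for x' by (simp add: L_def c0_def matrix_vector_mult_diff_distrib)
  have "near_AE (w x) (\<lambda>k y'. grid_degree w (ball x r) k y' = sgn (det ?A))" if r: "r > 0" "r < d" for r
  proof -
    \<comment> \<open>In units of \<open>c * r / 16\<close>: the mesh moves \<open>L\<close> by at
      most 1, \<open>L\<close> and \<open>w\<close> differ by at most 4, on boundary cubes
      \<open>L\<close> is at distance at least 12 from \<open>w x\<close>, and \<open>y'\<close> is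
      within 1 of \<open>w x\<close>. So hulls within radius 5 miss \<open>y'\<close>.\<close>
    obtain K where K: "\<And>k. k \<ge> K \<Longrightarrow> real CARD('n) / 2^k < min (r / 4) (c * r / (16 * B))"
      using small_mesh[of "min (r / 4) (c * r / (16 * B))" "real CARD('n)"] r cd B by auto
    define G where "G k y' \<longleftrightarrow> generic (range (\<lambda>z. L (vert k z)) \<union> range (\<lambda>z. w (vert k z))) y' \<and>
        (\<exists>u. y' = c0 + ((1 / 2^k) *\<^sub>R ?A) *v u \<and> off_grid u)" for k y'
    show ?thesis
    proof (rule near_AE_I[where \<epsilon>="c * r / 16" and K=K and G=G])
      show "c * r / 16 > 0" using cd r by simp
      show "AE y' in lborel. G k y'" for k
      proof -
        have "det ((1 / 2^k) *\<^sub>R ?A) \<noteq> 0" using det by (simp add: det_scaleR_matrix)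
        from AE_off_grid[OF this, of c0] AE_generic[of "range (\<lambda>z. L (vert k z)) \<union> range (\<lambda>z. w (vert k z))"]
        show ?thesis unfolding G_def using countable_range_vert by auto
      qed
      fix k y' assume k: "k \<ge> K" and y': "dist y' (w x) < c * r / 16" and G: "G k y'"
      let ?\<delta> = "real CARD('n) / 2^k"
      have d1: "?\<delta> < r / 4" and d2: "?\<delta> < c * r / (16 * B)" using K[OF k] by auto
      have d3: "B * ?\<delta> \<le> c * r / 16" using d2 B by (simp add: field_simps)
      let ?Z = "inner_cubes k (ball x r)"
      have "(\<Sum>z\<in>?Z. cube_degree (\<lambda>z. w (vert k z)) z y') = (\<Sum>z\<in>?Z. cube_degree (\<lambda>z. L (vert k z)) z y')"
      proof (rule cube_degree_homotopy_boundary)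
        show "finite ?Z" by (rule finite_inner_cubes) simp
        show "generic (range (\<lambda>z. L (vert k z)) \<union> range (\<lambda>z. w (vert k z))) y'" using G by (simp add: G_def)
        fix z z' X assume z: "z \<in> ?Z" "z' \<notin> ?Z" and X: "X \<noteq> {}" "X \<subseteq> range (corner z)" "X \<subseteq> range (corner z')"
        obtain q0 where q0: "q0 \<in> X" using X by blast
        have inz: "vert k q \<in> dcube k z" "vert k q \<in> dcube k z'" if "q \<in> X" for q
          using that X vert_in_dcube_if_corner by blast+
        have "L (vert k q) \<in> cball (L (vert k q0)) (5 * c * r / 16)
            \<and> w (vert k q) \<in> cball (L (vert k q0)) (5 * c * r / 16)" if q: "q \<in> X" for q
        proof -
          have "vert k q \<in> ball x r" using inz(1)[OF q] z(1) by (auto simp: inner_cubes_def)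
          then have nq: "norm (vert k q - x) < r" by (simp add: dist_norm norm_minus_commute)
          have "dist (L (vert k q0)) (L (vert k q)) = norm (?A *v (vert k q0 - vert k q))"
            by (simp add: Lx dist_norm matrix_vector_mult_diff_distrib)
          also have "\<dots> \<le> B * norm (vert k q0 - vert k q)" by (rule B)
          also have "\<dots> \<le> B * ?\<delta>" 
            using B(1) dist_dcube[OF inz(1)[OF q0] inz(1)[OF q]] by (intro mult_left_mono) (simp_all add: dist_norm)
          finally have 1: "dist (L (vert k q0)) (L (vert k q)) \<le> c * r / 16" using d3 by linarith
          have "dist (L (vert k q)) (w (vert k q)) = norm (w (vert k q) - w x - ?A *v (vert k q - x))"
            by (simp add: Lx dist_norm norm_minus_commute algebra_simps)
          also have "\<dots> \<le> c / 4 * norm (vert k q - x)" by (rule approx) (use nq r in linarith)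
          also have "\<dots> \<le> c / 4 * r" using nq cd by simp
          finally have 2: "dist (L (vert k q)) (w (vert k q)) \<le> 4 * (c * r / 16)" by simp
          have "dist (L (vert k q0)) (w (vert k q)) \<le> dist (L (vert k q0)) (L (vert k q)) + dist (L (vert k q)) (w (vert k q))"
            by (rule dist_triangle)
          moreover have "5 * c * r / 16 = 5 * (c * r / 16)" "0 \<le> c * r / 16" using cd r by auto
          ultimately show ?thesis using 1 2 unfolding mem_cball by (simp only:) linarith
        qed
        then have "(\<lambda>z. L (vert k z)) ` X \<union> (\<lambda>z. w (vert k z)) ` X \<subseteq> cball (L (vert k q0)) (5 * c * r / 16)"
          by blast
        then have hull: "convex hull ((\<lambda>z. L (vert k z)) ` X \<union> (\<lambda>z. w (vert k z)) ` X) \<subseteq> cball (L (vert k q0)) (5 * c * r / 16)"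
          by (rule convex_hull_subset_cball)
        have "r - ?\<delta> \<le> dist x (vert k q0)"
          by (rule outside_dcube_dist[OF inz(2)[OF q0]]) (use z(2) in \<open>simp add: inner_cubes_def\<close>)
        then have "3 * r / 4 \<le> norm (vert k q0 - x)" using d1 by (simp add: dist_norm norm_minus_commute)
        then have "c * (3 * r / 4) \<le> c * norm (vert k q0 - x)" using cd by simp
        also have "\<dots> \<le> norm (?A *v (vert k q0 - x))" by (rule lower)
        finally have "12 * (c * r / 16) \<le> dist (L (vert k q0)) (w x)" by (simp add: Lx dist_norm)
        moreover have "dist (L (vert k q0)) (w x) \<le> dist (L (vert k q0)) y' + dist y' (w x)" by (rule dist_triangle)
        moreover have "5 * c * r / 16 = 5 * (c * r / 16)" "0 < c * r / 16" using cd r by auto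
        ultimately have "y' \<notin> cball (L (vert k q0)) (5 * c * r / 16)" using y' unfolding mem_cball by linarith
        then show "y' \<notin> convex hull ((\<lambda>z. L (vert k z)) ` X \<union> (\<lambda>z. w (vert k z)) ` X)" using hull by blast
      qed
      also have "\<dots> = sgn (det ?A)"
      proof -
        obtain u where u: "y' = c0 + ((1 / 2^k) *\<^sub>R ?A) *v u" "off_grid u" using G by (auto simp: G_def)
        have e: "((1 / 2^k) *\<^sub>R ?A) *v u' = ?A *v ((1 / 2^k) *\<^sub>R u')" for u'
          by (simp add: scaleR_matrix_vector_assoc matrix_vector_mult_scaleR)
        have Lv: "(\<lambda>z. L (vert k z)) = (\<lambda>z. c0 + ((1 / 2^k) *\<^sub>R ?A) *v emb z)" by (simp add: L_def vert_def e)
        have d0: "det ((1 / 2^k) *\<^sub>R ?A) \<noteq> 0" and sg: "sgn (det ((1 / 2^k) *\<^sub>R ?A)) = sgn (det ?A)"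
          using det by (simp_all add: det_scaleR_matrix sgn_mult)
        let ?x' = "(1 / 2^k) *\<^sub>R u"
        have "y' - w x = ?A *v (?x' - x)" using u(1) by (simp add: e c0_def matrix_vector_mult_diff_distrib)
        then have "c * norm (?x' - x) \<le> dist y' (w x)" using lower[of "?x' - x"] by (simp add: dist_norm)
        then have "c * norm (?x' - x) < c * (r / 16)" using y' by simp
        then have nx: "dist x ?x' < r / 16" using cd by (simp add: dist_norm norm_minus_commute)
        \<comment> \<open>The preimage \<open>?x'\<close> of \<open>y'\<close> under
          \<open>L\<close> is so close to \<open>x\<close> that its whole cube lies in the ball.
          This is the one cube that contributes.\<close>
        have "floor_vec u \<in> ?Z"
        proof -
          have "?x' \<in> dcube k (floor_vec u)" using floor_vec_in_dcube[of ?x' k] by simp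
          then have "dist x p < r" if "p \<in> dcube k (floor_vec u)" for p
            using dist_triangle[of x p ?x'] dist_dcube[of ?x' k "floor_vec u" p] that nx d1 r by linarith
          then show ?thesis by (auto simp: inner_cubes_def)
        qed
        moreover have "finite ?Z" by (rule finite_inner_cubes) simp
        ultimately show ?thesis unfolding Lv u(1) cube_degree_affine[OF d0 u(2)] sg by simp
      qed
      finally show "grid_degree w (ball x r) k y' = sgn (det ?A)" unfolding grid_degree_def .
    qed
  qed
  then show ?thesis unfolding eventually_at_right_field using cd by blast
qed

text \<open>An infinite preimage would accumulate, by compactness, at a preimage in
  \<open>\<Omega>\<close>, since none lies on the frontier. That point is regular, and there the
  linear part would have to be both at least \<open>c\<close> and at most \<open>c / 4\<close> times
  the displacement.\<close>

lemma finite_regular_preimage: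
  fixes w :: "real^'n \<Rightarrow> real^'n"
  assumes "bounded \<Omega>" and cw: "continuous_on (closure \<Omega>) w" and op: "open \<Omega>"
    and dw: "\<And>x. x \<in> \<Omega> \<Longrightarrow> w differentiable (at x)"
    and fr: "\<And>z. z \<in> frontier \<Omega> \<Longrightarrow> w z \<noteq> y"
    and reg: "\<And>x. x \<in> \<Omega> \<Longrightarrow> w x = y \<Longrightarrow> det (jacobian w (at x)) \<noteq> 0"
  shows "finite {x \<in> \<Omega>. w x = y}"
proof (rule ccontr)
  assume inf: "infinite {x \<in> \<Omega>. w x = y}"
  have cl: "closure \<Omega> = \<Omega> \<union> frontier \<Omega>" using closure_Un_frontier by blast
  have comp: "compact (closure \<Omega>)" using assms(1) by (simp add: compact_closure)
  have "{x \<in> \<Omega>. w x = y} = {x \<in> closure \<Omega>. w x = y}" using fr cl by auto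
  moreover have "compact {x \<in> closure \<Omega>. w x = y}"
    unfolding compact_eq_bounded_closed
    using continuous_closed_preimage_constant[OF cw closed_closure] assms(1)
    by (blast intro: bounded_subset[OF bounded_closure])
  ultimately obtain x where x: "x \<in> {x \<in> \<Omega>. w x = y}" "x islimpt {x \<in> \<Omega>. w x = y}"
    using inf unfolding compact_eq_Bolzano_Weierstrass by force
  then have "x \<in> \<Omega>" "w x = y" by auto
  then obtain c d where cd: "c > 0" "d > 0" "\<And>h. c * norm h \<le> norm (jacobian w (at x) *v h)"
    "\<And>x'. norm (x' - x) < d \<Longrightarrow> norm (w x' - w x - jacobian w (at x) *v (x' - x)) \<le> c / 4 * norm (x' - x)"
    using regular_point_expansion[OF dw reg] by metis
  obtain x' where x': "x' \<in> {x \<in> \<Omega>. w x = y}" "x' \<noteq> x" "dist x' x < d"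
    using x(2) cd(2) unfolding islimpt_approachable by blast
  then have "norm (jacobian w (at x) *v (x' - x)) \<le> c / 4 * norm (x' - x)"
    using cd(4)[of x'] \<open>w x = y\<close> by (simp add: dist_norm)
  then have "c * norm (x' - x) \<le> c / 4 * norm (x' - x)" using cd(3)[of "x' - x"] by linarith
  then show False using cd(1) x'(2) by simp
qed

lemma uniform_radius:
  assumes "finite P" "open \<Omega>" "P \<subseteq> \<Omega>"
  shows "eventually (\<lambda>r. (\<forall>x\<in>P. ball x r \<subseteq> \<Omega>) \<and> disjoint_family_on (\<lambda>x. ball x r) P) (at_right (0::real))"
proof (rule eventually_conj)
  have "eventually (\<lambda>r. ball x r \<subseteq> \<Omega>) (at_right 0)" if x: "x \<in> P" for x
  proof -
    obtain e where "e > 0" "ball x e \<subseteq> \<Omega>" using assms x open_contains_ball by (metis subsetD)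
    then show ?thesis unfolding eventually_at_right_field
      by (intro exI[of _ e]) (meson less_imp_le order_trans subset_ball)
  qed
  then show "eventually (\<lambda>r. \<forall>x\<in>P. ball x r \<subseteq> \<Omega>) (at_right 0)"
    using assms(1) by (simp add: eventually_ball_finite)
  have "eventually (\<lambda>r. ball x r \<inter> ball x' r = {}) (at_right 0)" if "x \<noteq> x'" for x x' :: 'a
    unfolding eventually_at_right_field
  proof (intro exI[of _ "dist x x' / 2"] conjI allI impI)
    show "dist x x' / 2 > 0" using that by simp
    fix r assume "0 < r" "r < dist x x' / 2"
    then show "ball x r \<inter> ball x' r = {}" by (intro disjoint_ballI) simp
  qed
  then have "eventually (\<lambda>r. \<forall>p\<in>{(x, x')\<in>P \<times> P. x \<noteq> x'}. ball (fst p) r \<inter> ball (snd p) r = {}) (at_right 0)"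
    using assms(1) by (intro eventually_ball_finite) (auto intro: finite_subset[of _ "P \<times> P"])
  then show "eventually (\<lambda>r. disjoint_family_on (\<lambda>x. ball x r) P) (at_right 0)"
    by eventually_elim (force simp: disjoint_family_on_def)
qed

text \<open>Excision: cubes outside small balls around the preimages are mapped away from
  \<open>y'\<close> and contribute nothing.\<close>

lemma grid_degree_regular:
  fixes w :: "real^'n \<Rightarrow> real^'n"
  assumes bd: "bounded \<Omega>" and cw: "continuous_on (closure \<Omega>) w" and op: "open \<Omega>"
    and dw: "\<And>x. x \<in> \<Omega> \<Longrightarrow> w differentiable (at x)"
    and fr: "\<And>z. z \<in> frontier \<Omega> \<Longrightarrow> w z \<noteq> y"
    and reg: "\<And>x. x \<in> \<Omega> \<Longrightarrow> w x = y \<Longrightarrow> det (jacobian w (at x)) \<noteq> 0"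
  shows "near_AE y (\<lambda>k y'. grid_degree w \<Omega> k y' = regular_degree w \<Omega> y)"
proof -
  define P where "P = {x \<in> \<Omega>. w x = y}"
  have fP: "finite P" unfolding P_def by (rule finite_regular_preimage[OF bd cw op dw fr reg])
  have cl: "closure \<Omega> = \<Omega> \<union> frontier \<Omega>" using closure_Un_frontier by blast
  have "eventually (\<lambda>r. \<forall>x\<in>P. near_AE y (\<lambda>k y'. grid_degree w (ball x r) k y' = sgn (det (jacobian w (at x))))) (at_right 0)"
  proof (intro eventually_ball_finite[OF fP] ballI)
    fix x assume "x \<in> P"
    then have "w differentiable (at x)" "det (jacobian w (at x)) \<noteq> 0" "w x = y" using dw reg by (auto simp: P_def)
    then show "eventually (\<lambda>r. near_AE y (\<lambda>k y'. grid_degree w (ball x r) k y' = sgn (det (jacobian w (at x))))) (at_right 0)"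
      using grid_degree_local[of w x] by simp
  qed
  moreover have "eventually (\<lambda>r. (\<forall>x\<in>P. ball x r \<subseteq> \<Omega>) \<and> disjoint_family_on (\<lambda>x. ball x r) P) (at_right 0)"
    by (rule uniform_radius[OF fP op]) (auto simp: P_def)
  moreover have "eventually (\<lambda>r::real. r > 0) (at_right 0)" by (simp add: eventually_at_right_less)
  ultimately have "eventually (\<lambda>r. (\<forall>x\<in>P. near_AE y (\<lambda>k y'. grid_degree w (ball x r) k y' = sgn (det (jacobian w (at x)))))
      \<and> ((\<forall>x\<in>P. ball x r \<subseteq> \<Omega>) \<and> disjoint_family_on (\<lambda>x. ball x r) P) \<and> r > 0) (at_right 0)"
    by eventually_elim blast
  then obtain r where loc: "\<And>x. x \<in> P \<Longrightarrow> near_AE y (\<lambda>k y'. grid_degree w (ball x r) k y' = sgn (det (jacobian w (at x))))"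
    and sub: "\<And>x. x \<in> P \<Longrightarrow> ball x r \<subseteq> \<Omega>" and disj: "disjoint_family_on (\<lambda>x. ball x r) P" and r: "r > 0"
    using eventually_happens'[OF trivial_limit_at_right_real] by blast
  have all: "near_AE y (\<lambda>k y'. \<forall>x\<in>P. grid_degree w (ball x r) k y' = sgn (det (jacobian w (at x))))"
    by (rule near_AE_ball_finite[OF fP loc])
  have rest: "near_AE y (\<lambda>k y'. grid_degree w \<Omega> k y' = (\<Sum>x\<in>P. grid_degree w (ball x r) k y'))"
  proof -
    \<comment> \<open>The radius is halved because, for mesh below \<open>r / 2\<close>, a cube that
      sticks out of \<open>ball x r\<close> has its base vertex outside
      \<open>ball x (r / 2)\<close>. So such base vertices lie in \<open>C\<close>, where
      \<open>w\<close> stays away from \<open>y\<close>.\<close>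
    define C where "C = closure \<Omega> - (\<Union>x\<in>P. ball x (r / 2))"
    have comp: "compact (closure \<Omega>)" using bd by (simp add: compact_closure)
    have "compact C" unfolding C_def by (intro compact_diff comp open_UN) auto
    then have "compact (w ` C)"
      by (rule compact_continuous_image[rotated]) (rule continuous_on_subset[OF cw], auto simp: C_def)
    moreover have "y \<notin> w ` C" using fr cl r by (force simp: C_def P_def)
    ultimately obtain \<eta> where \<eta>: "\<eta> > 0" "\<And>x. x \<in> C \<Longrightarrow> \<eta> \<le> dist y (w x)"
      using separate_point_closed[OF compact_imp_closed] by (metis imageI)
    obtain d where d: "d > 0" "\<And>x x'. x \<in> closure \<Omega> \<Longrightarrow> x' \<in> closure \<Omega> \<Longrightarrow> dist x' x < d \<Longrightarrow> dist (w x') (w x) < \<eta> / 4"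
      using compact_uniformly_continuous[OF cw comp] \<eta>(1) unfolding uniformly_continuous_on_def
      by (metis divide_pos_pos zero_less_numeral)
    obtain K where K: "\<And>k. k \<ge> K \<Longrightarrow> real CARD('n) / 2^k < min d (r / 2)"
      using small_mesh[of "min d (r / 2)" "real CARD('n)"] d r by auto
    show ?thesis
    proof (rule near_AE_I[where \<epsilon>="\<eta> / 4" and K=K and G="\<lambda>_ _. True"])
      show "\<eta> / 4 > 0" using \<eta> by simp
      fix k y' assume k: "k \<ge> K" and y': "dist y' y < \<eta> / 4"
      let ?c = "\<lambda>z. cube_degree (\<lambda>z. w (vert k z)) z y'"
      have zero: "?c z = 0" if z: "z \<in> inner_cubes k \<Omega> - (\<Union>x\<in>P. inner_cubes k (ball x r))" for z
      proof (rule cube_degree_zero)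
        have zs: "dcube k z \<subseteq> \<Omega>" using z by (simp add: inner_cubes_def)
        then have zc: "dcube k z \<subseteq> closure \<Omega>" using closure_subset by blast
        have "(\<lambda>z. w (vert k z)) ` range (corner z) \<subseteq> cball (w (vert k z)) (\<eta> / 4)"
        proof
          fix p assume "p \<in> (\<lambda>z. w (vert k z)) ` range (corner z)"
          then obtain S where p: "p = w (vert k (corner z S))" by blast
          have "dist (vert k z) (vert k (corner z S)) \<le> real CARD('n) / 2^k"
            by (rule dist_dcube[OF vert_in_dcube vert_corner_in_dcube])
          then have "dist (vert k z) (vert k (corner z S)) < d" using K[OF k] by linarith
          then have "dist (w (vert k z)) (w (vert k (corner z S))) < \<eta> / 4"
            using d(2) zc vert_in_dcube vert_corner_in_dcube by (metis subsetD)
          then show "p \<in> cball (w (vert k z)) (\<eta> / 4)" by (simp add: p)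
        qed
        then have "convex hull ((\<lambda>z. w (vert k z)) ` range (corner z)) \<subseteq> cball (w (vert k z)) (\<eta> / 4)"
          by (rule convex_hull_subset_cball)
        moreover have "vert k z \<in> C"
        proof -
          have "dist x (vert k z) \<ge> r / 2" if "x \<in> P" for x
          proof -
            have "\<not> dcube k z \<subseteq> ball x r" using z that by (auto simp: inner_cubes_def)
            then have "r - real CARD('n) / 2^k \<le> dist x (vert k z)"
              by (rule outside_dcube_dist[OF vert_in_dcube])
            then show ?thesis using K[OF k] by linarith
          qed
          then show ?thesis using zc vert_in_dcube[of k z] by (auto simp: C_def not_less)
        qed
        then have "\<eta> \<le> dist y (w (vert k z))" by (rule \<eta>)
        then have "dist (w (vert k z)) y' > \<eta> / 4"
          using dist_triangle[of y "w (vert k z)" y'] y' \<eta>(1) by (simp add: dist_commute)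
        ultimately show "y' \<notin> convex hull ((\<lambda>z. w (vert k z)) ` range (corner z))" by auto
      qed
      have fin: "finite (inner_cubes k \<Omega>)" by (rule finite_inner_cubes[OF bd])
      have "grid_degree w \<Omega> k y' = (\<Sum>z\<in>(\<Union>x\<in>P. inner_cubes k (ball x r)). ?c z)"
        unfolding grid_degree_def
      proof (rule sum.mono_neutral_right[OF fin])
        show "(\<Union>x\<in>P. inner_cubes k (ball x r)) \<subseteq> inner_cubes k \<Omega>"
          using sub unfolding inner_cubes_def by blast
      qed (use zero in blast)
      also have "\<dots> = (\<Sum>x\<in>P. \<Sum>z\<in>inner_cubes k (ball x r). ?c z)"
      proof (rule sum.UNION_disjoint[OF fP])
        show "\<forall>x\<in>P. finite (inner_cubes k (ball x r))" by (simp add: finite_inner_cubes)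
        show "\<forall>x\<in>P. \<forall>x'\<in>P. x \<noteq> x' \<longrightarrow> inner_cubes k (ball x r) \<inter> inner_cubes k (ball x' r) = {}"
        proof (intro ballI impI)
          fix x x' assume "x \<in> P" "x' \<in> P" "x \<noteq> x'"
          then have "ball x r \<inter> ball x' r = {}" using disj by (auto simp: disjoint_family_on_def)
          then show "inner_cubes k (ball x r) \<inter> inner_cubes k (ball x' r) = {}"
            using vert_in_dcube[of k] unfolding inner_cubes_def by blast
        qed
      qed
      finally show "grid_degree w \<Omega> k y' = (\<Sum>x\<in>P. grid_degree w (ball x r) k y')" by (simp add: grid_degree_def)
    qed simp
  qed
  show ?thesis using near_AE_conj[OF all rest]
    by (rule near_AE_mono) (simp add: regular_degree_def P_def)
qed

lemma grid_degree_perturb: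
  fixes v w :: "real^'n \<Rightarrow> real^'n"
  assumes bd: "bounded \<Omega>" and ne: "\<Omega> \<noteq> {}" and cv: "continuous_on (closure \<Omega>) v" and cw: "continuous_on (closure \<Omega>) w"
    and close: "\<And>x z. x \<in> closure \<Omega> \<Longrightarrow> z \<in> frontier \<Omega> \<Longrightarrow> dist (w x) (v x) < dist y (v z)"
  shows "near_AE y (\<lambda>k y'. grid_degree w \<Omega> k y' = grid_degree v \<Omega> k y')"
proof -
  have comp: "compact (closure \<Omega>)" using bd by (simp add: compact_closure)
  have cl: "closure \<Omega> = \<Omega> \<union> frontier \<Omega>" using closure_Un_frontier by blast
  have "\<Omega> \<noteq> UNIV" using bd not_bounded_UNIV by auto
  then have fne: "frontier \<Omega> \<noteq> {}" using ne frontier_eq_empty by blast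
  have fcomp: "compact (frontier \<Omega>)" using bd by (simp add: compact_frontier_bounded)
  have "continuous_on (frontier \<Omega>) (\<lambda>z. dist y (v z))"
    by (intro continuous_intros continuous_on_subset[OF cv]) (auto simp: cl)
  from continuous_attains_inf[OF fcomp fne this]
  obtain z0 where z0: "z0 \<in> frontier \<Omega>" "\<And>z. z \<in> frontier \<Omega> \<Longrightarrow> dist y (v z0) \<le> dist y (v z)" by blast
  have "continuous_on (closure \<Omega>) (\<lambda>x. dist (w x) (v x))" by (intro continuous_intros cv cw)
  moreover have "closure \<Omega> \<noteq> {}" using ne by simp
  ultimately obtain x0 where x0: "x0 \<in> closure \<Omega>" "\<And>x. x \<in> closure \<Omega> \<Longrightarrow> dist (w x) (v x) \<le> dist (w x0) (v x0)"
    using continuous_attains_sup[OF comp] by blast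
  define \<delta> where "\<delta> = dist y (v z0)" 
  define \<eta> where "\<eta> = dist (w x0) (v x0)"
  \<comment> \<open>Of the gap between \<open>\<delta>\<close> and \<open>\<eta>\<close>, one
    quarter is spent on the oscillation of \<open>v\<close> over a cube and one quarter on the
    distance from \<open>y'\<close> to \<open>y\<close>.\<close>
  define m where "m = (\<delta> - \<eta>) / 4"
  have m: "m > 0" using close[OF x0(1) z0(1)] by (simp add: m_def \<delta>_def \<eta>_def)
  have dm: "\<delta> = \<eta> + 4 * m" by (simp add: m_def field_simps)
  obtain d where d: "d > 0" "\<And>x x'. x \<in> closure \<Omega> \<Longrightarrow> x' \<in> closure \<Omega> \<Longrightarrow> dist x' x < d \<Longrightarrow> dist (v x') (v x) < m"
    using compact_uniformly_continuous[OF cv comp] m unfolding uniformly_continuous_on_def by metis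
  obtain K where K: "\<And>k. k \<ge> K \<Longrightarrow> real CARD('n) / 2^k < d" using small_mesh[OF d(1)] by blast
  let ?G = "\<lambda>k y'. generic (range (\<lambda>z. v (vert k z)) \<union> range (\<lambda>z. w (vert k z))) y'"
  show ?thesis
  proof (rule near_AE_I[where \<epsilon>=m and K=K and G="?G"])
    show "m > 0" by (rule m)
    show "AE y' in lborel. ?G k y'" for k by (rule AE_generic) (simp add: countable_range_vert)
    fix k y' assume k: "k \<ge> K" and y': "dist y' y < m" and G: "?G k y'"
    show "grid_degree w \<Omega> k y' = grid_degree v \<Omega> k y'"
      unfolding grid_degree_def
    proof (rule cube_degree_homotopy_boundary[OF finite_inner_cubes[OF bd] G])
      fix z z' X assume z: "z \<in> inner_cubes k \<Omega>" "z' \<notin> inner_cubes k \<Omega>"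
        and X: "X \<noteq> {}" "X \<subseteq> range (corner z)" "X \<subseteq> range (corner z')"
      have inz: "vert k q \<in> dcube k z" "vert k q \<in> dcube k z'" if "q \<in> X" for q
        using that X vert_in_dcube_if_corner by blast+
      have zO: "dcube k z \<subseteq> \<Omega>" using z by (simp add: inner_cubes_def)
      obtain q0 where "q0 \<in> X" using X by blast
      \<comment> \<open>The outer cube contains a point of \<open>\<Omega>\<close> without lying
        inside, so by connectedness it contains a frontier point \<open>p\<close>. All shared
        corners are within one cube diameter of \<open>p\<close>.\<close>
      then have "dcube k z' \<inter> \<Omega> \<noteq> {}" using inz zO by blast
      moreover have "dcube k z' - \<Omega> \<noteq> {}" using z(2) by (auto simp: inner_cubes_def)
      ultimately have "dcube k z' \<inter> frontier \<Omega> \<noteq> {}"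
        by (intro connected_Int_frontier convex_connected convex_dcube)
      then obtain p where p: "p \<in> dcube k z'" "p \<in> frontier \<Omega>" by blast
      have pc: "p \<in> closure \<Omega>" using p cl by blast
      have "v (vert k q) \<in> cball (v p) (\<eta> + m) \<and> w (vert k q) \<in> cball (v p) (\<eta> + m)" if q: "q \<in> X" for q
      proof -
        have qc: "vert k q \<in> closure \<Omega>" using inz(1)[OF q] zO cl by blast
        have "dist (vert k q) p < d" using dist_dcube[OF inz(2)[OF q] p(1)] K[OF k] by linarith
        then have 1: "dist (v (vert k q)) (v p) < m" by (intro d pc qc)
        have 2: "dist (w (vert k q)) (v (vert k q)) \<le> \<eta>" unfolding \<eta>_def by (rule x0(2)[OF qc])
        have "0 \<le> \<eta>" by (simp add: \<eta>_def)
        then show ?thesis using 1 2 dist_triangle[of "w (vert k q)" "v p" "v (vert k q)"] by (auto simp: dist_commute)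
      qed
      then have "convex hull ((\<lambda>z. v (vert k z)) ` X \<union> (\<lambda>z. w (vert k z)) ` X) \<subseteq> cball (v p) (\<eta> + m)"
        by (intro convex_hull_subset_cball) blast
      moreover have "dist (v p) y' > \<eta> + m"
      proof -
        have "\<delta> \<le> dist y (v p)" unfolding \<delta>_def by (rule z0(2)[OF p(2)])
        then show ?thesis using dist_triangle[of y "v p" y'] y' dm m by (simp add: dist_commute)
      qed
      ultimately show "y' \<notin> convex hull ((\<lambda>z. v (vert k z)) ` X \<union> (\<lambda>z. w (vert k z)) ` X)" by auto
    qed
  qed
qed

section \<open>Convergence to the Brouwer degree\<close>

lemma real_polynomial_function_C1:
  assumes "real_polynomial_function p"
  shows "\<exists>p'. (\<forall>x. (p has_derivative p' x) (at x)) \<and> (\<forall>h. continuous_on UNIV (\<lambda>x. p' x h))"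
  using assms
proof (induction rule: real_polynomial_function.induct)
  case (linear f)
  then show ?case by (intro exI[of _ "\<lambda>_. f"]) (auto simp: bounded_linear_imp_has_derivative)
next
  case (const c)
  then show ?case by (intro exI[of _ "\<lambda>_ _. 0"]) auto
next
  case (add f g)
  then obtain f' g' where "\<forall>x. (f has_derivative f' x) (at x)" "\<forall>h. continuous_on UNIV (\<lambda>x. f' x h)"
    "\<forall>x. (g has_derivative g' x) (at x)" "\<forall>h. continuous_on UNIV (\<lambda>x. g' x h)" by auto
  then show ?case by (intro exI[of _ "\<lambda>x h. f' x h + g' x h"]) (auto intro!: derivative_intros continuous_intros)
next
  case (mult f g)
  then obtain f' g' where d: "\<forall>x. (f has_derivative f' x) (at x)" "\<forall>h. continuous_on UNIV (\<lambda>x. f' x h)"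
    "\<forall>x. (g has_derivative g' x) (at x)" "\<forall>h. continuous_on UNIV (\<lambda>x. g' x h)" by auto
  have "continuous_on UNIV f" "continuous_on UNIV g"
    using mult continuous_on_polymonial_function by (auto simp: real_polynomial_function_eq)
  then show ?case using d
    by (intro exI[of _ "\<lambda>x h. f x * g' x h + f' x h * g x"]) (auto intro!: derivative_eq_intros continuous_intros)
qed

lemma polynomial_function_C1:
  fixes g :: "real^'n \<Rightarrow> real^'n"
  assumes "polynomial_function g"
  shows "g differentiable (at x)" and "continuous_on UNIV (\<lambda>x. jacobian g (at x))"
proof -
  show d: "g differentiable (at x)" for x by (rule differentiable_at_polynomial_function[OF assms])
  have "continuous_on UNIV (\<lambda>x. jacobian g (at x) $ i $ j)" for i j
  proof -
    have "real_polynomial_function ((\<lambda>x. x $ i) \<circ> g)"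
      using assms unfolding polynomial_function_def by (simp add: bounded_linear_vec_nth)
    from real_polynomial_function_C1[OF this] obtain p' where
      p': "\<And>x. (((\<lambda>x. x $ i) \<circ> g) has_derivative p' x) (at x)" "\<And>h. continuous_on UNIV (\<lambda>x. p' x h)" by blast
    have "jacobian g (at x) $ i $ j = p' x (axis j 1)" for x
    proof -
      have "(g has_derivative (*v) (jacobian g (at x))) (at x)" using d jacobian_works by blast
      then have "((\<lambda>x. g x $ i) has_derivative (\<lambda>h. (jacobian g (at x) *v h) $ i)) (at x)"
        by (rule bounded_linear.has_derivative[OF bounded_linear_vec_nth])
      then have "(\<lambda>h. (jacobian g (at x) *v h) $ i) = p' x"
        using p'(1)[of x] has_derivative_unique by (auto simp: o_def)
      then have "(jacobian g (at x) *v axis j 1) $ i = p' x (axis j 1)" by (rule fun_cong)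
      then show ?thesis by (simp add: matrix_vector_mul_component inner_axis)
    qed
    then show ?thesis using p'(2) by simp
  qed
  then have "continuous_on UNIV (\<lambda>x. \<chi> i. \<chi> j. jacobian g (at x) $ i $ j)" by (intro continuous_on_vec_lambda)
  then show "continuous_on UNIV (\<lambda>x. jacobian g (at x))" by simp
qed

text \<open>The library states Sard's lemma for well-ordered index types only.\<close>

typedef 'a enumerated = "UNIV :: 'a set" by simp

instantiation enumerated :: (countable) linorder
begin

definition "x \<le> y \<longleftrightarrow> to_nat (Rep_enumerated x) \<le> to_nat (Rep_enumerated y)"
definition "x < y \<longleftrightarrow> to_nat (Rep_enumerated x) < to_nat (Rep_enumerated y)"

instance
  by standard (auto simp: less_eq_enumerated_def less_enumerated_def Rep_enumerated_inject)

end

instance enumerated :: (countable) wellorder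
proof
  fix P :: "'a enumerated \<Rightarrow> bool" and a
  assume step: "\<And>x. (\<And>y. y < x \<Longrightarrow> P y) \<Longrightarrow> P x"
  show "P a"
  proof (induction a rule: measure_induct_rule[of "\<lambda>x. to_nat (Rep_enumerated x)"])
    case (less x)
    show ?case by (rule step, rule less) (simp add: less_enumerated_def)
  qed
qed

lemma bij_Rep_enumerated: "bij Rep_enumerated"
  by (metis Rep_enumerated_inject UNIV_I bij_def injI surj_def Abs_enumerated_inverse)

instance enumerated :: (finite) finite
  by standard (metis bij_Rep_enumerated bij_betw_finite finite)

text \<open>Conjugation with the linear relabelling \<open>T\<close> of the coordinates moves the
  problem to an index type where \<open>baby_Sard\<close> applies. Singular derivatives stay
  singular, and \<open>T'\<close> carries null sets back to null sets.\<close>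

lemma negligible_critical_values:
  fixes g :: "real^'n \<Rightarrow> real^'n"
  assumes g: "\<And>x. x \<in> S \<Longrightarrow> (g has_derivative (*v) (A x)) (at x)" and "\<And>x. x \<in> S \<Longrightarrow> det (A x) = 0"
  shows "negligible (g ` S)"
proof -
  define T :: "real^'n \<Rightarrow> real^('n enumerated)" where "T x = (\<chi> i. x $ Rep_enumerated i)" for x
  define T' :: "real^('n enumerated) \<Rightarrow> real^'n" where "T' x = (\<chi> i. x $ Abs_enumerated i)" for x
  have lT: "bounded_linear T" "bounded_linear T'"
    unfolding linear_conv_bounded_linear[symmetric] by (auto intro!: linearI simp: T_def T'_def vec_eq_iff)
  have inv: "T' (T x) = x" "T (T' y) = y" for x y
    by (auto simp: T_def T'_def vec_eq_iff Abs_enumerated_inverse Rep_enumerated_inverse)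
  have card: "CARD('n enumerated) = CARD('n)" using bij_betw_same_card[OF bij_Rep_enumerated] .
  have dT: "(T has_derivative T) F" "(T' has_derivative T') F'" for F F'
    using lT bounded_linear_imp_has_derivative by blast+
  have "negligible ((T \<circ> g \<circ> T') ` (T ` S))"
  proof (rule baby_Sard[where f'="\<lambda>y. T \<circ> (*v) (A (T' y)) \<circ> T'"])
    fix y assume "y \<in> T ` S"
    then have x: "T' y \<in> S" by (auto simp: inv)
    have "((T \<circ> g) \<circ> T' has_derivative (T \<circ> (*v) (A (T' y))) \<circ> T') (at y)"
      by (intro diff_chain_at dT g x)
    then show "(T \<circ> g \<circ> T' has_derivative T \<circ> (*v) (A (T' y)) \<circ> T') (at y within T ` S)"
      by (rule has_derivative_at_withinI)
    let ?f = "T \<circ> (*v) (A (T' y)) \<circ> T'"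
    have lin: "linear ?f"
      using lT by (intro linear_compose matrix_vector_mul_linear) (simp_all add: linear_conv_bounded_linear)
    have "\<not> inj ((*v) (A (T' y)))"
      using assms(2)[OF x] det_nz_iff_inj[OF matrix_vector_mul_linear[of "A (T' y)"]] by simp
    then obtain a b where ab: "A (T' y) *v a = A (T' y) *v b" "a \<noteq> b" by (auto simp: inj_def)
    then have "?f (T a) = ?f (T b)" "T a \<noteq> T b" using inv(1) by (auto simp: o_def) metis
    then have "\<not> inj ?f" by (auto simp: inj_def)
    then have "det (matrix ?f) = 0" using det_nz_iff_inj[OF lin] by blast
    then show "rank (matrix ?f) < CARD('n enumerated)" using det_eq_0_rank by blast
  qed simp
  then have "negligible (T' ` ((T \<circ> g \<circ> T') ` (T ` S)))"
    by (rule negligible_differentiable_image_negligible[rotated])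
       (use card lT in \<open>auto intro!: linear_imp_differentiable_on simp: linear_conv_bounded_linear\<close>)
  moreover have "T' ` ((T \<circ> g \<circ> T') ` (T ` S)) = g ` S" by (simp add: image_image inv)
  ultimately show ?thesis by simp
qed

lemma degree_admissible_exists:
  fixes v :: "real^'n \<Rightarrow> real^'n"
  assumes bd: "bounded \<Omega>" and cv: "continuous_on (closure \<Omega>) v" and y: "y \<notin> v ` frontier \<Omega>"
  shows "\<exists>w. degree_admissible v \<Omega> y w"
proof -
  have comp: "compact (closure \<Omega>)" using bd by (simp add: compact_closure)
  have cl: "closure \<Omega> = \<Omega> \<union> frontier \<Omega>" using closure_Un_frontier by blast
  have "compact (v ` frontier \<Omega>)"
    using bd by (intro compact_continuous_image continuous_on_subset[OF cv] compact_frontier_bounded) (auto simp: cl)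
  then obtain \<delta> where \<delta>: "\<delta> > 0" "\<And>z. z \<in> frontier \<Omega> \<Longrightarrow> \<delta> \<le> dist y (v z)"
    using separate_point_closed[OF compact_imp_closed y] by (metis imageI)
  obtain g where g: "polynomial_function g" "\<And>x. x \<in> closure \<Omega> \<Longrightarrow> norm (v x - g x) < \<delta> / 2"
    using Stone_Weierstrass_polynomial_function[OF comp cv, of "\<delta> / 2"] \<delta>(1) by auto
  define S where "S = {x. det (jacobian g (at x)) = 0}"
  have hd: "(g has_derivative (*v) (jacobian g (at x))) (at x)" for x
    using polynomial_function_C1(1)[OF g(1)] jacobian_works by blast
  have "negligible (g ` S)"
    by (rule negligible_critical_values) (use hd in \<open>auto simp: S_def\<close>)
  moreover have "\<not> negligible (ball y (\<delta> / 2))" using \<delta>(1) by (simp add: open_not_negligible)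
  ultimately have "\<not> ball y (\<delta> / 2) \<subseteq> g ` S" using negligible_subset by blast
  then obtain b where b: "dist y b < \<delta> / 2" "b \<notin> g ` S" by (auto simp: subset_iff)
  \<comment> \<open>The map is shifted instead of the value: \<open>b\<close> is a regular value of
    \<open>g\<close>, so \<open>y\<close> is one of \<open>w\<close>. Approximation and shift each
    spend less than \<open>\<delta> / 2\<close> of the distance from \<open>y\<close> to the
    frontier values.\<close>
  define w where "w = (\<lambda>x. g x + (y - b))"
  have wd: "(w has_derivative (*v) (jacobian g (at x))) (at x)" for x
    unfolding w_def using hd by (auto intro!: derivative_eq_intros)
  then have dw: "w differentiable (at x)" for x by (auto simp: differentiable_def)
  have jw: "jacobian w (at x) = jacobian g (at x)" for x
    using frechet_derivative_at[OF wd[of x]] unfolding jacobian_def[of w]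
    by (metis matrix_of_matrix_vector_mul)
  have "degree_admissible v \<Omega> y w"
    unfolding degree_admissible_def
  proof (intro conjI ballI impI)
    show "continuous_on (closure \<Omega>) w"
      unfolding w_def by (intro continuous_intros continuous_on_polymonial_function g)
    show "w differentiable (at x)" for x by (rule dw)
    show "continuous_on \<Omega> (\<lambda>x. jacobian w (at x))"
      unfolding jw by (rule continuous_on_subset[OF polynomial_function_C1(2)[OF g(1)]]) simp
    show "dist (w x) (v x) < dist y (v z)" if "x \<in> closure \<Omega>" "z \<in> frontier \<Omega>" for x z
    proof -
      have "dist (w x) (v x) = norm ((y - b) - (v x - g x))" by (simp add: w_def dist_norm algebra_simps)
      also have "\<dots> \<le> norm (y - b) + norm (v x - g x)" by (rule norm_triangle_ineq4)
      also have "\<dots> < \<delta>" using b(1) g(2)[OF that(1)] by (simp add: dist_norm)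
      finally show ?thesis using \<delta>(2)[OF that(2)] by linarith
    qed
    show "det (jacobian w (at x)) \<noteq> 0" if "w x = y" for x
    proof
      assume "det (jacobian w (at x)) = 0"
      then have "g x \<in> g ` S" by (simp add: S_def jw)
      moreover have "g x = b" using that by (simp add: w_def algebra_simps)
      ultimately show False using b by simp
    qed
  qed
  then show ?thesis by blast
qed

section \<open>Well-definedness of the degree and almost everywhere convergence\<close>

lemma grid_degree_admissible:
  fixes v :: "real^'n \<Rightarrow> real^'n"
  assumes bd: "bounded \<Omega>" and op: "open \<Omega>" and cv: "continuous_on (closure \<Omega>) v"
    and adm: "degree_admissible v \<Omega> y w"
  shows "near_AE y (\<lambda>k y'. grid_degree v \<Omega> k y' = regular_degree w \<Omega> y)"
proof -
  note a = adm[unfolded degree_admissible_def]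
  have "near_AE y (\<lambda>k y'. grid_degree w \<Omega> k y' = regular_degree w \<Omega> y)"
  proof (rule grid_degree_regular[OF bd _ op])
    show "w z \<noteq> y" if "z \<in> frontier \<Omega>" for z
    proof -
      have "z \<in> closure \<Omega>" using that by (simp add: frontier_def)
      then have "dist (w z) (v z) < dist y (v z)" using a that by blast
      then show ?thesis by auto
    qed
  qed (use a in auto)
  moreover have "near_AE y (\<lambda>k y'. grid_degree w \<Omega> k y' = grid_degree v \<Omega> k y')"
  \<comment> \<open>The margin in \<open>grid_degree_perturb\<close> is a minimum over a nonempty
    frontier. For empty \<open>\<Omega>\<close> there are no cubes and both sums are empty.\<close>
  proof (cases "\<Omega> = {}")
    case True
    then have "inner_cubes k \<Omega> = {}" for k using vert_in_dcube by (auto simp: inner_cubes_def)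
    then have "grid_degree w \<Omega> k y' = grid_degree v \<Omega> k y'" for k y' by (simp add: grid_degree_def)
    then show ?thesis unfolding near_AE_def by (intro exI[of _ 1]) auto
  next
    case False
    show ?thesis by (rule grid_degree_perturb[OF bd False cv]) (use a in auto)
  qed
  ultimately have "near_AE y (\<lambda>k y'. grid_degree w \<Omega> k y' = regular_degree w \<Omega> y \<and> grid_degree w \<Omega> k y' = grid_degree v \<Omega> k y')"
    by (rule near_AE_conj)
  then show ?thesis by (rule near_AE_mono) simp
qed

lemma near_AE_eq_unique:
  fixes y :: "'a::euclidean_space"
  assumes "near_AE y (\<lambda>k y'. f k y' = a)" "near_AE y (\<lambda>k y'. f k y' = b)"
  shows "a = b"
proof -
  obtain y' K where "\<forall>k\<ge>K. f k y' = a \<and> f k y' = b"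
    using near_AE_ex[OF near_AE_conj[OF assms]] by blast
  then show ?thesis by (metis order_refl)
qed

text \<open>The eventual grid degree of \<open>v\<close> near \<open>y\<close> does not refer to
  \<open>w\<close>, so all admissible maps have the same regular degree. As one such map exists, the
  definite description denotes this number.\<close>

proposition grid_degree_near_brouwer:
  fixes v :: "real^'n \<Rightarrow> real^'n"
  assumes bd: "bounded \<Omega>" and op: "open \<Omega>" and cv: "continuous_on (closure \<Omega>) v" and y: "y \<notin> v ` frontier \<Omega>"
  shows "near_AE y (\<lambda>k y'. grid_degree v \<Omega> k y' = brouwer_degree v \<Omega> y)"
proof -
  note adm = grid_degree_admissible[OF bd op cv]
  obtain w where w: "degree_admissible v \<Omega> y w" using degree_admissible_exists[OF bd cv y] by blast
  have "brouwer_degree v \<Omega> y = (THE k. \<forall>w. degree_admissible v \<Omega> y w \<longrightarrow> regular_degree w \<Omega> y = k)"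
    using y by (simp add: brouwer_degree_def)
  also have "\<dots> = regular_degree w \<Omega> y"
  proof (rule the_equality)
    show "\<forall>w'. degree_admissible v \<Omega> y w' \<longrightarrow> regular_degree w' \<Omega> y = regular_degree w \<Omega> y"
      using near_AE_eq_unique[OF adm adm[OF w]] by blast
  qed (use w in blast)
  finally show ?thesis using adm[OF w] by simp
qed

theorem grid_degree_tendsto_brouwer:
  fixes v :: "real^'n \<Rightarrow> real^'n"
  assumes bd: "bounded \<Omega>" and op: "open \<Omega>" and cv: "continuous_on (closure \<Omega>) v"
  shows "AE y in lborel. y \<notin> v ` frontier \<Omega> \<longrightarrow> (\<lambda>k. grid_degree v \<Omega> k y) \<longlonglongrightarrow> brouwer_degree v \<Omega> y"
proof -
  let ?O = "- (v ` frontier \<Omega>)"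
  have cl: "closure \<Omega> = \<Omega> \<union> frontier \<Omega>" using closure_Un_frontier by blast
  have "compact (v ` frontier \<Omega>)"
    using bd by (intro compact_continuous_image continuous_on_subset[OF cv] compact_frontier_bounded) (auto simp: cl)
  then have oO: "open ?O" by (simp add: compact_imp_closed open_Compl)
  note near = grid_degree_near_brouwer[OF bd op cv]
  have "\<exists>e>0. AE y' in lborel. dist y' y < e \<longrightarrow> y' \<in> ?O \<longrightarrow> (\<lambda>k. grid_degree v \<Omega> k y') \<longlonglongrightarrow> brouwer_degree v \<Omega> y'"
    if y: "y \<in> ?O" for y
  proof -
    obtain e K where e: "e > 0" "AE y' in lborel. dist y' y < e \<longrightarrow> (\<forall>k\<ge>K. grid_degree v \<Omega> k y' = brouwer_degree v \<Omega> y)"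
      using near[of y] y unfolding near_AE_def by auto
    \<comment> \<open>The degree is locally constant: a smaller ball around \<open>y'\<close> inside
      the ball around \<open>y\<close> has the same eventual value, and eventual values are
      unique.\<close>
    have const: "brouwer_degree v \<Omega> y' = brouwer_degree v \<Omega> y" if y': "y' \<in> ?O" "dist y' y < e" for y'
    proof (rule near_AE_eq_unique[where f="\<lambda>k. grid_degree v \<Omega> k" and y=y'])
      show "near_AE y' (\<lambda>k y''. grid_degree v \<Omega> k y'' = brouwer_degree v \<Omega> y')" using near y' by auto
      have "AE y'' in lborel. dist y'' y' < e - dist y' y \<longrightarrow> (\<forall>k\<ge>K. grid_degree v \<Omega> k y'' = brouwer_degree v \<Omega> y)"
        using e(2)
      proof eventually_elim
        case (elim y'')
        then show ?case using dist_triangle[of y'' y y'] by auto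
      qed
      then show "near_AE y' (\<lambda>k y''. grid_degree v \<Omega> k y'' = brouwer_degree v \<Omega> y)"
        unfolding near_AE_def using y'(2) by (intro exI[of _ "e - dist y' y"]) auto
    qed
    have "AE y' in lborel. dist y' y < e \<longrightarrow> y' \<in> ?O \<longrightarrow> (\<lambda>k. grid_degree v \<Omega> k y') \<longlonglongrightarrow> brouwer_degree v \<Omega> y'"
      using e(2)
    proof eventually_elim
      case (elim y')
      show ?case
      proof (intro impI)
        assume d: "dist y' y < e" "y' \<in> ?O"
        then have "\<forall>k\<ge>K. grid_degree v \<Omega> k y' = brouwer_degree v \<Omega> y'" using elim const by auto
        then show "(\<lambda>k. grid_degree v \<Omega> k y') \<longlonglongrightarrow> brouwer_degree v \<Omega> y'"
          by (intro tendsto_eventually) (auto simp: eventually_sequentially)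
      qed
    qed
    then show ?thesis using e(1) by blast
  qed
  then have "\<forall>y\<in>?O. \<exists>e>0. AE y' in lborel. dist y' y < e \<longrightarrow> y' \<in> ?O \<longrightarrow> (\<lambda>k. grid_degree v \<Omega> k y') \<longlonglongrightarrow> brouwer_degree v \<Omega> y'"
    by blast
  from bchoice[OF this] obtain e where e: "\<And>y. y \<in> ?O \<Longrightarrow> e y > 0"
    "\<And>y. y \<in> ?O \<Longrightarrow> AE y' in lborel. dist y' y < e y \<longrightarrow> y' \<in> ?O \<longrightarrow> (\<lambda>k. grid_degree v \<Omega> k y') \<longlonglongrightarrow> brouwer_degree v \<Omega> y'"
    by blast
  \<comment> \<open>The exceptional null set depends on the centre of the ball, so the cover is
    reduced to countably many balls.\<close>
  obtain F where F: "F \<subseteq> (\<lambda>y. ball y (e y)) ` ?O" "countable F" "\<Union>F = \<Union>((\<lambda>y. ball y (e y)) ` ?O)"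
    using Lindelof[of "(\<lambda>y. ball y (e y)) ` ?O"] by auto
  have "AE y' in lborel. \<forall>B\<in>F. y' \<in> B \<longrightarrow> y' \<in> ?O \<longrightarrow> (\<lambda>k. grid_degree v \<Omega> k y') \<longlonglongrightarrow> brouwer_degree v \<Omega> y'"
  proof (subst AE_ball_countable[OF F(2)], rule ballI)
    fix B assume "B \<in> F"
    then obtain y where y: "y \<in> ?O" "B = ball y (e y)" using F(1) by blast
    show "AE y' in lborel. y' \<in> B \<longrightarrow> y' \<in> ?O \<longrightarrow> (\<lambda>k. grid_degree v \<Omega> k y') \<longlonglongrightarrow> brouwer_degree v \<Omega> y'"
      using e(2)[OF y(1)] by eventually_elim (auto simp: y(2) dist_commute)
  qed
  then show ?thesis
  proof eventually_elim
    case (elim y')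
    show ?case
    proof
      assume "y' \<notin> v ` frontier \<Omega>"
      then have o: "y' \<in> ?O" by simp
      then have "y' \<in> ball y' (e y')" using e(1) by simp
      then have "y' \<in> \<Union>F" unfolding F(3) using o by (rule UN_I[rotated])
      then obtain B where "B \<in> F" "y' \<in> B" by (rule UnionE)
      then show "(\<lambda>k. grid_degree v \<Omega> k y') \<longlonglongrightarrow> brouwer_degree v \<Omega> y'" using elim o by auto
    qed
  qed
qed

section \<open>Fractional energy of convex sets\<close>

lemma emeasure_lborel_translation:
  fixes A :: "'a::euclidean_space set"
  assumes "A \<in> sets borel"
  shows "(\<lambda>x. c + x) ` A \<in> sets borel" and "emeasure lborel ((\<lambda>x. c + x) ` A) = emeasure lborel A"
proof -
  have im: "(\<lambda>x. c + x) ` A = (\<lambda>x. - c + x) -` A" by (auto intro!: image_eqI[of _ _ "- c + _"])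
  have meas: "(\<lambda>x. - c + x) \<in> measurable borel borel" by simp
  then show "(\<lambda>x. c + x) ` A \<in> sets borel" using measurable_sets[OF meas assms] by (simp add: im)
  have "emeasure lborel A = emeasure (distr lborel borel ((+) (- c))) A" by (simp only: lborel_distr_plus)
  also have "\<dots> = emeasure lborel ((\<lambda>x. - c + x) -` A)" using assms by (subst emeasure_distr) auto
  finally show "emeasure lborel ((\<lambda>x. c + x) ` A) = emeasure lborel A" by (simp add: im)
qed

lemma nn_integral_lborel_shift:
  fixes f :: "'a::euclidean_space \<Rightarrow> ennreal"
  assumes "f \<in> borel_measurable borel"
  shows "(\<integral>\<^sup>+y. f y \<partial>lborel) = (\<integral>\<^sup>+h. f (x + h) \<partial>lborel)"
  using assms by (subst lborel_distr_plus[symmetric, of x]) (simp add: nn_integral_distr)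

text \<open>On each line parallel to \<open>h\<close> the set \<open>S - (h + S)\<close> is the initial piece of length at most
  \<open>norm h\<close> of a segment, so its translates by multiples of \<open>h\<close> are disjoint; about \<open>r / norm h\<close> of them
  fit into a ball of radius \<open>2 * r\<close>.\<close>

lemma emeasure_convex_minus_translate:
  fixes S :: "'a::euclidean_space set"
  assumes S: "convex S" "compact S" "S \<subseteq> cball c r" and r: "r > 0"
  shows "emeasure lborel (S - (\<lambda>x. h + x) ` S)
    \<le> ennreal (unit_ball_vol DIM('a) * 2 ^ (DIM('a) + 1) * r ^ DIM('a) * min (norm h / r) 1)"
    (is "?L \<le> ennreal (?V * 2 ^ (?n + 1) * r ^ ?n * _)")
proof (cases "norm h \<ge> r")
  case True
  have "S - (\<lambda>x. h + x) ` S \<subseteq> cball c r" using S by auto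
  then have "?L \<le> emeasure lborel (cball c r)" by (intro emeasure_mono) auto
  also have "\<dots> = ennreal (?V * r ^ ?n)" using r by (simp add: emeasure_cball)
  also have "\<dots> \<le> ennreal (?V * 2 ^ (?n + 1) * r ^ ?n * min (norm h / r) 1)"
  proof (rule ennreal_leI)
    have "?V * r ^ ?n * 1 \<le> ?V * r ^ ?n * 2 ^ (?n + 1)"
      using r by (intro mult_left_mono) (auto intro!: one_le_power mult_nonneg_nonneg simp del: power_Suc)
    then show "?V * r ^ ?n \<le> ?V * 2 ^ (?n + 1) * r ^ ?n * min (norm h / r) 1"
      using True r by (simp add: min_absorb2 mult_ac)
  qed
  finally show ?thesis .
next
  case False
  show ?thesis
  proof (cases "h = 0")
    case True then show ?thesis by simp
  next
    case h0: False
    define A where "A = S - (\<lambda>x. h + x) ` S"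
    \<comment> \<open>Since \<open>r / norm h\<close> is at least 1, rounding down loses at most a
      factor 2. With the ball of radius \<open>2 * r\<close> this gives the constant
      \<open>2 ^ (DIM('a) + 1)\<close>.\<close>
    define m where "m = nat \<lfloor>r / norm h\<rfloor>"
    have h: "0 < norm h" using h0 by simp
    have t: "1 \<le> r / norm h" using False h by (simp add: field_simps)
    then have "1 \<le> \<lfloor>r / norm h\<rfloor>" by linarith
    then have m: "real m \<le> r / norm h" "r / norm h \<le> 2 * real m" "1 \<le> m"
    proof -
      have "real m = of_int \<lfloor>r / norm h\<rfloor>" using \<open>1 \<le> \<lfloor>r / norm h\<rfloor>\<close> by (simp add: m_def)
      moreover have "1 \<le> real m" using \<open>1 \<le> \<lfloor>r / norm h\<rfloor>\<close> by (simp add: m_def)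
      ultimately show "real m \<le> r / norm h" "r / norm h \<le> 2 * real m" "1 \<le> m" by linarith+
    qed
    have SA: "S \<in> sets borel" using S(2) by (simp add: borel_compact)
    have A: "A \<in> sets borel" unfolding A_def using SA emeasure_lborel_translation(1)[OF SA] by auto
    define T where "T j = (\<lambda>x. real j *\<^sub>R h + x) ` A" for j
    have TT: "T j \<in> sets borel" "emeasure lborel (T j) = emeasure lborel A" for j
      unfolding T_def by (rule emeasure_lborel_translation[OF A])+
    have disj: "T i \<inter> T j = {}" if ij: "i < j" for i j
    proof (rule ccontr)
      assume "T i \<inter> T j \<noteq> {}"
      then obtain a b where ab: "a \<in> A" "b \<in> A" "real i *\<^sub>R h + a = real j *\<^sub>R h + b" by (auto simp: T_def)
      define q where "q = real j - real i"
      have q: "q \<ge> 1" using ij by (simp add: q_def)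
      have "a = b + q *\<^sub>R h" using ab(3) by (simp add: q_def algebra_simps)
      \<comment> \<open>The point \<open>a - h\<close> lies on the segment from \<open>b\<close> to
        \<open>a\<close>, since \<open>a = b + q *\<^sub>R h\<close> with \<open>q \<ge> 1\<close>.
        By convexity it is in \<open>S\<close>, so \<open>a\<close> belongs to the translate that
        was removed.\<close>
      then have "a - h = (1 / q) *\<^sub>R b + ((q - 1) / q) *\<^sub>R a"
        using q by (simp add: algebra_simps add_divide_distrib[symmetric] diff_divide_distrib flip: scaleR_add_left)
      also have "\<dots> \<in> S" using ab q by (intro convexD[OF S(1)]) (auto simp: A_def field_simps)
      finally have "h + (a - h) \<in> (\<lambda>x. h + x) ` S" by blast
      then show False using ab(1) by (simp add: A_def)
    qed
    then have df: "disjoint_family_on T {..<m}"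
      unfolding disjoint_family_on_def by (metis Int_commute nat_neq_iff)
    have "ennreal (real m) * emeasure lborel A = (\<Sum>j<m. emeasure lborel (T j))"
      by (simp add: TT ennreal_of_nat_eq_real_of_nat)
    also have "\<dots> = emeasure lborel (\<Union>j<m. T j)"
      by (rule sum_emeasure) (use TT df in auto)
    also have "\<dots> \<le> emeasure lborel (cball c (2 * r))"
    proof (rule emeasure_mono)
      show "(\<Union>j<m. T j) \<subseteq> cball c (2 * r)"
      proof
        fix x assume "x \<in> (\<Union>j<m. T j)"
        then obtain j a where j: "j < m" "a \<in> A" "x = real j *\<^sub>R h + a" by (auto simp: T_def)
        have "real j * norm h \<le> real m * norm h" using j h by simp
        also have "\<dots> \<le> r" using m(1) h by (simp add: field_simps)
        finally have "norm (real j *\<^sub>R h) \<le> r" by simp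
        moreover have "dist c a \<le> r" using j(2) S(3) by (auto simp: A_def)
        moreover have "dist c x \<le> dist c a + norm (real j *\<^sub>R h)"
          unfolding j(3) dist_norm using norm_triangle_ineq4[of "c - a" "real j *\<^sub>R h"] by (simp add: algebra_simps)
        ultimately show "x \<in> cball c (2 * r)" by simp
      qed
    qed simp
    also have "\<dots> = ennreal (?V * (2 * r) ^ ?n)" using r by (simp add: emeasure_cball)
    finally have le: "ennreal (real m) * emeasure lborel A \<le> ennreal (?V * (2 * r) ^ ?n)" .
    have "A \<subseteq> cball c r" using S(3) by (auto simp: A_def)
    then have "emeasure lborel A \<le> emeasure lborel (cball c r)" by (intro emeasure_mono) auto
    also have "\<dots> < \<infinity>" using r by (simp add: emeasure_cball)
    finally obtain a where a: "a \<ge> 0" "emeasure lborel A = ennreal a" by (cases "emeasure lborel A") auto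
    have "real m * a \<le> ?V * (2 * r) ^ ?n"
      using le a r by (simp add: ennreal_mult[symmetric] ennreal_le_iff)
    moreover have "r / norm h * a \<le> 2 * real m * a" using m(2) a(1) by (rule mult_right_mono)
    ultimately have "r / norm h * a \<le> 2 * (?V * (2 * r) ^ ?n)" by linarith
    then have "a \<le> ?V * 2 ^ (?n + 1) * r ^ ?n * (norm h / r)"
      using h r by (simp add: field_simps power_mult_distrib)
    moreover have "min (norm h / r) 1 = norm h / r" using False r by (simp add: min_def)
    ultimately have "a \<le> ?V * 2 ^ (?n + 1) * r ^ ?n * min (norm h / r) 1" by (simp only:)
    then show ?thesis using a(2) unfolding A_def by (simp add: ennreal_leI del: power_Suc)
  qed
qed

text \<open>The integrand is the indicator of two disjoint sets: \<open>S\<close> minus its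
  translate by \<open>- h\<close>, and a translate of \<open>S\<close> minus its translate by
  \<open>h\<close>. Each obeys the previous bound, which adds one factor 2.\<close>

lemma indicator_shift_integral:
  fixes S :: "'a::euclidean_space set"
  assumes S: "convex S" "compact S" "S \<subseteq> cball c r" and r: "r > 0"
  shows "(\<integral>\<^sup>+x. ennreal \<bar>indicator S x - indicator S (x + h)\<bar> \<partial>lborel)
    \<le> ennreal (unit_ball_vol DIM('a) * 2 ^ (DIM('a) + 2) * r ^ DIM('a) * min (norm h / r) 1)"
proof -
  let ?B = "unit_ball_vol DIM('a) * 2 ^ (DIM('a) + 1) * r ^ DIM('a) * min (norm h / r) 1"
  let ?A = "\<lambda>h. S - (\<lambda>x. h + x) ` S"
  have SA: "S \<in> sets borel" using S(2) by (simp add: borel_compact)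
  have A: "?A h \<in> sets borel" for h using SA emeasure_lborel_translation(1)[OF SA] by auto
  let ?A' = "(\<lambda>x. - h + x) ` ?A h"
  have A': "?A' \<in> sets borel" "emeasure lborel ?A' = emeasure lborel (?A h)"
    by (rule emeasure_lborel_translation[OF A])+
  have mem: "x \<in> (\<lambda>x. g + x) ` X \<longleftrightarrow> x - g \<in> X" for x g :: 'a and X
    by (auto intro!: image_eqI[of _ _ "x - g"])
  have "ennreal \<bar>indicator S x - indicator S (x + h)\<bar> = indicator (?A (- h)) x + indicator ?A' x" for x
  proof -
    have "x \<in> ?A (- h) \<longleftrightarrow> x \<in> S \<and> x + h \<notin> S"
      by (simp only: Diff_iff mem diff_minus_eq_add)
    moreover have "x \<in> ?A' \<longleftrightarrow> x + h \<in> S \<and> x \<notin> S"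
      by (simp only: Diff_iff mem diff_minus_eq_add add_diff_cancel_right')
    ultimately show ?thesis by (cases "x \<in> S"; cases "x + h \<in> S") (simp_all add: indicator_def)
  qed
  then have "(\<integral>\<^sup>+x. ennreal \<bar>indicator S x - indicator S (x + h)\<bar> \<partial>lborel)
    = emeasure lborel (?A (- h)) + emeasure lborel ?A'"
    using A[of "- h"] A' by (simp add: nn_integral_add)
  also have "\<dots> \<le> ennreal ?B + ennreal ?B"
    using emeasure_convex_minus_translate[OF S r, of "- h"] emeasure_convex_minus_translate[OF S r, of h] A'(2)
    by (intro add_mono) simp_all
  also have "\<dots> = ennreal (?B + ?B)" using r by (intro ennreal_plus[symmetric]) auto
  also have "?B + ?B = unit_ball_vol DIM('a) * 2 ^ (DIM('a) + 2) * r ^ DIM('a) * min (norm h / r) 1" by simp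
  finally show ?thesis .
qed

section \<open>A radial integral\<close>

lemma ex_dyadic_scale:
  fixes t :: real assumes "1 \<le> t"
  obtains j :: nat where "2 ^ j \<le> t" "t < 2 ^ Suc j"
proof -
  define j where "j = nat \<lfloor>log 2 t\<rfloor>"
  have "0 \<le> log 2 t" using assms by simp
  then have j: "real j \<le> log 2 t" "log 2 t < real (Suc j)" unfolding j_def by linarith+
  have "2 powr real j \<le> 2 powr log 2 t" "2 powr log 2 t < 2 powr real (Suc j)" using j by auto
  then have "2 ^ j \<le> t" "t < 2 ^ Suc j" unfolding powr_realpow[OF zero_less_numeral] using assms by auto
  then show ?thesis by (rule that)
qed

lemma suminf_ennreal_geometric:
  assumes "0 \<le> c" "0 < q" "q < 1"
  shows "(\<Sum>j. ennreal (c * q ^ j)) = ennreal (c / (1 - q))"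
proof -
  have "(\<lambda>j. c * q ^ j) sums (c * (1 / (1 - q)))" using assms by (intro sums_mult geometric_sums) auto
  then show ?thesis using assms by (intro suminf_ennreal_eq) auto
qed

text \<open>Dyadic shells take the place of polar coordinates. Shells beyond \<open>r\<close>, where
  the minimum is 1, form a geometric series with ratio \<open>2 powr (- s)\<close>; shells inside
  \<open>r\<close>, where it is linear, form one with ratio \<open>2 powr (s - 1)\<close>. So
  \<open>s > 0\<close> is used at infinity and \<open>s < 1\<close> at the origin.\<close>

lemma radial_integral:
  fixes s :: real
  assumes s: "0 < s" "s < 1"
  shows "\<exists>C\<ge>0. \<forall>r>0. (\<integral>\<^sup>+h. ennreal (min (norm (h::'a::euclidean_space) / r) 1 / norm h powr (real DIM('a) + s)) \<partial>lborel)
     \<le> ennreal (C * r powr (- s))"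
proof -
  let ?n = "DIM('a)" let ?e = "real ?n + s" let ?V = "unit_ball_vol (real ?n)"
  define qa where "qa = 2 powr (- s)"
  define qb where "qb = 2 powr (s - 1)"
  have q: "0 < qa" "qa < 1" "0 < qb" "qb < 1"
    using s powr_less_mono[of "- s" 0 2] powr_less_mono[of "s - 1" 0 2] by (auto simp: qa_def qb_def)
  define C where "C = ?V * 2 ^ ?n / (1 - qa) + 2 * qb * (?V * 2 ^ ?n) / (1 - qb)"
  have C: "C \<ge> 0" using q by (simp add: C_def)
  have key: "R ^ ?n / R powr ?e = R powr (- s)" if "R > 0" for R :: real
  proof -
    have "R powr ?e = R ^ ?n * R powr s" using that by (simp add: powr_add powr_realpow)
    then show ?thesis using that by (simp add: powr_minus divide_inverse)
  qed
  have two: "(2 ^ j :: real) powr t = (2 powr t) ^ j" for j and t :: real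
    by (simp add: powr_realpow[symmetric] powr_powr mult.commute)
  have "(\<integral>\<^sup>+h. ennreal (min (norm (h::'a) / r) 1 / norm h powr ?e) \<partial>lborel) \<le> ennreal (C * r powr (- s))"
    if r: "r > 0" for r
  proof -
    define A where "A j = 2 ^ j * r" for j :: nat
    define B where "B j = r / 2 ^ Suc j" for j :: nat
    have AB: "A j > 0" "B j > 0" for j using r by (auto simp: A_def B_def)
    define a where "a j = 1 / A j powr ?e" for j :: nat
    define b where "b j = (2 * B j / r) / B j powr ?e" for j :: nat
    have ab: "0 \<le> a j" "0 \<le> b j" for j using AB[of j] r by (auto simp: a_def b_def intro!: divide_nonneg_nonneg)
    let ?Ba = "\<lambda>j::nat. cball (0::'a) (2 * A j)"
    let ?Bb = "\<lambda>j::nat. cball (0::'a) (2 * B j)"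
    let ?F = "\<lambda>h. (\<Sum>j. ennreal (a j) * indicator (?Ba j) h) + (\<Sum>j. ennreal (b j) * indicator (?Bb j) h)"
    have single: "f j \<le> (\<Sum>j. f j)" for f :: "nat \<Rightarrow> ennreal" and j
      using sum_le_suminf[OF summableI, of "{j}" f] by simp
    have pw: "ennreal (min (norm h / r) 1 / norm h powr ?e) \<le> ?F h" for h :: 'a
    proof (cases "h = 0")
      case True then show ?thesis using r by simp
    next
      case False
      then have h: "norm h > 0" by simp
      show ?thesis
      proof (cases "norm h \<ge> r")
        case True
        then have t: "1 \<le> norm h / r" using r by simp
        then obtain j where j: "2 ^ j \<le> norm h / r" "norm h / r < 2 ^ Suc j" using ex_dyadic_scale by blast
        have j1: "A j \<le> norm h" using j(1) r by (simp add: A_def field_simps)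
        have j2: "norm h \<le> 2 * A j" using j(2) r by (simp add: A_def field_simps)
        have "min (norm h / r) 1 / norm h powr ?e = 1 / norm h powr ?e"
          using t by (simp add: min_absorb2)
        also have "\<dots> \<le> a j"
          unfolding a_def using j1 AB[of j] h s by (intro divide_left_mono powr_mono2) auto
        finally have "ennreal (min (norm h / r) 1 / norm h powr ?e) \<le> ennreal (a j) * indicator (?Ba j) h"
          using j2 by (simp add: ennreal_leI)
        also have "\<dots> \<le> (\<Sum>j. ennreal (a j) * indicator (?Ba j) h)" by (rule single)
        also have "\<dots> \<le> ?F h" by simp
        finally show ?thesis .
      next
        case False
        then have "1 \<le> r / norm h" using h by simp
        then obtain j where j: "2 ^ j \<le> r / norm h" "r / norm h < 2 ^ Suc j" using ex_dyadic_scale by blast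
        have j1: "norm h \<le> 2 * B j" using j(1) h by (simp add: B_def field_simps)
        have j2: "B j \<le> norm h" using j(2) h by (simp add: B_def field_simps)
        have "min (norm h / r) 1 / norm h powr ?e \<le> b j"
          unfolding b_def
        proof (rule frac_le)
          show "0 \<le> 2 * B j / r" using AB[of j] r by simp
          have "norm h / r \<le> 2 * B j / r" using j1 r by (simp add: divide_right_mono)
          then show "min (norm h / r) 1 \<le> 2 * B j / r" by linarith
          show "0 < B j powr ?e" using AB[of j] by simp
          show "B j powr ?e \<le> norm h powr ?e" using j2 AB[of j] s by (intro powr_mono2) auto
        qed
        then have "ennreal (min (norm h / r) 1 / norm h powr ?e) \<le> ennreal (b j) * indicator (?Bb j) h"
          using j1 by (simp add: ennreal_leI)
        also have "\<dots> \<le> (\<Sum>j. ennreal (b j) * indicator (?Bb j) h)" by (rule single)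
        also have "\<dots> \<le> ?F h" by simp
        finally show ?thesis .
      qed
    qed
    have meas: "(\<lambda>h. ennreal c * indicator (cball (0::'a) R) h) \<in> borel_measurable borel" for c R
      by (intro borel_measurable_times_ennreal borel_measurable_const borel_measurable_indicator) auto
    have sa: "a j * (?V * (2 * A j) ^ ?n) = (?V * 2 ^ ?n * r powr (- s)) * qa ^ j" for j
    proof -
      have "a j * (?V * (2 * A j) ^ ?n) = ?V * 2 ^ ?n * (A j ^ ?n / A j powr ?e)" by (simp add: a_def power_mult_distrib)
      also have "A j ^ ?n / A j powr ?e = r powr (- s) * qa ^ j"
        using r by (simp only: key[OF AB(1)]) (simp add: A_def powr_mult two qa_def)
      finally show ?thesis by simp
    qed
    have sb: "b j * (?V * (2 * B j) ^ ?n) = (2 * qb * (?V * 2 ^ ?n * r powr (- s))) * qb ^ j" for j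
    proof -
      have "b j * (?V * (2 * B j) ^ ?n) = ?V * 2 ^ ?n * (2 * B j / r) * (B j ^ ?n / B j powr ?e)"
        by (simp add: b_def power_mult_distrib)
      also have "B j ^ ?n / B j powr ?e = B j powr (- s)" by (rule key[OF AB(2)])
      also have "B j powr (- s) = r powr (- s) * (2 powr s) ^ Suc j"
      proof -
        have "B j powr (- s) = r powr (- s) / (2 ^ Suc j) powr (- s)" unfolding B_def by (rule powr_divide)
        also have "\<dots> = r powr (- s) * (2 ^ Suc j) powr s" by (simp add: powr_minus divide_inverse)
        finally show ?thesis unfolding two .
      qed
      also have "?V * 2 ^ ?n * (2 * B j / r) * (r powr (- s) * (2 powr s) ^ Suc j)
        = 2 * (?V * 2 ^ ?n * r powr (- s)) * ((2 powr s) ^ Suc j / 2 ^ Suc j)"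
        using r unfolding B_def by (simp del: power_Suc)
      also have "(2 powr s) ^ Suc j / 2 ^ Suc j = qb ^ Suc j"
        unfolding power_divide[symmetric] by (simp only: qb_def powr_diff powr_one zero_le_numeral)
      finally show ?thesis by (simp add: mult_ac)
    qed
    have "(\<integral>\<^sup>+h. ennreal (min (norm (h::'a) / r) 1 / norm h powr ?e) \<partial>lborel) \<le> (\<integral>\<^sup>+h. ?F h \<partial>lborel)"
      by (rule nn_integral_mono) (rule pw)
    also have "\<dots> = (\<integral>\<^sup>+h. (\<Sum>j. ennreal (a j) * indicator (?Ba j) h) \<partial>lborel) + (\<integral>\<^sup>+h. (\<Sum>j. ennreal (b j) * indicator (?Bb j) h) \<partial>lborel)"
      by (rule nn_integral_add) (use meas in measurable)
    also have "(\<integral>\<^sup>+h. (\<Sum>j. ennreal (a j) * indicator (?Ba j) h) \<partial>lborel) = (\<Sum>j. ennreal (a j) * emeasure lborel (?Ba j))"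
      by (subst nn_integral_suminf) (auto simp: nn_integral_cmult_indicator intro: meas)
    also have "(\<integral>\<^sup>+h. (\<Sum>j. ennreal (b j) * indicator (?Bb j) h) \<partial>lborel) = (\<Sum>j. ennreal (b j) * emeasure lborel (?Bb j))"
      by (subst nn_integral_suminf) (auto simp: nn_integral_cmult_indicator intro: meas)
    also have "(\<Sum>j. ennreal (a j) * emeasure lborel (?Ba j)) = (\<Sum>j. ennreal ((?V * 2 ^ ?n * r powr (- s)) * qa ^ j))"
      unfolding sa[symmetric] using AB ab less_imp_le[OF AB(1)] by (simp add: emeasure_cball ennreal_mult)
    also have "(\<Sum>j. ennreal (b j) * emeasure lborel (?Bb j)) = (\<Sum>j. ennreal ((2 * qb * (?V * 2 ^ ?n * r powr (- s))) * qb ^ j))"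
      unfolding sb[symmetric] using AB ab less_imp_le[OF AB(2)] by (simp add: emeasure_cball ennreal_mult)
    also have "(\<Sum>j. ennreal ((?V * 2 ^ ?n * r powr (- s)) * qa ^ j)) = ennreal (?V * 2 ^ ?n * r powr (- s) / (1 - qa))"
      using q by (intro suminf_ennreal_geometric) auto
    also have "(\<Sum>j. ennreal ((2 * qb * (?V * 2 ^ ?n * r powr (- s))) * qb ^ j)) = ennreal (2 * qb * (?V * 2 ^ ?n * r powr (- s)) / (1 - qb))"
      using q by (intro suminf_ennreal_geometric) auto
    also have "ennreal (?V * 2 ^ ?n * r powr (- s) / (1 - qa)) + ennreal (2 * qb * (?V * 2 ^ ?n * r powr (- s)) / (1 - qb))
      = ennreal (C * r powr (- s))"
      using q by (subst ennreal_plus[symmetric]) (auto simp: C_def algebra_simps add_divide_distrib)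
    finally show ?thesis .
  qed
  then show ?thesis using C by blast
qed

text \<open>Jensen's inequality for \<open>t powr p\<close> with weights proportional to
  \<open>l\<close>. The weights are free here and are adapted later to the sizes of the
  simplices.\<close>

lemma powr_sum_le:
  fixes a l :: "'i \<Rightarrow> real"
  assumes fin: "finite J" and l: "\<And>j. j \<in> J \<Longrightarrow> 0 < l j" and p: "1 \<le> p"
  shows "\<bar>\<Sum>j\<in>J. a j\<bar> powr p \<le> (\<Sum>j\<in>J. l j) powr (p - 1) * (\<Sum>j\<in>J. l j powr (1 - p) * \<bar>a j\<bar> powr p)"
proof -
  \<comment> \<open>Convexity of \<open>t powr p\<close> is used on the open half line, so zero
    terms are dropped first.\<close>
  define K where "K = {j \<in> J. a j \<noteq> 0}"
  have K: "finite K" "K \<subseteq> J" using fin by (auto simp: K_def)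
  have aK: "(\<Sum>j\<in>J. a j) = (\<Sum>j\<in>K. a j)" by (rule sum.mono_neutral_right) (use fin in \<open>auto simp: K_def\<close>)
  show ?thesis
  proof (cases "K = {}")
    case True
    then show ?thesis using aK l p by (auto intro!: mult_nonneg_nonneg sum_nonneg)
  next
    case False
    define A where "A = (\<Sum>j\<in>K. l j)"
    have A: "A > 0" unfolding A_def using False K l by (intro sum_pos) auto
    have "A \<le> (\<Sum>j\<in>J. l j)" unfolding A_def using K fin l by (intro sum_mono2) (auto intro: less_imp_le)
    have "\<bar>\<Sum>j\<in>K. a j\<bar> \<le> (\<Sum>j\<in>K. \<bar>a j\<bar>)" by (rule sum_abs)
    also have "\<dots> = A * (\<Sum>j\<in>K. (l j / A) *\<^sub>R (\<bar>a j\<bar> / l j))"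
      unfolding sum_distrib_left
    proof (rule sum.cong[OF refl])
      fix j assume "j \<in> K"
      then have "l j > 0" using l K by auto
      then show "\<bar>a j\<bar> = A * ((l j / A) *\<^sub>R (\<bar>a j\<bar> / l j))" using A by simp
    qed
    finally have "\<bar>\<Sum>j\<in>K. a j\<bar> powr p \<le> (A * (\<Sum>j\<in>K. (l j / A) *\<^sub>R (\<bar>a j\<bar> / l j))) powr p"
      using p by (intro powr_mono2) auto
    also have "\<dots> = A powr p * (\<Sum>j\<in>K. (l j / A) *\<^sub>R (\<bar>a j\<bar> / l j)) powr p"
      by (rule powr_mult)
    also have "\<dots> \<le> A powr p * (\<Sum>j\<in>K. (l j / A) * (\<bar>a j\<bar> / l j) powr p)"
    proof (intro mult_left_mono convex_on_sum[OF K(1) False powr_convex[OF p]])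
      show "(\<Sum>j\<in>K. l j / A) = 1" using A by (simp add: A_def sum_divide_distrib[symmetric])
      show "0 \<le> l j / A" if "j \<in> K" for j using that A l K by (auto intro!: divide_nonneg_nonneg less_imp_le)
      show "\<bar>a j\<bar> / l j \<in> {0<..}" if "j \<in> K" for j using that l K by (auto simp: K_def)
    qed simp
    also have "\<dots> = A powr (p - 1) * (\<Sum>j\<in>K. l j powr (1 - p) * \<bar>a j\<bar> powr p)"
      unfolding sum_distrib_left
    proof (rule sum.cong[OF refl])
      fix j assume "j \<in> K"
      then have "l j > 0" using l K by auto
      then show "A powr p * (l j / A * (\<bar>a j\<bar> / l j) powr p) = A powr (p - 1) * (l j powr (1 - p) * \<bar>a j\<bar> powr p)"
        using A by (simp add: powr_divide powr_diff field_simps)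
    qed
    also have "\<dots> \<le> (\<Sum>j\<in>J. l j) powr (p - 1) * (\<Sum>j\<in>J. l j powr (1 - p) * \<bar>a j\<bar> powr p)"
      using \<open>A \<le> _\<close> A p K fin by (intro mult_mono powr_mono2 sum_mono2) (auto intro!: sum_nonneg)
    finally show ?thesis unfolding aK .
  qed
qed

lemma ennreal_weighted_sum:
  assumes "0 \<le> A" "\<And>j. j \<in> J \<Longrightarrow> 0 \<le> l j" "\<And>j. j \<in> J \<Longrightarrow> 0 \<le> d j"
  shows "ennreal (A * (\<Sum>j\<in>J. l j * d j)) = ennreal A * (\<Sum>j\<in>J. ennreal (l j) * ennreal (d j))"
proof -
  have "(\<Sum>j\<in>J. ennreal (l j) * ennreal (d j)) = (\<Sum>j\<in>J. ennreal (l j * d j))"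
    using assms by (intro sum.cong) (auto simp: ennreal_mult)
  also have "\<dots> = ennreal (\<Sum>j\<in>J. l j * d j)" using assms by (intro sum_ennreal) auto
  finally show ?thesis using assms by (simp add: ennreal_mult sum_nonneg)
qed

lemma nn_integral_weighted_sum:
  assumes "\<And>j. j \<in> J \<Longrightarrow> f j \<in> borel_measurable M"
  shows "(\<integral>\<^sup>+x. a * (\<Sum>j\<in>J. c j * f j x) \<partial>M) = a * (\<Sum>j\<in>J. c j * (\<integral>\<^sup>+x. f j x \<partial>M))"
  using assms by (simp add: nn_integral_cmult nn_integral_sum)

text \<open>The p-th power of the seminorm. Without the outer root, Jensen's inequality and Fatou's
  lemma apply directly under the integrals.\<close>

definition sobolev_energy :: "real \<Rightarrow> real \<Rightarrow> ('a::euclidean_space \<Rightarrow> real) \<Rightarrow> ennreal" where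
  "sobolev_energy \<beta> p f = (if \<beta> = 0 then (\<integral>\<^sup>+x. ennreal (\<bar>f x\<bar> powr p) \<partial>lborel)
     else (\<integral>\<^sup>+x. \<integral>\<^sup>+y. ennreal (\<bar>f x - f y\<bar> powr p / norm (x - y) powr (real DIM('a) + \<beta> * p)) \<partial>lborel \<partial>lborel))"

lemma sobolev_seminorm_energy: "sobolev_seminorm \<beta> p f = ennreal_powr (sobolev_energy \<beta> p f) (1 / p)"
  by (simp add: sobolev_seminorm_def sobolev_energy_def)

text \<open>Measurability is asked of the approximants: the integrals of \<open>f\<close> are
  rewritten almost everywhere as integrals of a lower limit, and then Fatou's lemma applies, twice
  if \<open>\<beta> \<noteq> 0\<close>.\<close>

lemma sobolev_energy_liminf:
  fixes f :: "'a::euclidean_space \<Rightarrow> real"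
  assumes g[measurable]: "\<And>k. g k \<in> borel_measurable borel"
    and lim: "AE x in lborel. (\<lambda>k. g k x) \<longlonglongrightarrow> f x" and p: "p > 0"
    and le: "\<And>k. sobolev_energy \<beta> p (g k) \<le> B"
  shows "sobolev_energy \<beta> p f \<le> B"
proof (cases "\<beta> = 0")
  case True
  have "(\<integral>\<^sup>+x. ennreal (\<bar>f x\<bar> powr p) \<partial>lborel) = (\<integral>\<^sup>+x. liminf (\<lambda>k. ennreal (\<bar>g k x\<bar> powr p)) \<partial>lborel)"
  proof (rule nn_integral_cong_AE)
    show "AE x in lborel. ennreal (\<bar>f x\<bar> powr p) = liminf (\<lambda>k. ennreal (\<bar>g k x\<bar> powr p))"
      using lim
    proof eventually_elim
      case (elim x)
      have "(\<lambda>k. ennreal (\<bar>g k x\<bar> powr p)) \<longlonglongrightarrow> ennreal (\<bar>f x\<bar> powr p)"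
        using elim p by (intro tendsto_ennrealI tendsto_powr' tendsto_rabs tendsto_const) auto
      then show ?case by (rule lim_imp_Liminf[OF sequentially_bot, symmetric])
    qed
  qed
  also have "\<dots> \<le> liminf (\<lambda>k. \<integral>\<^sup>+x. ennreal (\<bar>g k x\<bar> powr p) \<partial>lborel)"
    by (rule nn_integral_liminf) measurable
  also have "\<dots> \<le> B"
    using le True unfolding sobolev_energy_def by (simp add: Liminf_le always_eventually)
  finally show ?thesis using True by (simp add: sobolev_energy_def)
next
  case False
  let ?e = "real DIM('a) + \<beta> * p"
  let ?G = "\<lambda>k x y. ennreal (\<bar>g k x - g k y\<bar> powr p / norm (x - y) powr ?e)"
  have "(\<integral>\<^sup>+x. \<integral>\<^sup>+y. ennreal (\<bar>f x - f y\<bar> powr p / norm (x - y) powr ?e) \<partial>lborel \<partial>lborel)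
    = (\<integral>\<^sup>+x. \<integral>\<^sup>+y. liminf (\<lambda>k. ?G k x y) \<partial>lborel \<partial>lborel)"
  proof (rule nn_integral_cong_AE)
    show "AE x in lborel. (\<integral>\<^sup>+y. ennreal (\<bar>f x - f y\<bar> powr p / norm (x - y) powr ?e) \<partial>lborel) = (\<integral>\<^sup>+y. liminf (\<lambda>k. ?G k x y) \<partial>lborel)"
      using lim
    proof eventually_elim
      case (elim x)
      show ?case
      proof (rule nn_integral_cong_AE)
        show "AE y in lborel. ennreal (\<bar>f x - f y\<bar> powr p / norm (x - y) powr ?e) = liminf (\<lambda>k. ?G k x y)"
          using lim
        proof eventually_elim
          case y: (elim y)
          have "(\<lambda>k. \<bar>g k x - g k y\<bar> powr p) \<longlonglongrightarrow> \<bar>f x - f y\<bar> powr p"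
            using elim y p by (intro tendsto_powr' tendsto_rabs tendsto_const tendsto_diff) auto
          then have "(\<lambda>k. \<bar>g k x - g k y\<bar> powr p * inverse (norm (x - y) powr ?e)) \<longlonglongrightarrow> \<bar>f x - f y\<bar> powr p * inverse (norm (x - y) powr ?e)"
            by (intro tendsto_mult tendsto_const)
          then have "(\<lambda>k. ?G k x y) \<longlonglongrightarrow> ennreal (\<bar>f x - f y\<bar> powr p / norm (x - y) powr ?e)"
            unfolding divide_inverse by (rule tendsto_ennrealI)
          then show ?case by (rule lim_imp_Liminf[OF sequentially_bot, symmetric])
        qed
      qed
    qed
  qed
  also have "\<dots> \<le> (\<integral>\<^sup>+x. liminf (\<lambda>k. \<integral>\<^sup>+y. ?G k x y \<partial>lborel) \<partial>lborel)"
    by (intro nn_integral_mono nn_integral_liminf) measurable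
  also have "\<dots> \<le> liminf (\<lambda>k. \<integral>\<^sup>+x. \<integral>\<^sup>+y. ?G k x y \<partial>lborel \<partial>lborel)"
    by (rule nn_integral_liminf) measurable
  also have "\<dots> \<le> B"
    using le False unfolding sobolev_energy_def by (simp add: Liminf_le always_eventually)
  finally show ?thesis using False by (simp add: sobolev_energy_def)
qed

text \<open>With \<open>y = x + h\<close> and the order of integration exchanged, the inner integral
  is the measure of a symmetric difference of translates, at most
  \<open>r ^ n * min (norm h / r) 1\<close> up to a constant. The radial integral does the
  rest.\<close>

lemma sobolev_energy_convex_indicator:
  assumes p: "1 \<le> p" and \<beta>: "0 \<le> \<beta>" "\<beta> * p < 1"
  shows "\<exists>C\<ge>0. \<forall>(S :: 'a::euclidean_space set) c r. convex S \<longrightarrow> compact S \<longrightarrow> S \<subseteq> cball c r \<longrightarrow> r > 0 \<longrightarrow>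
     sobolev_energy \<beta> p (indicator S) \<le> ennreal (C * r powr (real DIM('a) - \<beta> * p))"
proof (cases "\<beta> = 0")
  case True
  have "sobolev_energy \<beta> p (indicator S) \<le> ennreal (unit_ball_vol (DIM('a)) * r powr (real DIM('a) - \<beta> * p))"
    if S: "convex S" "compact S" "S \<subseteq> cball c r" "r > 0" for S :: "'a set" and c r
  proof -
    have "sobolev_energy \<beta> p (indicator S) = (\<integral>\<^sup>+x. indicator S x \<partial>lborel)"
      using True p by (auto simp: sobolev_energy_def indicator_def intro!: nn_integral_cong)
    also have "\<dots> = emeasure lborel S" using S by (simp add: borel_compact)
    also have "\<dots> \<le> emeasure lborel (cball c r)" using S by (intro emeasure_mono) auto
    also have "\<dots> = ennreal (unit_ball_vol (DIM('a)) * r powr (real DIM('a) - \<beta> * p))"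
      using S True by (simp add: emeasure_cball powr_realpow)
    finally show ?thesis .
  qed
  then show ?thesis by (intro exI[of _ "unit_ball_vol (DIM('a))"]) auto
next
  case False
  let ?n = "DIM('a)"
  define s where "s = \<beta> * p"
  have s: "0 < s" "s < 1" using False \<beta> p by (auto simp: s_def)
  obtain C where C: "C \<ge> 0" and rad: "\<And>r. r > 0 \<Longrightarrow>
      (\<integral>\<^sup>+h. ennreal (min (norm (h::'a) / r) 1 / norm h powr (real ?n + s)) \<partial>lborel) \<le> ennreal (C * r powr (- s))"
    using radial_integral[OF s, where 'a='a] by blast
  define D where "D = unit_ball_vol ?n * 2 ^ (?n + 2)"
  have D: "D \<ge> 0" by (simp add: D_def)
  have "sobolev_energy \<beta> p (indicator S) \<le> ennreal ((D * C) * r powr (real ?n - s))"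
    if S: "convex S" "compact S" "S \<subseteq> cball c r" and r: "r > 0" for S :: "'a set" and c r
  proof -
    have [measurable]: "S \<in> sets borel" using S by (simp add: borel_compact)
    let ?i = "\<lambda>x h. ennreal \<bar>indicator S x - indicator S (x + h)\<bar>" 
    let ?k = "\<lambda>h. ennreal (1 / norm h powr (real ?n + s))"
    \<comment> \<open>A difference of two indicator values has absolute value 0 or 1, so the power
      \<open>p\<close> disappears and the energy depends on \<open>s = \<beta> * p\<close>
      alone.\<close>
    have "sobolev_energy \<beta> p (indicator S)
      = (\<integral>\<^sup>+x. \<integral>\<^sup>+y. ennreal (\<bar>indicator S x - indicator S y\<bar> / norm (x - y) powr (real ?n + s)) \<partial>lborel \<partial>lborel)"
      using False p unfolding sobolev_energy_def s_def
      by (auto simp: indicator_def intro!: nn_integral_cong)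
    also have "\<dots> = (\<integral>\<^sup>+x. \<integral>\<^sup>+h. ?i x h * ?k h \<partial>lborel \<partial>lborel)"
    proof (rule nn_integral_cong)
      fix x :: 'a
      have "(\<integral>\<^sup>+y. ennreal (\<bar>indicator S x - indicator S y\<bar> / norm (x - y) powr (real ?n + s)) \<partial>lborel)
        = (\<integral>\<^sup>+h. ennreal (\<bar>indicator S x - indicator S (x + h)\<bar> / norm (x - (x + h)) powr (real ?n + s)) \<partial>lborel)"
        by (rule nn_integral_lborel_shift) measurable
      then show "(\<integral>\<^sup>+y. ennreal (\<bar>indicator S x - indicator S y\<bar> / norm (x - y) powr (real ?n + s)) \<partial>lborel)
        = (\<integral>\<^sup>+h. ?i x h * ?k h \<partial>lborel)"
        by (simp add: ennreal_mult[symmetric])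
    qed
    also have "\<dots> = (\<integral>\<^sup>+h. \<integral>\<^sup>+x. ?i x h * ?k h \<partial>lborel \<partial>lborel)"
    proof (rule lborel_pair.Fubini'[symmetric])
      show "(\<lambda>(x, h). ?i x h * ?k h) \<in> borel_measurable (lborel \<Otimes>\<^sub>M lborel)" by measurable
    qed
    also have "\<dots> = (\<integral>\<^sup>+h. (\<integral>\<^sup>+x. ?i x h \<partial>lborel) * ?k h \<partial>lborel)"
      by (intro nn_integral_cong nn_integral_multc) measurable
    also have "\<dots> \<le> (\<integral>\<^sup>+h. ennreal (D * r ^ ?n) * ennreal (min (norm (h::'a) / r) 1 / norm h powr (real ?n + s)) \<partial>lborel)"
    proof (rule nn_integral_mono)
      fix h :: 'a
      have "(\<integral>\<^sup>+x. ?i x h \<partial>lborel) * ?k h \<le> ennreal (D * r ^ ?n * min (norm h / r) 1) * ?k h"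
        using indicator_shift_integral[OF S r, of h] unfolding D_def by (intro mult_right_mono) auto
      also have "\<dots> = ennreal (D * r ^ ?n) * ennreal (min (norm (h::'a) / r) 1 / norm h powr (real ?n + s))"
        using D r by (simp add: ennreal_mult[symmetric])
      finally show "(\<integral>\<^sup>+x. ?i x h \<partial>lborel) * ?k h \<le> ennreal (D * r ^ ?n) * ennreal (min (norm (h::'a) / r) 1 / norm h powr (real ?n + s))" .
    qed
    also have "\<dots> = ennreal (D * r ^ ?n) * (\<integral>\<^sup>+h. ennreal (min (norm (h::'a) / r) 1 / norm h powr (real ?n + s)) \<partial>lborel)"
      by (rule nn_integral_cmult) measurable
    also have "\<dots> \<le> ennreal (D * r ^ ?n) * ennreal (C * r powr (- s))" by (intro mult_left_mono rad r) simp
    also have "\<dots> = ennreal ((D * C) * r powr (real ?n - s))"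
      using D C r by (simp add: ennreal_mult[symmetric] powr_diff powr_realpow powr_minus divide_inverse mult_ac)
    finally show ?thesis .
  qed
  then show ?thesis using C D unfolding s_def by (intro exI[of _ "D * C"]) auto
qed

proposition sobolev_energy_sum_convex_indicators:
  assumes p: "1 \<le> p" and \<beta>: "0 \<le> \<beta>" "\<beta> * p < 1"
  shows "\<exists>C\<ge>0. \<forall>J (S :: 'i \<Rightarrow> 'a::euclidean_space set) c r a. finite J \<longrightarrow>
     (\<forall>j\<in>J. convex (S j) \<and> compact (S j) \<and> S j \<subseteq> cball (c j) (r j) \<and> r j > 0 \<and> \<bar>a j\<bar> \<le> 1) \<longrightarrow>
     sobolev_energy \<beta> p (\<lambda>x. \<Sum>j\<in>J. a j * indicator (S j) x)
       \<le> ennreal (C * (\<Sum>j\<in>J. r j powr (real DIM('a) / p - \<beta>)) powr p)"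
proof -
  let ?n = "DIM('a)"
  obtain C where C: "C \<ge> 0" and ind: "\<And>(S :: 'a set) c r. convex S \<Longrightarrow> compact S \<Longrightarrow> S \<subseteq> cball c r \<Longrightarrow> r > 0 \<Longrightarrow>
     sobolev_energy \<beta> p (indicator S) \<le> ennreal (C * r powr (real ?n - \<beta> * p))"
    using sobolev_energy_convex_indicator[OF assms, where 'a='a] by blast
  have "sobolev_energy \<beta> p (\<lambda>x. \<Sum>j\<in>J. a j * indicator (S j) x)
       \<le> ennreal (C * (\<Sum>j\<in>J. r j powr (real ?n / p - \<beta>)) powr p)"
    if fin: "finite J" and J: "\<And>j. j \<in> J \<Longrightarrow> convex (S j) \<and> compact (S j) \<and> S j \<subseteq> cball (c j) (r j) \<and> r j > 0 \<and> \<bar>a j\<bar> \<le> 1"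
    for J :: "'i set" and S :: "'i \<Rightarrow> 'a set" and c r a
  proof -
    define \<gamma> where "\<gamma> = real ?n / p - \<beta>"
    \<comment> \<open>With this weight \<open>l powr (1 - p) * r powr (n - \<beta> * p) = l\<close>,
      because \<open>\<gamma> * p = n - \<beta> * p\<close>. The sum of weighted energies then
      collapses to a multiple of \<open>A\<close>.\<close>
    define l where "l j = r j powr \<gamma>" for j
    define A where "A = (\<Sum>j\<in>J. l j)"
    have l: "0 < l j" if "j \<in> J" for j using J[OF that] by (simp add: l_def)
    have A0: "A \<ge> 0" unfolding A_def by (intro sum_nonneg) (use l in \<open>auto intro: less_imp_le\<close>)
    have Sm: "S j \<in> sets borel" if "j \<in> J" for j using J[OF that] by (simp add: borel_compact)
    have \<gamma>p: "\<gamma> * (1 - p) + (real ?n - \<beta> * p) = \<gamma>" using p by (simp add: \<gamma>_def field_simps)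
    have amp: "\<bar>\<Sum>j\<in>J. a j * t j\<bar> powr p \<le> A powr (p - 1) * (\<Sum>j\<in>J. l j powr (1 - p) * \<bar>t j\<bar> powr p)" for t
    proof -
      have "\<bar>\<Sum>j\<in>J. a j * t j\<bar> powr p \<le> A powr (p - 1) * (\<Sum>j\<in>J. l j powr (1 - p) * \<bar>a j * t j\<bar> powr p)"
        unfolding A_def by (rule powr_sum_le[OF fin l p])
      also have "\<dots> \<le> A powr (p - 1) * (\<Sum>j\<in>J. l j powr (1 - p) * \<bar>t j\<bar> powr p)"
      proof (intro mult_left_mono sum_mono powr_mono2)
        fix j assume "j \<in> J"
        then show "\<bar>a j * t j\<bar> \<le> \<bar>t j\<bar>" using J[of j] by (simp add: abs_mult mult_left_le_one_le)
      qed (use p in auto)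
      finally show ?thesis .
    qed
    have "sobolev_energy \<beta> p (\<lambda>x. \<Sum>j\<in>J. a j * indicator (S j) x)
      \<le> ennreal (A powr (p - 1)) * (\<Sum>j\<in>J. ennreal (l j powr (1 - p)) * sobolev_energy \<beta> p (indicator (S j)))"
    proof (cases "\<beta> = 0")
      case True
      have "(\<integral>\<^sup>+x. ennreal (\<bar>\<Sum>j\<in>J. a j * indicator (S j) x\<bar> powr p) \<partial>lborel)
        \<le> (\<integral>\<^sup>+x. ennreal (A powr (p - 1)) * (\<Sum>j\<in>J. ennreal (l j powr (1 - p)) * ennreal (\<bar>indicator (S j) x\<bar> powr p)) \<partial>lborel)"
      proof (rule nn_integral_mono)
        fix x
        show "ennreal (\<bar>\<Sum>j\<in>J. a j * indicator (S j) x\<bar> powr p)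
          \<le> ennreal (A powr (p - 1)) * (\<Sum>j\<in>J. ennreal (l j powr (1 - p)) * ennreal (\<bar>indicator (S j) x\<bar> powr p))"
          using ennreal_leI[OF amp[of "\<lambda>j. indicator (S j) x"]]
          by (subst ennreal_weighted_sum[symmetric]) auto
      qed
      also have "\<dots> = ennreal (A powr (p - 1)) * (\<Sum>j\<in>J. ennreal (l j powr (1 - p)) * (\<integral>\<^sup>+x. ennreal (\<bar>indicator (S j) x\<bar> powr p) \<partial>lborel))"
        using Sm by (intro nn_integral_weighted_sum) auto
      finally show ?thesis using True by (simp add: sobolev_energy_def)
    next
      case False
      let ?w = "\<lambda>x y :: 'a. norm (x - y) powr (real ?n + \<beta> * p)"
      let ?d = "\<lambda>j x y. \<bar>indicator (S j) x - indicator (S j) y :: real\<bar> powr p / ?w x y"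
      have meas: "(\<lambda>(x, y). ennreal (?d j x y)) \<in> borel_measurable (borel \<Otimes>\<^sub>M borel)" if "j \<in> J" for j
      proof -
        have [measurable]: "S j \<in> sets borel" using Sm that by simp
        show ?thesis by measurable
      qed
      have meas1: "(\<lambda>y. ennreal (?d j x y)) \<in> borel_measurable lborel" if "j \<in> J" for j x
      proof -
        have [measurable]: "S j \<in> sets borel" using Sm that by simp
        show ?thesis by measurable
      qed
      have meas2: "(\<lambda>x. \<integral>\<^sup>+y. ennreal (?d j x y) \<partial>lborel) \<in> borel_measurable lborel" if "j \<in> J" for j
      proof -
        have [measurable]: "S j \<in> sets borel" using Sm that by simp
        show ?thesis by measurable
      qed
      have "(\<integral>\<^sup>+x. \<integral>\<^sup>+y. ennreal (\<bar>(\<Sum>j\<in>J. a j * indicator (S j) x) - (\<Sum>j\<in>J. a j * indicator (S j) y)\<bar> powr p / ?w x y) \<partial>lborel \<partial>lborel)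
        \<le> (\<integral>\<^sup>+x. \<integral>\<^sup>+y. ennreal (A powr (p - 1)) * (\<Sum>j\<in>J. ennreal (l j powr (1 - p)) * ennreal (?d j x y)) \<partial>lborel \<partial>lborel)"
      proof (intro nn_integral_mono)
        fix x y
        have "\<bar>(\<Sum>j\<in>J. a j * indicator (S j) x) - (\<Sum>j\<in>J. a j * indicator (S j) y)\<bar> powr p
          \<le> A powr (p - 1) * (\<Sum>j\<in>J. l j powr (1 - p) * \<bar>indicator (S j) x - indicator (S j) y\<bar> powr p)"
          using amp[of "\<lambda>j. indicator (S j) x - indicator (S j) y"] by (simp add: sum_subtractf right_diff_distrib)
        then have "\<bar>(\<Sum>j\<in>J. a j * indicator (S j) x) - (\<Sum>j\<in>J. a j * indicator (S j) y)\<bar> powr p / ?w x y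
          \<le> A powr (p - 1) * (\<Sum>j\<in>J. l j powr (1 - p) * \<bar>indicator (S j) x - indicator (S j) y\<bar> powr p) / ?w x y"
          by (intro divide_right_mono) auto
        also have "\<dots> = A powr (p - 1) * (\<Sum>j\<in>J. l j powr (1 - p) * ?d j x y)"
          by (simp add: sum_divide_distrib[symmetric])
        finally show "ennreal (\<bar>(\<Sum>j\<in>J. a j * indicator (S j) x) - (\<Sum>j\<in>J. a j * indicator (S j) y)\<bar> powr p / ?w x y)
          \<le> ennreal (A powr (p - 1)) * (\<Sum>j\<in>J. ennreal (l j powr (1 - p)) * ennreal (?d j x y))"
          by (subst ennreal_weighted_sum[symmetric]) (auto intro: ennreal_leI)
      qed
      also have "\<dots> = (\<integral>\<^sup>+x. ennreal (A powr (p - 1)) * (\<Sum>j\<in>J. ennreal (l j powr (1 - p)) * (\<integral>\<^sup>+y. ennreal (?d j x y) \<partial>lborel)) \<partial>lborel)"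
        by (intro nn_integral_cong nn_integral_weighted_sum meas1)
      also have "\<dots> = ennreal (A powr (p - 1)) * (\<Sum>j\<in>J. ennreal (l j powr (1 - p)) * (\<integral>\<^sup>+x. \<integral>\<^sup>+y. ennreal (?d j x y) \<partial>lborel \<partial>lborel))"
        by (intro nn_integral_weighted_sum meas2)
      finally show ?thesis using False by (simp add: sobolev_energy_def)
    qed
    also have "\<dots> \<le> ennreal (A powr (p - 1)) * (\<Sum>j\<in>J. ennreal (l j powr (1 - p)) * ennreal (C * r j powr (real ?n - \<beta> * p)))"
      using J by (intro mult_left_mono sum_mono ind) auto
    also have "\<dots> = ennreal (A powr (p - 1)) * (\<Sum>j\<in>J. ennreal (C * l j))"
    proof -
      have cancel: "l j powr (1 - p) * (C * r j powr (real ?n - \<beta> * p)) = C * l j" if "j \<in> J" for j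
      proof -
        have "l j powr (1 - p) * r j powr (real ?n - \<beta> * p) = r j powr (\<gamma> * (1 - p) + (real ?n - \<beta> * p))"
          by (simp add: l_def powr_powr powr_add)
        then show ?thesis unfolding \<gamma>p l_def by simp
      qed
      have "ennreal (l j powr (1 - p)) * ennreal (C * r j powr (real ?n - \<beta> * p)) = ennreal (C * l j)" if "j \<in> J" for j
        unfolding cancel[OF that, symmetric] using C by (subst ennreal_mult[symmetric]) auto
      then show ?thesis by simp
    qed
    also have "\<dots> = ennreal (A powr (p - 1) * (C * A))"
    proof -
      have "(\<Sum>j\<in>J. ennreal (C * l j)) = ennreal (C * A)"
        using C l by (subst sum_ennreal) (auto simp: A_def sum_distrib_left less_imp_le)
      then show ?thesis using C A0 by (simp add: ennreal_mult)
    qed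
    also have "A powr (p - 1) * (C * A) = C * A powr p"
    proof -
      have "A powr p = A powr (p - 1) * A" using powr_add[of A "p - 1" 1] A0 by simp
      then show ?thesis by (simp only: mult_ac)
    qed
    finally show ?thesis unfolding A_def l_def \<gamma>_def .
  qed
  note main = this
  show ?thesis
  proof (intro exI[of _ C] conjI allI impI)
    fix J :: "'i set" and S :: "'i \<Rightarrow> 'a set" and c and r a :: "'i \<Rightarrow> real"
    assume "finite J" "\<forall>j\<in>J. convex (S j) \<and> compact (S j) \<and> S j \<subseteq> cball (c j) (r j) \<and> r j > 0 \<and> \<bar>a j\<bar> \<le> 1"
    then show "sobolev_energy \<beta> p (\<lambda>x. \<Sum>j\<in>J. a j * indicator (S j) x)
       \<le> ennreal (C * (\<Sum>j\<in>J. r j powr (real ?n / p - \<beta>)) powr p)"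
      by (intro main[where c=c]) auto
  qed (rule C)
qed

section \<open>Box counting and Hoelder maps\<close>

lemma card_int_box_le:
  fixes lo :: "'n::finite \<Rightarrow> int"
  assumes "\<And>z. z \<in> Z \<Longrightarrow> \<forall>i. lo i \<le> z $ i \<and> z $ i < lo i + int m"
  shows "finite Z" and "card Z \<le> m ^ CARD('n)"
proof -
  let ?P = "PiE UNIV (\<lambda>i. {lo i..<lo i + int m})"
  have sub: "Z \<subseteq> vec_lambda ` ?P"
  proof
    fix z assume "z \<in> Z"
    then have "(\<lambda>i. z $ i) \<in> ?P" using assms by auto
    moreover have "z = vec_lambda (\<lambda>i. z $ i)" by (simp add: vec_eq_iff)
    ultimately show "z \<in> vec_lambda ` ?P" by (metis imageI)
  qed
  have fin: "finite ?P" by (rule finite_PiE) auto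
  then show "finite Z" using sub finite_surj by blast
  have "card Z \<le> card (vec_lambda ` ?P)" using sub fin by (intro card_mono) auto
  also have "\<dots> \<le> card ?P" using fin by (rule card_image_le)
  also have "\<dots> = m ^ CARD('n)" by (simp add: card_PiE)
  finally show "card Z \<le> m ^ CARD('n)" .
qed

definition touching_cubes :: "nat \<Rightarrow> (real^'n) set \<Rightarrow> (int^'n) set" where
  "touching_cubes k K = {z. dcube k z \<inter> K \<noteq> {}}"

lemma touching_cubes_ball:
  fixes x :: "real^'n"
  shows "finite (touching_cubes k (ball x (1 / 2^k)))" and "card (touching_cubes k (ball x (1 / 2^k))) \<le> 4 ^ CARD('n)"
proof -
  have "\<forall>i. \<lfloor>2^k * x $ i\<rfloor> - 2 \<le> z $ i \<and> z $ i < (\<lfloor>2^k * x $ i\<rfloor> - 2) + int 4"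
    if z: "z \<in> touching_cubes k (ball x (1 / 2^k))" for z
  proof
    fix i
    obtain p where p: "p \<in> dcube k z" "dist x p < 1 / 2^k" using z by (auto simp: touching_cubes_def)
    have "\<bar>(x - p) $ i\<bar> \<le> norm (x - p)" by (rule component_le_norm_cart)
    then have "\<bar>x $ i - p $ i\<bar> < 1 / 2^k" using p(2) by (simp add: dist_norm)
    then have "2^k * \<bar>x $ i - p $ i\<bar> < 1" by (simp add: field_simps)
    then have "\<bar>2^k * x $ i - 2^k * p $ i\<bar> < 1" by (simp add: right_diff_distrib[symmetric] abs_mult)
    moreover have "of_int (z $ i) \<le> 2^k * p $ i" "2^k * p $ i \<le> of_int (z $ i) + 1" using p(1) by (auto simp: dcube_def)
    ultimately show "\<lfloor>2^k * x $ i\<rfloor> - 2 \<le> z $ i \<and> z $ i < (\<lfloor>2^k * x $ i\<rfloor> - 2) + int 4" by linarith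
  qed
  from card_int_box_le[OF this] show "finite (touching_cubes k (ball x (1 / 2^k)))" "card (touching_cubes k (ball x (1 / 2^k))) \<le> 4 ^ CARD('n)"
    by auto
qed

lemma covering_number_attained:
  fixes K :: "'a::metric_space set"
  assumes "compact K" "\<epsilon> > 0"
  obtains S where "finite S" "card S = covering_number \<epsilon> K" "K \<subseteq> (\<Union>x\<in>S. ball x \<epsilon>)"
proof -
  obtain S0 where "finite S0" "K \<subseteq> (\<Union>x\<in>S0. ball x \<epsilon>)"
    using compactE_image[OF assms(1), of K "\<lambda>x. ball x \<epsilon>"] assms(2) by (metis UN_I centre_in_ball open_ball subsetI)
  then have "\<exists>S. finite S \<and> card S = card S0 \<and> K \<subseteq> (\<Union>x\<in>S. ball x \<epsilon>)" by blast
  then have "\<exists>S. finite S \<and> card S = covering_number \<epsilon> K \<and> K \<subseteq> (\<Union>x\<in>S. ball x \<epsilon>)"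
    unfolding covering_number_def by (rule LeastI)
  then show ?thesis using that by blast
qed

lemma touching_cubes_covering_number:
  fixes K :: "(real^'n) set"
  assumes "compact K"
  shows "finite (touching_cubes k K)" and "card (touching_cubes k K) \<le> 4 ^ CARD('n) * covering_number (1 / 2^k) K"
proof -
  obtain S where S: "finite S" "card S = covering_number (1 / 2^k) K" "K \<subseteq> (\<Union>x\<in>S. ball x (1 / 2^k))"
    using covering_number_attained[OF assms, of "1 / 2^k"] by auto
  have sub: "touching_cubes k K \<subseteq> (\<Union>x\<in>S. touching_cubes k (ball x (1 / 2^k)))"
    using S(3) unfolding touching_cubes_def by blast
  have fin: "finite (\<Union>x\<in>S. touching_cubes k (ball x (1 / 2^k)))" using S(1) touching_cubes_ball(1) by blast
  then show "finite (touching_cubes k K)" using sub finite_subset by blast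
  have "card (touching_cubes k K) \<le> card (\<Union>x\<in>S. touching_cubes k (ball x (1 / 2^k)))" by (rule card_mono[OF fin sub])
  also have "\<dots> \<le> (\<Sum>x\<in>S. card (touching_cubes k (ball x (1 / 2^k))))" by (rule card_UN_le[OF S(1)])
  also have "\<dots> \<le> (\<Sum>x\<in>S. 4 ^ CARD('n))" by (rule sum_mono) (rule touching_cubes_ball(2))
  finally show "card (touching_cubes k K) \<le> 4 ^ CARD('n) * covering_number (1 / 2^k) K"
    using S(2) by (simp add: mult.commute)
qed

text \<open>A limes superior below \<open>d\<close> bounds the covering numbers at all small scales;
  the finitely many coarse scales are absorbed into \<open>C\<close> by adding up their
  quotients.\<close>

lemma box_dim_touching_cubes:
  fixes K :: "(real^'n) set"
  assumes K: "compact K" and d: "box_dim K < ereal d"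
  shows "\<exists>C\<ge>0. \<forall>k. real (card (touching_cubes k K)) \<le> C * 2 powr (real k * d)"
proof -
  have "eventually (\<lambda>\<epsilon>. ereal (ln (real (covering_number \<epsilon> K)) / ln (1 / \<epsilon>)) < ereal d) (at_right 0)"
    by (rule Limsup_lessD) (use d in \<open>simp add: box_dim_def\<close>)
  then obtain b where b: "b > 0" "\<And>\<epsilon>. 0 < \<epsilon> \<Longrightarrow> \<epsilon> < b \<Longrightarrow> ln (real (covering_number \<epsilon> K)) / ln (1 / \<epsilon>) < d"
    unfolding eventually_at_right_field by auto
  obtain k0 where k0: "\<And>k. k \<ge> k0 \<Longrightarrow> 1 / 2^k < min b 1" using small_mesh[of "min b 1" 1] b(1) by auto
  let ?t = "\<lambda>k. real (card (touching_cubes k K))"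
  define C where "C = 4 ^ CARD('n) + (\<Sum>k<k0. ?t k / 2 powr (real k * d))"
  have S0: "0 \<le> (\<Sum>k<k0. ?t k / 2 powr (real k * d))" by (intro sum_nonneg) auto
  have "?t k \<le> C * 2 powr (real k * d)" for k
  proof (cases "k < k0")
    case True
    have "?t k / 2 powr (real k * d) \<le> (\<Sum>k<k0. ?t k / 2 powr (real k * d))"
      using True by (intro member_le_sum) auto
    then have "?t k / 2 powr (real k * d) \<le> C" unfolding C_def by (rule add_increasing[rotated]) simp
    then show ?thesis by (simp add: pos_divide_le_eq)
  next
    case False
    then have e: "0 < 1 / (2::real)^k" "1 / (2::real)^k < b" "1 / (2::real)^k < 1" using k0[of k] by auto
    let ?N = "real (covering_number (1 / 2^k) K)"
    have "?N \<le> 2 powr (real k * d)"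
    \<comment> \<open>For covering number 0 the value \<open>ln 0 = 0\<close> carries no
      information, but the bound is trivial.\<close>
    proof (cases "?N = 0")
      case False
      then have N: "?N > 0" by simp
      have "ln (1 / (1 / (2::real)^k)) = real k * ln 2" by (simp add: ln_realpow)
      moreover have "k > 0" using e(3) by (cases k) auto
      ultimately have "ln ?N < d * (real k * ln 2)" using b(2)[OF e(1,2)] by (simp add: pos_divide_less_eq)
      then have "?N < exp (d * (real k * ln 2))" using N by (metis exp_less_cancel_iff exp_ln)
      then show ?thesis by (simp add: powr_def mult_ac)
    qed simp
    moreover have "?t k \<le> 4 ^ CARD('n) * ?N"
      using of_nat_mono[OF touching_cubes_covering_number(2)[OF K, of k], where 'a=real] by simp
    moreover have "4 ^ CARD('n) * ?N \<le> 4 ^ CARD('n) * 2 powr (real k * d)"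
      by (rule mult_left_mono[OF calculation(1)]) simp
    ultimately have "?t k \<le> 4 ^ CARD('n) * 2 powr (real k * d)" by linarith
    also have "\<dots> \<le> C * 2 powr (real k * d)" using S0 by (intro mult_right_mono) (auto simp: C_def)
    finally show ?thesis .
  qed
  moreover have "C \<ge> 0" using S0 by (simp add: C_def)
  ultimately show ?thesis by blast
qed

text \<open>About \<open>2 powr (k * d)\<close> balls of radius proportional to
  \<open>2 powr (- k * \<alpha>)\<close> cover the image. Their total volume is of order
  \<open>2 powr (k * (d - \<alpha> * n))\<close> and tends to 0.\<close>

lemma null_sets_holder_image:
  fixes v :: "real^'n \<Rightarrow> real^'n"
  assumes K: "compact K" and d: "box_dim K < ereal d" "d < \<alpha> * real CARD('n)" and \<alpha>: "\<alpha> > 0" and M: "M > 0"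
    and cv: "continuous_on K v" and hv: "\<And>x y. x \<in> K \<Longrightarrow> y \<in> K \<Longrightarrow> dist (v x) (v y) \<le> M * dist x y powr \<alpha>"
  shows "v ` K \<in> null_sets lborel"
proof -
  let ?n = "CARD('n)"
  obtain C where C: "C \<ge> 0" "\<And>k. real (card (touching_cubes k K)) \<le> C * 2 powr (real k * d)"
    using box_dim_touching_cubes[OF K d(1)] by blast
  have vK: "v ` K \<in> sets borel" using compact_continuous_image[OF cv K] by (simp add: borel_compact)
  define D where "D = C * unit_ball_vol ?n * (M * real ?n powr \<alpha>) ^ ?n"
  define q where "q = 2 powr (d - \<alpha> * real ?n)"
  have q: "0 < q" "q < 1" using d(2) powr_less_mono[of "d - \<alpha> * real ?n" 0 2] by (auto simp: q_def)
  have "emeasure lborel (v ` K) \<le> ennreal (D * q ^ k)" for k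
  proof -
    let ?T = "touching_cubes k K"
    define r where "r = M * (real ?n / 2^k) powr \<alpha>"
    have r: "r > 0" using M by (simp add: r_def)
    have "\<exists>c. v ` (K \<inter> dcube k z) \<subseteq> cball c r" if z: "z \<in> ?T" for z
    proof -
      obtain p where p: "p \<in> K" "p \<in> dcube k z" using z by (auto simp: touching_cubes_def)
      have "v x \<in> cball (v p) r" if x: "x \<in> K" "x \<in> dcube k z" for x
      proof -
        have "dist (v p) (v x) \<le> M * dist p x powr \<alpha>" using hv p x by blast
        also have "\<dots> \<le> r"
          unfolding r_def using M \<alpha> dist_dcube[OF p(2) x(2)] by (intro mult_left_mono powr_mono2) auto
        finally show ?thesis by simp
      qed
      then show ?thesis by blast
    qed
    then obtain c where c: "\<And>z. z \<in> ?T \<Longrightarrow> v ` (K \<inter> dcube k z) \<subseteq> cball (c z) r" by metis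
    have fin: "finite ?T" by (rule touching_cubes_covering_number(1)[OF K])
    have "v ` K \<subseteq> (\<Union>z\<in>?T. cball (c z) r)"
    proof
      fix y assume "y \<in> v ` K"
      then obtain x where x: "x \<in> K" "y = v x" by blast
      let ?z = "floor_vec ((2^k) *\<^sub>R x)"
      have "x \<in> dcube k ?z" by (rule floor_vec_in_dcube)
      moreover from this have "?z \<in> ?T" using x by (auto simp: touching_cubes_def)
      ultimately show "y \<in> (\<Union>z\<in>?T. cball (c z) r)" using c x by blast
    qed
    then have "emeasure lborel (v ` K) \<le> emeasure lborel (\<Union>z\<in>?T. cball (c z) r)"
      using fin by (intro emeasure_mono) auto
    also have "\<dots> \<le> (\<Sum>z\<in>?T. emeasure lborel (cball (c z) r))"
      using fin by (intro emeasure_subadditive_finite) auto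
    also have "\<dots> = ennreal (real (card ?T) * (unit_ball_vol ?n * r ^ ?n))"
      using r by (simp add: emeasure_cball ennreal_mult ennreal_of_nat_eq_real_of_nat)
    also have "\<dots> \<le> ennreal (D * q ^ k)"
    proof (rule ennreal_leI)
      have "real (card ?T) * (unit_ball_vol ?n * r ^ ?n) \<le> C * 2 powr (real k * d) * (unit_ball_vol ?n * r ^ ?n)"
        using C(2) r by (intro mult_right_mono) auto
      also have "\<dots> = D * q ^ k"
      proof -
        have "r = M * real ?n powr \<alpha> * 2 powr (- (real k * \<alpha>))"
        proof -
          have "(2 ^ k :: real) powr \<alpha> = 2 powr (real k * \<alpha>)" by (simp add: powr_realpow[symmetric] powr_powr)
          then show ?thesis unfolding r_def powr_divide powr_minus by (simp add: divide_inverse)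
        qed
        then have "r ^ ?n = (M * real ?n powr \<alpha>) ^ ?n * 2 powr (- (real k * \<alpha>) * real ?n)"
          by (simp add: power_mult_distrib powr_power mult.commute)
        moreover have "q ^ k = 2 powr (real k * d) * 2 powr (- (real k * \<alpha>) * real ?n)"
          unfolding powr_add[symmetric] using q by (simp add: q_def powr_realpow[symmetric] powr_powr algebra_simps)
        ultimately show ?thesis by (simp add: D_def mult_ac)
      qed
      finally show "real (card ?T) * (unit_ball_vol ?n * r ^ ?n) \<le> D * q ^ k" .
    qed
    finally show ?thesis .
  qed
  moreover have "(\<lambda>k. ennreal (D * q ^ k)) \<longlonglongrightarrow> ennreal (D * 0)"
    using q by (intro tendsto_ennrealI tendsto_mult tendsto_const LIMSEQ_realpow_zero) auto
  ultimately have "emeasure lborel (v ` K) \<le> ennreal (D * 0)"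
    by (intro LIMSEQ_le_const) auto
  then show ?thesis using vK by (simp add: null_sets_def)
qed

section \<open>Extension of Hoelder maps to the closure\<close>

lemma holder_space_norm_le:
  assumes "v \<in> holder_space \<alpha> \<Omega>" "x \<in> \<Omega>" "y \<in> \<Omega>"
  shows "dist (v x) (v y) \<le> enn2real (holder_seminorm \<alpha> \<Omega> v) * dist x y powr \<alpha>"
proof (cases "x = y")
  case False
  have "ennreal (norm (v x - v y) / norm (x - y) powr \<alpha>) \<le> holder_seminorm \<alpha> \<Omega> v"
    unfolding holder_seminorm_def using assms False by (intro SUP_upper2[of "(x, y)"]) auto
  moreover have "holder_seminorm \<alpha> \<Omega> v < \<infinity>" using assms(1) by (simp add: holder_space_def)
  ultimately have "enn2real (ennreal (norm (v x - v y) / norm (x - y) powr \<alpha>)) \<le> enn2real (holder_seminorm \<alpha> \<Omega> v)"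
    by (intro enn2real_mono) simp_all
  then have "norm (v x - v y) / norm (x - y) powr \<alpha> \<le> enn2real (holder_seminorm \<alpha> \<Omega> v)"
    by (subst (asm) enn2real_ennreal) auto
  then show ?thesis using False by (simp add: dist_norm pos_divide_le_eq)
qed simp

lemma closure_extension_holder:
  fixes v :: "'a::euclidean_space \<Rightarrow> 'b::euclidean_space"
  assumes op: "open \<Omega>" and \<alpha>: "\<alpha> > 0" and M: "M \<ge> 0"
    and hv: "\<And>x y. x \<in> \<Omega> \<Longrightarrow> y \<in> \<Omega> \<Longrightarrow> dist (v x) (v y) \<le> M * dist x y powr \<alpha>"
  shows "continuous_on (closure \<Omega>) (closure_extension \<Omega> v)"
    and "\<And>x y. x \<in> closure \<Omega> \<Longrightarrow> y \<in> closure \<Omega> \<Longrightarrow>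
      dist (closure_extension \<Omega> v x) (closure_extension \<Omega> v y) \<le> M * dist x y powr \<alpha>"
proof -
  let ?g = "closure_extension \<Omega> v"
  have "uniformly_continuous_on \<Omega> v"
    unfolding uniformly_continuous_on_def
  proof (intro allI impI)
    fix e :: real assume e: "e > 0"
    define d where "d = (e / (M + 1)) powr (1 / \<alpha>)"
    have "dist (v x') (v x) < e" if "x \<in> \<Omega>" "x' \<in> \<Omega>" "dist x' x < d" for x x'
    proof -
      have "dist x' x powr \<alpha> < d powr \<alpha>" using that \<alpha> by (intro powr_less_mono2) auto
      also have "\<dots> = e / (M + 1)" using \<alpha> e M by (simp add: d_def powr_powr)
      finally have "(M + 1) * dist x' x powr \<alpha> < e" using M by (simp add: field_simps)
      moreover have "M * dist x' x powr \<alpha> \<le> (M + 1) * dist x' x powr \<alpha>" by (intro mult_right_mono) auto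
      ultimately show ?thesis using hv[OF that(2,1)] by linarith
    qed
    moreover have "d > 0" using e M by (simp add: d_def)
    ultimately show "\<exists>d>0. \<forall>x\<in>\<Omega>. \<forall>x'\<in>\<Omega>. dist x' x < d \<longrightarrow> dist (v x') (v x) < e" by blast
  qed
  then obtain g where g: "uniformly_continuous_on (closure \<Omega>) g" "\<And>x. x \<in> \<Omega> \<Longrightarrow> v x = g x"
    using uniformly_continuous_on_extension_on_closure by metis
  have cg: "continuous_on (closure \<Omega>) g" using g(1) by (rule uniformly_continuous_imp_continuous)
  have ge: "?g x = g x" if x: "x \<in> closure \<Omega>" for x
  proof -
    have "(g \<longlongrightarrow> g x) (at x within \<Omega>)"
      using cg x tendsto_within_subset[OF _ closure_subset] unfolding continuous_on_def by blast
    then have "(v \<longlongrightarrow> g x) (at x within \<Omega>)"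
      by (rule Lim_transform_eventually) (auto simp: eventually_at_filter g(2))
    \<comment> \<open>Points of the closure of an open set are limit points of it, so the filter
      \<open>at x within \<Omega>\<close> is nontrivial and \<open>Lim\<close> returns the
      limit.\<close>
    moreover have "x islimpt \<Omega>"
      using x op by (metis Un_iff closure_def interior_limit_point interior_open mem_Collect_eq)
    ultimately show ?thesis unfolding closure_extension_def
      by (intro tendsto_Lim) (auto simp: trivial_limit_within)
  qed
  show "continuous_on (closure \<Omega>) ?g" using cg ge by (simp cong: continuous_on_cong)
  fix x y assume xy: "x \<in> closure \<Omega>" "y \<in> closure \<Omega>"
  obtain X Y where X: "\<And>n. X n \<in> \<Omega>" "X \<longlonglongrightarrow> x" and Y: "\<And>n. Y n \<in> \<Omega>" "Y \<longlonglongrightarrow> y"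
    using xy unfolding closure_sequential by blast
  have "(\<lambda>n. g (X n)) \<longlonglongrightarrow> g x" "(\<lambda>n. g (Y n)) \<longlonglongrightarrow> g y"
    using continuous_on_tendsto_compose[OF cg X(2) xy(1)] continuous_on_tendsto_compose[OF cg Y(2) xy(2)] X(1) Y(1) closure_subset
    by (auto intro!: always_eventually)
  then have "(\<lambda>n. dist (g (X n)) (g (Y n))) \<longlonglongrightarrow> dist (g x) (g y)" by (rule tendsto_dist)
  moreover have "(\<lambda>n. M * dist (X n) (Y n) powr \<alpha>) \<longlonglongrightarrow> M * dist x y powr \<alpha>"
    using X(2) Y(2) \<alpha> by (intro tendsto_mult tendsto_const tendsto_powr' tendsto_dist) auto
  moreover have "dist (g (X n)) (g (Y n)) \<le> M * dist (X n) (Y n) powr \<alpha>" for n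
    using hv[OF X(1) Y(1)] g(2)[OF X(1)] g(2)[OF Y(1)] by simp
  ultimately have "dist (g x) (g y) \<le> M * dist x y powr \<alpha>" by (intro LIMSEQ_le) auto
  then show "dist (?g x) (?g y) \<le> M * dist x y powr \<alpha>" using ge xy by simp
qed

section \<open>Sums of convex indicators\<close>

text \<open>By convexity of \<open>t \<mapsto> t powr p\<close>, the energy of such a sum is controlled by \<open>b\<close> alone, whatever
  the number of terms.\<close>

definition convex_budget :: "real \<Rightarrow> ('a::euclidean_space \<Rightarrow> real) \<Rightarrow> real \<Rightarrow> bool" where
  "convex_budget \<gamma> f b \<longleftrightarrow> (\<exists>xs :: (real \<times> 'a set \<times> 'a \<times> real) list.
     (\<forall>(a, S, c, r)\<in>set xs. \<bar>a\<bar> \<le> 1 \<and> convex S \<and> compact S \<and> S \<subseteq> cball c r \<and> r > 0) \<and>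
     (AE x in lborel. f x = (\<Sum>(a, S, c, r)\<leftarrow>xs. a * indicator S x)) \<and>
     (\<Sum>(a, S, c, r)\<leftarrow>xs. r powr \<gamma>) \<le> b)"

lemma convex_budget_AE_eq:
  assumes "convex_budget \<gamma> f b" "AE x in lborel. g x = f x" shows "convex_budget \<gamma> g b"
proof -
  obtain xs :: "(real \<times> 'a set \<times> 'a \<times> real) list" where
    xs: "\<forall>(a, S, c, r)\<in>set xs. \<bar>a\<bar> \<le> 1 \<and> convex S \<and> compact S \<and> S \<subseteq> cball c r \<and> r > 0"
    "AE x in lborel. f x = (\<Sum>(a, S, c, r)\<leftarrow>xs. a * indicator S x)" "(\<Sum>(a, S, c, r)\<leftarrow>xs. r powr \<gamma>) \<le> b"
    using assms(1) unfolding convex_budget_def by blast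
  have "AE x in lborel. g x = (\<Sum>(a, S, c, r)\<leftarrow>xs. a * indicator S x)"
    using assms(2) xs(2) by eventually_elim simp
  then show ?thesis unfolding convex_budget_def using xs by blast
qed

lemma convex_budget_mono: "convex_budget \<gamma> f b \<Longrightarrow> b \<le> b' \<Longrightarrow> convex_budget \<gamma> f b'"
  unfolding convex_budget_def by (meson order_trans)

lemma convex_budget_zero: "convex_budget \<gamma> (\<lambda>_. 0) 0"
  unfolding convex_budget_def by (intro exI[of _ "[]"]) auto

lemma convex_budget_add:
  assumes "convex_budget \<gamma> f b" "convex_budget \<gamma> f' b'"
  shows "convex_budget \<gamma> (\<lambda>x. f x + f' x) (b + b')"
proof -
  obtain xs :: "(real \<times> 'a set \<times> 'a \<times> real) list" where
    xs: "\<forall>(a, S, c, r)\<in>set xs. \<bar>a\<bar> \<le> 1 \<and> convex S \<and> compact S \<and> S \<subseteq> cball c r \<and> r > 0"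
    "AE x in lborel. f x = (\<Sum>(a, S, c, r)\<leftarrow>xs. a * indicator S x)" "(\<Sum>(a, S, c, r)\<leftarrow>xs. r powr \<gamma>) \<le> b"
    using assms(1) unfolding convex_budget_def by blast
  obtain ys :: "(real \<times> 'a set \<times> 'a \<times> real) list" where
    ys: "\<forall>(a, S, c, r)\<in>set ys. \<bar>a\<bar> \<le> 1 \<and> convex S \<and> compact S \<and> S \<subseteq> cball c r \<and> r > 0"
    "AE x in lborel. f' x = (\<Sum>(a, S, c, r)\<leftarrow>ys. a * indicator S x)" "(\<Sum>(a, S, c, r)\<leftarrow>ys. r powr \<gamma>) \<le> b'"
    using assms(2) unfolding convex_budget_def by blast
  have "AE x in lborel. f x + f' x = (\<Sum>(a, S, c, r)\<leftarrow>xs @ ys. a * indicator S x)"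
    using xs(2) ys(2) by eventually_elim simp
  moreover have "\<forall>(a, S, c, r)\<in>set (xs @ ys). \<bar>a\<bar> \<le> 1 \<and> convex S \<and> compact S \<and> S \<subseteq> cball c r \<and> r > 0"
    using xs(1) ys(1) by auto
  moreover have "(\<Sum>(a, S, c, r)\<leftarrow>xs @ ys. r powr \<gamma>) \<le> b + b'" using xs(3) ys(3) by simp
  ultimately show ?thesis unfolding convex_budget_def by blast
qed

lemma convex_budget_sum:
  assumes "finite I" "\<And>i. i \<in> I \<Longrightarrow> convex_budget \<gamma> (f i) (b i)"
  shows "convex_budget \<gamma> (\<lambda>x. \<Sum>i\<in>I. f i x) (\<Sum>i\<in>I. b i)"
  using assms
proof (induction I)
  case empty
  then show ?case by (simp add: convex_budget_zero)
next
  case (insert i I)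
  then have "convex_budget \<gamma> (\<lambda>x. f i x + (\<Sum>i\<in>I. f i x)) (b i + (\<Sum>i\<in>I. b i))"
    by (intro convex_budget_add) auto
  then show ?case using insert by simp
qed

lemma convex_budget_chi:
  fixes ps :: "(real^'n) list"
  assumes "set ps \<subseteq> cball c r" "r > 0" "\<bar>e\<bar> \<le> 1"
  shows "convex_budget \<gamma> (\<lambda>y. e * chi y ps) (r powr \<gamma>)"
proof -
  let ?xs = "[(e * sgn (vol ps), convex hull (set ps), c, r)]"
  have "\<bar>e * sgn (vol ps)\<bar> \<le> 1" using assms(3) by (simp add: abs_mult sgn_if)
  moreover have "convex hull (set ps) \<subseteq> cball c r" by (rule convex_hull_subset_cball[OF assms(1)])
  moreover have "compact (convex hull (set ps))" by (simp add: finite_imp_compact compact_convex_hull)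
  ultimately show ?thesis
    unfolding convex_budget_def using assms(2)
    by (intro exI[of _ ?xs]) (auto simp: chi_def indicator_def)
qed

lemma abs_orient_wsign_le: "\<bar>orient TYPE('n::finite) * wsign w\<bar> \<le> 1" "\<bar>- (orient TYPE('n::finite) * wsign w)\<bar> \<le> 1"
  by (simp_all add: orient_def abs_mult wsign_nonzero del: wsign.simps)

lemma convex_budget_cube_degree:
  fixes a :: "int^'n \<Rightarrow> real^'n"
  assumes "a ` range (corner z) \<subseteq> cball c r" "r > 0"
  shows "convex_budget \<gamma> (cube_degree a z) (fact CARD('n) * r powr \<gamma>)"
proof -
  let ?P = "permutations_of_set (UNIV - {None :: 'n option})"
  have "card (UNIV - {None :: 'n option}) = CARD('n)" by simp
  then have card: "card ?P = fact CARD('n)" by (subst card_permutations_of_set) auto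
  have "convex_budget \<gamma> (\<lambda>y. \<Sum>w\<in>?P. orient TYPE('n) * wsign (None # w) *
      chi y (vertex_path (\<lambda>S. a (corner z (Some -` S))) {} w)) (\<Sum>w\<in>?P. r powr \<gamma>)"
  proof (intro convex_budget_sum convex_budget_chi abs_orient_wsign_le)
    fix w
    show "set (vertex_path (\<lambda>S. a (corner z (Some -` S))) {} w) \<subseteq> cball c r"
      by (rule set_vertex_path_subset) (use assms(1) in blast)
  qed (use assms in auto)
  then show ?thesis unfolding cube_degree_def[abs_def] using card by simp
qed

lemma convex_budget_face_flux:
  fixes a b :: "int^'n \<Rightarrow> real^'n"
  assumes "a ` face_corners j z \<union> b ` face_corners j z \<subseteq> cball c r" "r > 0" "\<bar>e\<bar> \<le> 1"
  shows "convex_budget \<gamma> (\<lambda>y. e * face_flux j a b z y) (fact CARD('n) * r powr \<gamma>)"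
proof -
  let ?P = "permutations_of_set (UNIV - {Some j :: 'n option})"
  have "card (UNIV - {Some j :: 'n option}) = CARD('n)" by simp
  then have card: "card ?P = fact CARD('n)" by (subst card_permutations_of_set) auto
  have "convex_budget \<gamma> (\<lambda>y. \<Sum>w\<in>?P. (e * - (orient TYPE('n) * wsign (Some j # w))) *
      chi y (vertex_path (prism_vertex a b z) {} w)) (\<Sum>w\<in>?P. r powr \<gamma>)"
  proof (intro convex_budget_sum convex_budget_chi)
    fix w assume "w \<in> ?P"
    then show "set (vertex_path (prism_vertex a b z) {} w) \<subseteq> cball c r"
      by (rule order_trans[OF set_prism_path_subset assms(1)])
    have "\<bar>e\<bar> * \<bar>orient TYPE('n) * wsign (Some j # w)\<bar> \<le> 1 * 1"
      using assms(3) abs_orient_wsign_le(1)[where 'n='n] by (intro mult_mono) (auto simp del: wsign.simps)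
    then show "\<bar>e * - (orient TYPE('n) * wsign (Some j # w))\<bar> \<le> 1" by (simp add: abs_mult del: wsign.simps)
  qed (use assms in auto)
  moreover have "(\<lambda>y. e * face_flux j a b z y) = (\<lambda>y. \<Sum>w\<in>?P. (e * - (orient TYPE('n) * wsign (Some j # w))) *
      chi y (vertex_path (prism_vertex a b z) {} w))"
    unfolding face_flux_def sum_distrib_left by (simp only: mult.assoc)
  ultimately show ?thesis using card by simp
qed

text \<open>Each \<open>f k\<close> agrees almost everywhere with a measurable sum of indicators
  whose energy is bounded through \<open>b\<close>, uniformly in \<open>k\<close>; Fatou's lemma
  hands the bound to the limit.\<close>

lemma convex_budget_energy:
  assumes p: "1 \<le> p" and \<beta>: "0 \<le> \<beta>" "\<beta> * p < 1"
  shows "\<exists>C\<ge>0. \<forall>(f :: nat \<Rightarrow> 'a::euclidean_space \<Rightarrow> real) g b.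
     (\<forall>k. convex_budget (real DIM('a) / p - \<beta>) (f k) b) \<longrightarrow> (AE x in lborel. (\<lambda>k. f k x) \<longlonglongrightarrow> g x) \<longrightarrow>
     sobolev_energy \<beta> p g \<le> ennreal (C * b powr p)"
proof -
  let ?\<gamma> = "real DIM('a) / p - \<beta>"
  obtain C where C: "C \<ge> 0" and main: "\<And>J (S :: nat \<Rightarrow> 'a set) c r a. finite J \<Longrightarrow>
     (\<forall>j\<in>J. convex (S j) \<and> compact (S j) \<and> S j \<subseteq> cball (c j) (r j) \<and> r j > 0 \<and> \<bar>a j\<bar> \<le> 1) \<Longrightarrow>
     sobolev_energy \<beta> p (\<lambda>x. \<Sum>j\<in>J. a j * indicator (S j) x) \<le> ennreal (C * (\<Sum>j\<in>J. r j powr ?\<gamma>) powr p)"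
    using sobolev_energy_sum_convex_indicators[OF assms, where 'a='a and 'i=nat] by blast
  have "sobolev_energy \<beta> p g \<le> ennreal (C * b powr p)"
    if bud: "\<And>k. convex_budget ?\<gamma> (f k) b" and lim: "AE x in lborel. (\<lambda>k. f k x) \<longlonglongrightarrow> g x"
    for f :: "nat \<Rightarrow> 'a \<Rightarrow> real" and g b
  proof -
    have "\<exists>h. h \<in> borel_measurable borel \<and> (AE x in lborel. f k x = h x) \<and> sobolev_energy \<beta> p h \<le> ennreal (C * b powr p)" for k
    proof -
      obtain xs :: "(real \<times> 'a set \<times> 'a \<times> real) list" where
        xs: "\<forall>(a, S, c, r)\<in>set xs. \<bar>a\<bar> \<le> 1 \<and> convex S \<and> compact S \<and> S \<subseteq> cball c r \<and> r > 0"
        "AE x in lborel. f k x = (\<Sum>(a, S, c, r)\<leftarrow>xs. a * indicator S x)" "(\<Sum>(a, S, c, r)\<leftarrow>xs. r powr ?\<gamma>) \<le> b"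
        using bud[of k] unfolding convex_budget_def by blast
      define a where "a j = fst (xs ! j)" for j
      define S where "S j = fst (snd (xs ! j))" for j
      define c where "c j = fst (snd (snd (xs ! j)))" for j
      define r where "r j = snd (snd (snd (xs ! j)))" for j
      have nth: "xs ! j = (a j, S j, c j, r j)" for j by (simp add: a_def S_def c_def r_def)
      let ?J = "{..<length xs}"
      have J: "\<forall>j\<in>?J. convex (S j) \<and> compact (S j) \<and> S j \<subseteq> cball (c j) (r j) \<and> r j > 0 \<and> \<bar>a j\<bar> \<le> 1"
        using xs(1) nth by (metis (no_types, lifting) case_prodD lessThan_iff nth_mem)
      have sum: "(\<Sum>(a, S, c, r)\<leftarrow>xs. F a S c r) = (\<Sum>j\<in>?J. F (a j) (S j) (c j) (r j))" for F :: "real \<Rightarrow> 'a set \<Rightarrow> 'a \<Rightarrow> real \<Rightarrow> real"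
        by (simp add: sum_list_sum_nth nth atLeast0LessThan)
      let ?h = "\<lambda>x. \<Sum>j\<in>?J. a j * indicator (S j) x"
      have "?h \<in> borel_measurable borel"
        using J by (intro borel_measurable_sum borel_measurable_times borel_measurable_const borel_measurable_indicator) (auto simp: borel_compact)
      moreover have "AE x in lborel. f k x = ?h x" using xs(2) by (simp add: sum)
      moreover have "sobolev_energy \<beta> p ?h \<le> ennreal (C * (\<Sum>j\<in>?J. r j powr ?\<gamma>) powr p)" by (rule main[OF _ J]) simp
      moreover have "C * (\<Sum>j\<in>?J. r j powr ?\<gamma>) powr p \<le> C * b powr p"
        using xs(3) p C by (intro mult_left_mono powr_mono2 sum_nonneg) (auto simp: sum)
      ultimately show ?thesis by (meson ennreal_leI order_trans)
    qed
    then obtain h where h: "\<And>k. h k \<in> borel_measurable borel" "\<And>k. AE x in lborel. f k x = h k x"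
      "\<And>k. sobolev_energy \<beta> p (h k) \<le> ennreal (C * b powr p)" by metis
    have "AE x in lborel. \<forall>k. f k x = h k x" using h(2) by (simp add: AE_all_countable)
    then have "AE x in lborel. (\<lambda>k. h k x) \<longlonglongrightarrow> g x" using lim by eventually_elim simp
    then show ?thesis using sobolev_energy_liminf[OF h(1) _ _ h(3)] p by simp
  qed
  note main2 = this
  show ?thesis
  proof (intro exI[of _ C] conjI allI impI)
    fix f :: "nat \<Rightarrow> 'a \<Rightarrow> real" and g b
    assume "\<forall>k. convex_budget ?\<gamma> (f k) b" "AE x in lborel. (\<lambda>k. f k x) \<longlonglongrightarrow> g x"
    then show "sobolev_energy \<beta> p g \<le> ennreal (C * b powr p)" by (intro main2) auto
  qed (rule C)
qed

section \<open>Refinement of the grid\<close>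

text \<open>One map with two roles: it sends a fine cube to the coarse cube that contains it, and a
  fine vertex to the coarse vertex it is rounded to.\<close>

definition parent :: "int^'n \<Rightarrow> int^'n" where
  "parent z = (\<chi> i. z $ i div 2)"

lemma card_parent_vimage:
  fixes A :: "(int^'n) set"
  assumes "finite A"
  shows "finite {z. parent z \<in> A}" and "card {z. parent z \<in> A} \<le> 2 ^ CARD('n) * card A"
proof -
  have "\<forall>i. 2 * m $ i \<le> z $ i \<and> z $ i < 2 * m $ i + int 2" if "z \<in> {z. parent z = m}" for m z :: "int^'n"
  proof
    fix i
    have "m $ i = z $ i div 2" using that by (auto simp: parent_def)
    then show "2 * m $ i \<le> z $ i \<and> z $ i < 2 * m $ i + int 2" by presburger
  qed
  note one = card_int_box_le[OF this]
  have eq: "{z. parent z \<in> A} = (\<Union>m\<in>A. {z. parent z = m})" by auto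
  show "finite {z. parent z \<in> A}" unfolding eq using assms one(1) by blast
  have "card {z. parent z \<in> A} \<le> (\<Sum>m\<in>A. card {z. parent z = m})" unfolding eq by (rule card_UN_le[OF assms])
  also have "\<dots> \<le> (\<Sum>m\<in>A. 2 ^ CARD('n))" by (rule sum_mono) (rule one(2))
  finally show "card {z. parent z \<in> A} \<le> 2 ^ CARD('n) * card A" by (simp add: mult.commute)
qed

lemma dcube_subset_parent: "dcube (Suc k) z \<subseteq> dcube k (parent z)"
proof
  fix x :: "real^'a" assume x: "x \<in> dcube (Suc k) z"
  have "of_int (z $ i div 2) \<le> 2^k * x $ i \<and> 2^k * x $ i \<le> of_int (z $ i div 2) + 1" for i
  proof -
    have "of_int (z $ i) \<le> 2 * (2^k * x $ i)" "2 * (2^k * x $ i) \<le> of_int (z $ i) + 1"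
      using x by (auto simp: dcube_def mult.assoc)
    moreover have "2 * (z $ i div 2) \<le> z $ i" "z $ i \<le> 2 * (z $ i div 2) + 1" by auto
    then have "2 * real_of_int (z $ i div 2) \<le> real_of_int (z $ i)" "real_of_int (z $ i) \<le> 2 * real_of_int (z $ i div 2) + 1"
      by linarith+
    ultimately show ?thesis by linarith
  qed
  then show "x \<in> dcube k (parent z)" by (simp add: dcube_def parent_def)
qed

lemma vert_parent_corner_in_dcube: "vert k (parent (corner z S)) \<in> dcube k (parent z)"
proof -
  have "z $ i div 2 \<le> (z $ i + (if i \<in> S then 1 else 0)) div 2 \<and> (z $ i + (if i \<in> S then 1 else 0)) div 2 \<le> z $ i div 2 + 1" for i
    by (auto simp: zdiv_mono1)
  then have "real_of_int (z $ i div 2) \<le> of_int ((z $ i + (if i \<in> S then 1 else 0)) div 2)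
    \<and> real_of_int ((z $ i + (if i \<in> S then 1 else 0)) div 2) \<le> of_int (z $ i div 2) + 1" for i
    by (metis of_int_1 of_int_add of_int_le_iff)
  then show ?thesis by (simp add: vert_def dcube_def emb_def parent_def corner_def)
qed

lemma cube_degree_parent_odd:
  assumes "\<forall>i. odd (z $ i)"
  shows "cube_degree (\<lambda>z. a (parent z)) z y = cube_degree a (parent z) y"
proof -
  have "parent (corner z S) = corner (parent z) S" for S
  proof -
    have "(z $ i + 1) div 2 = z $ i div 2 + 1" for i using assms by (auto elim: oddE)
    then show ?thesis by (simp add: parent_def corner_def vec_eq_iff)
  qed
  then show ?thesis by (simp add: cube_degree_def)
qed

text \<open>If coordinate \<open>i\<close> is even, rounding ignores the step in direction
  \<open>i\<close>. Every path takes this step once, so two consecutive vertices coincide and the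
  simplex is degenerate.\<close>

lemma cube_degree_parent_even:
  fixes a :: "int^'n \<Rightarrow> real^'n"
  assumes "even (z $ i)"
  shows "cube_degree (\<lambda>z. a (parent z)) z y = 0"
  unfolding cube_degree_def
proof (rule sum.neutral, rule ballI)
  fix w assume w: "w \<in> permutations_of_set (UNIV - {None :: 'n option})"
  let ?V = "\<lambda>S. a (parent (corner z (Some -` S)))"
  have len: "length w = CARD('n)" using w by (auto simp: permutations_of_set_def distinct_card[symmetric])
  have "Some i \<in> set w" using w by (auto simp: permutations_of_set_def)
  then obtain t where t: "t < length w" "w ! t = Some i" by (auto simp: in_set_conv_nth)
  have "parent (corner z (insert i S)) = parent (corner z S)" for S
    using assms by (auto simp: parent_def corner_def vec_eq_iff elim!: evenE)
  moreover have "Some -` set (take (Suc t) w) = insert i (Some -` set (take t w))"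
    using t by (auto simp: take_Suc_conv_app_nth)
  ultimately have "vertex_path ?V {} w ! t = vertex_path ?V {} w ! Suc t"
    using t by (simp add: nth_vertex_path)
  then have "vol (vertex_path ?V {} w) = 0" by (intro vol_repeated[of t "Suc t"]) (use t len in auto)
  then show "orient TYPE('n) * wsign (None # w) * chi y (vertex_path ?V {} w) = 0" by (simp add: chi_def)
qed

text \<open>Rounding down to the coarse grid collapses all subcubes of a cube but the one at its top
  corner, which is blown up to the whole cube.\<close>

lemma sum_cube_degree_parent:
  fixes a :: "int^'n \<Rightarrow> real^'n"
  assumes "finite A"
  shows "(\<Sum>z | parent z \<in> A. cube_degree (\<lambda>z. a (parent z)) z y) = (\<Sum>m\<in>A. cube_degree a m y)"
proof -
  let ?F = "\<lambda>z. cube_degree (\<lambda>z. a (parent z)) z y"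
  have "(\<Sum>z | parent z \<in> A. ?F z) = (\<Sum>z | parent z \<in> A \<and> (\<forall>i. odd (z $ i)). ?F z)"
    using card_parent_vimage(1)[OF assms] cube_degree_parent_even by (intro sum.mono_neutral_right) auto
  also have "\<dots> = (\<Sum>m\<in>A. cube_degree a m y)"
  proof (rule sum.reindex_bij_witness[where i="\<lambda>m. (\<chi> i. 2 * m $ i + 1)" and j=parent])
    fix z :: "int^'n" assume z: "z \<in> {z. parent z \<in> A \<and> (\<forall>i. odd (z $ i))}"
    then show "(\<chi> i. 2 * parent z $ i + 1) = z" "parent z \<in> A" by (auto simp: parent_def vec_eq_iff)
    show "cube_degree a (parent z) y = ?F z" using z by (intro cube_degree_parent_odd[symmetric]) simp
  qed (auto simp: parent_def vec_eq_iff)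
  finally show ?thesis .
qed

section \<open>The cost of one refinement step\<close>

lemma corner_unit_step: "corner z {j} = z + unit_step j"
  using corner_insert[of j "{}" z] by (simp add: corner_empty)

lemma convex_budget_sum_le:
  assumes "finite I" "real (card I) \<le> N" "0 \<le> b" "\<And>i. i \<in> I \<Longrightarrow> convex_budget \<gamma> (f i) b"
  shows "convex_budget \<gamma> (\<lambda>x. \<Sum>i\<in>I. f i x) (N * b)"
  by (rule convex_budget_mono[OF convex_budget_sum[OF assms(1,4)]]) (use assms(2,3) in \<open>auto intro: mult_right_mono\<close>)

text \<open>On \<open>Z\<close>, the fine subcubes of coarse inner cubes, the coarse degree is that
  of the rounded samples \<open>a\<close>, and passing from \<open>a\<close> to the fine samples
  \<open>b\<close> costs prisms over the boundary of \<open>Z\<close>. The fine inner cubes outside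
  \<open>Z\<close> are new.\<close>

lemma grid_degree_refine_eq:
  fixes v :: "real^'n \<Rightarrow> real^'n"
  assumes bd: "bounded \<Omega>"
  defines "a \<equiv> \<lambda>k z. v (vert k (parent z))" and "b \<equiv> \<lambda>k z. v (vert (Suc k) z)" and "Z \<equiv> \<lambda>k. {z. parent z \<in> inner_cubes k \<Omega>}"
  assumes gen: "generic (range (a k) \<union> range (b k)) y"
  shows "grid_degree v \<Omega> (Suc k) y - grid_degree v \<Omega> k y =
    (\<Sum>z\<in>inner_cubes (Suc k) \<Omega> - Z k. cube_degree (b k) z y) +
    (\<Sum>j\<in>UNIV. (\<Sum>z\<in>(\<lambda>z. z + unit_step j) ` Z k - Z k. 1 * face_flux j (a k) (b k) z y)
      + (\<Sum>z\<in>Z k - (\<lambda>z. z + unit_step j) ` Z k. - 1 * face_flux j (a k) (b k) z y))"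
proof -
  have finI: "finite (inner_cubes k \<Omega>)" for k by (rule finite_inner_cubes[OF bd])
  have finZ: "finite (Z k)" unfolding Z_def by (rule card_parent_vimage(1)[OF finI])
  have sub: "Z k \<subseteq> inner_cubes (Suc k) \<Omega>"
    unfolding Z_def inner_cubes_def using dcube_subset_parent by fast
  have "grid_degree v \<Omega> (Suc k) y = (\<Sum>z\<in>inner_cubes (Suc k) \<Omega> - Z k. cube_degree (b k) z y) + (\<Sum>z\<in>Z k. cube_degree (b k) z y)"
    unfolding grid_degree_def b_def by (rule sum.subset_diff[OF sub finI])
  moreover have "grid_degree v \<Omega> k y = (\<Sum>z\<in>Z k. cube_degree (a k) z y)"
    unfolding grid_degree_def a_def Z_def by (rule sum_cube_degree_parent[OF finI, symmetric])
  moreover have "(\<Sum>z\<in>Z k. cube_degree (b k) z y) - (\<Sum>z\<in>Z k. cube_degree (a k) z y)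
    = (\<Sum>j\<in>UNIV. (\<Sum>z\<in>(\<lambda>z. z + unit_step j) ` Z k - Z k. face_flux j (a k) (b k) z y)
        - (\<Sum>z\<in>Z k - (\<lambda>z. z + unit_step j) ` Z k. face_flux j (a k) (b k) z y))"
  proof (rule sum_cube_degree_diff[OF finZ])
    fix z
    show "generic (a k ` range (corner z) \<union> b k ` range (corner z)) y"
      by (rule generic_mono[OF gen]) (intro Un_mono image_mono subset_UNIV)
  qed
  ultimately show ?thesis by (simp add: sum_negf)
qed

text \<open>Origin of the constant: one family of new cubes and, for each of n directions, two
  families of boundary faces; at most 2^n fine cubes per coarse cube that touches the frontier; n!
  simplices for each cube or prism.\<close>

proposition convex_budget_refine:
  fixes v :: "real^'n \<Rightarrow> real^'n"
  assumes bd: "bounded \<Omega>" and M: "M > 0" and \<alpha>: "\<alpha> > 0"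
    and hv: "\<And>x y. x \<in> \<Omega> \<Longrightarrow> y \<in> \<Omega> \<Longrightarrow> dist (v x) (v y) \<le> M * dist x y powr \<alpha>"
  shows "convex_budget \<gamma> (\<lambda>y. grid_degree v \<Omega> (Suc k) y - grid_degree v \<Omega> k y)
    (((1 + 2 * real CARD('n)) * (2 ^ CARD('n) * fact CARD('n))) * (real (card (touching_cubes k (frontier \<Omega>))) * (M * (real CARD('n) / 2^k) powr \<alpha>) powr \<gamma>))"
proof -
  let ?n = "CARD('n)"
  define a where "a = (\<lambda>z. v (vert k (parent z)))"
  define b where "b = (\<lambda>z. v (vert (Suc k) z))"
  define Z where "Z = {z. parent z \<in> inner_cubes k \<Omega>}"
  define T where "T = touching_cubes k (frontier \<Omega>)"
  define r where "r = M * (real ?n / 2^k) powr \<alpha>"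
  let ?e = "unit_step :: 'n \<Rightarrow> int^'n"
  let ?s = "\<lambda>j. (\<lambda>z. z + ?e j)"
  have r: "r > 0" using M by (simp add: r_def)
  have fcomp: "compact (frontier \<Omega>)" using bd by (rule compact_frontier_bounded)
  have finT: "finite T" unfolding T_def by (rule touching_cubes_covering_number(1)[OF fcomp])
  have finI: "finite (inner_cubes k \<Omega>)" for k by (rule finite_inner_cubes[OF bd])
  have finZ: "finite Z" unfolding Z_def by (rule card_parent_vimage(1)[OF finI])
  define W where "W = {z. parent z \<in> T}"
  have finW: "finite W" unfolding W_def by (rule card_parent_vimage(1)[OF finT])
  have cardW: "real (card W) \<le> 2 ^ ?n * real (card T)"
    using of_nat_mono[OF card_parent_vimage(2)[OF finT], where 'a=real] by (simp add: W_def)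
  have near: "dist (v x) (v y) \<le> r" if "x \<in> dcube k m" "y \<in> dcube k m" "x \<in> \<Omega>" "y \<in> \<Omega>" for x y m
  proof -
    have "dist (v x) (v y) \<le> M * dist x y powr \<alpha>" using hv that by blast
    also have "\<dots> \<le> r"
      unfolding r_def using M \<alpha> dist_dcube[OF that(1,2)] by (intro mult_left_mono powr_mono2) auto
    finally show ?thesis .
  qed
  have vc: "vert (Suc k) q \<in> dcube k (parent z)" if "q \<in> range (corner z)" for q z :: "int^'n"
    using vert_in_dcube_if_corner[OF that] dcube_subset_parent by blast
  \<comment> \<open>The parent of such a cube meets \<open>\<Omega>\<close> without lying inside, so
    by connectedness it touches the frontier.\<close>
  have inW: "z \<in> W" if x: "x \<in> dcube (Suc k) z" "x \<in> \<Omega>" and z: "z \<notin> Z" for x z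
  proof -
    have "x \<in> dcube k (parent z)" using x dcube_subset_parent by blast
    then have "dcube k (parent z) \<inter> \<Omega> \<noteq> {}" using x by blast
    moreover have "dcube k (parent z) - \<Omega> \<noteq> {}" using z by (auto simp: Z_def inner_cubes_def)
    ultimately have "dcube k (parent z) \<inter> frontier \<Omega> \<noteq> {}"
      by (intro connected_Int_frontier convex_connected convex_dcube)
    then show ?thesis by (simp add: W_def T_def touching_cubes_def)
  qed
  have Zsub: "dcube (Suc k) z \<subseteq> \<Omega>" if "z \<in> Z" for z
    using that dcube_subset_parent unfolding Z_def inner_cubes_def by blast
  have ball_b: "b ` range (corner z) \<subseteq> cball (b z) r" if z: "dcube (Suc k) z \<subseteq> \<Omega>" for z
  proof
    fix p assume "p \<in> b ` range (corner z)"
    then obtain q where q: "q \<in> range (corner z)" "p = b q" by blast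
    have z0: "z \<in> range (corner z)" using corner_empty by (metis rangeI)
    have "dist (b z) (b q) \<le> r" unfolding b_def
      by (rule near[OF vc[OF z0] vc[OF q(1)]])
         (use z vert_in_dcube_if_corner[OF z0, of "Suc k"] vert_in_dcube_if_corner[OF q(1), of "Suc k"] in blast)+
    then show "p \<in> cball (b z) r" using q by simp
  qed
  have ball_ab: "a ` range (corner z) \<union> b ` range (corner z) \<subseteq> cball (b z) r" if z: "z \<in> Z" for z
  proof -
    have "a ` range (corner z) \<subseteq> cball (b z) r"
    proof
      fix p assume "p \<in> a ` range (corner z)"
      then obtain S where p: "p = a (corner z S)" by blast
      have z0: "z \<in> range (corner z)" using corner_empty by (metis rangeI)
      have "dcube k (parent z) \<subseteq> \<Omega>" using z by (simp add: Z_def inner_cubes_def)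
      then have "dist (b z) (a (corner z S)) \<le> r" unfolding b_def a_def
        by (intro near[OF vc[OF z0] vert_parent_corner_in_dcube]) (use vc[OF z0] vert_parent_corner_in_dcube in blast)+
      then show "p \<in> cball (b z) r" using p by simp
    qed
    then show ?thesis using ball_b[OF Zsub[OF z]] by blast
  qed
  let ?c = "fact ?n * r powr \<gamma>"
  have c0: "0 \<le> ?c" by simp
  let ?N = "2 ^ ?n * real (card T)"
  have B1: "convex_budget \<gamma> (\<lambda>y. \<Sum>z\<in>inner_cubes (Suc k) \<Omega> - Z. cube_degree b z y) (?N * ?c)"
  proof (rule convex_budget_sum_le)
    show "finite (inner_cubes (Suc k) \<Omega> - Z)" using finI by simp
    have "inner_cubes (Suc k) \<Omega> - Z \<subseteq> W"
    proof
      fix z assume z: "z \<in> inner_cubes (Suc k) \<Omega> - Z"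
      then show "z \<in> W" using vert_in_dcube[of "Suc k" z] by (intro inW[of "vert (Suc k) z"]) (auto simp: inner_cubes_def)
    qed
    then have "card (inner_cubes (Suc k) \<Omega> - Z) \<le> card W" by (rule card_mono[OF finW])
    then show "real (card (inner_cubes (Suc k) \<Omega> - Z)) \<le> ?N" using cardW by linarith
    fix z assume "z \<in> inner_cubes (Suc k) \<Omega> - Z"
    then show "convex_budget \<gamma> (cube_degree b z) ?c"
      by (intro convex_budget_cube_degree[OF ball_b r]) (simp add: inner_cubes_def)
  qed simp
  have B2: "convex_budget \<gamma> (\<lambda>y. \<Sum>z\<in>?s j ` Z - Z. 1 * face_flux j a b z y) (?N * ?c)" for j
  proof (rule convex_budget_sum_le)
    show "finite (?s j ` Z - Z)" using finZ by simp
    have "?s j ` Z - Z \<subseteq> W"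
    proof
      fix z assume z: "z \<in> ?s j ` Z - Z"
      then obtain z0 where z0: "z0 \<in> Z" "z = corner z0 {j}" by (auto simp: corner_unit_step)
      have "vert (Suc k) z \<in> \<Omega>" using Zsub[OF z0(1)] vert_corner_in_dcube[of "Suc k" z0 "{j}"] z0(2) by blast
      then show "z \<in> W" using z by (intro inW[OF vert_in_dcube]) auto
    qed
    then have "card (?s j ` Z - Z) \<le> card W" by (rule card_mono[OF finW])
    then show "real (card (?s j ` Z - Z)) \<le> ?N" using cardW by linarith
    fix z assume "z \<in> ?s j ` Z - Z"
    then obtain z0 where z0: "z0 \<in> Z" "z = z0 + ?e j" by blast
    have "a ` face_corners j z \<union> b ` face_corners j z \<subseteq> cball (b z0) r"
      using ball_ab[OF z0(1)] face_corners_subset(2)[of j z0] unfolding z0(2) by blast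
    then show "convex_budget \<gamma> (\<lambda>y. 1 * face_flux j a b z y) ?c" by (rule convex_budget_face_flux[OF _ r]) simp
  qed simp
  have B3: "convex_budget \<gamma> (\<lambda>y. \<Sum>z\<in>Z - ?s j ` Z. - 1 * face_flux j a b z y) (?N * ?c)" for j
  proof (rule convex_budget_sum_le)
    show "finite (Z - ?s j ` Z)" using finZ by simp
    \<comment> \<open>A face of this family is counted through the cube on its other side, which is
      outside \<open>Z\<close>: the cube \<open>z\<close> itself is in \<open>Z\<close>, and its
      parent need not touch the frontier.\<close>
    have "(\<lambda>z. z - ?e j) ` (Z - ?s j ` Z) \<subseteq> W"
    proof
      fix z' assume "z' \<in> (\<lambda>z. z - ?e j) ` (Z - ?s j ` Z)"
      then obtain z where z: "z \<in> Z" "z \<notin> ?s j ` Z" "z' = z - ?e j" by blast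
      have zc: "z = corner z' {j}" using z(3) by (simp add: corner_unit_step)
      have "z' \<notin> Z" using z(2,3) by (metis diff_add_cancel image_eqI)
      moreover have "vert (Suc k) z \<in> \<Omega>" using Zsub[OF z(1)] vert_in_dcube by blast
      ultimately show "z' \<in> W" using vert_corner_in_dcube[of "Suc k" z' "{j}"] zc by (intro inW[of "vert (Suc k) z"]) auto
    qed
    then have "card ((\<lambda>z. z - ?e j) ` (Z - ?s j ` Z)) \<le> card W" by (rule card_mono[OF finW])
    moreover have "card ((\<lambda>z. z - ?e j) ` (Z - ?s j ` Z)) = card (Z - ?s j ` Z)" by (rule card_image) (simp add: inj_on_def)
    ultimately show "real (card (Z - ?s j ` Z)) \<le> ?N" using cardW by linarith
    fix z assume "z \<in> Z - ?s j ` Z"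
    then have z: "z \<in> Z" by blast
    have "a ` face_corners j z \<union> b ` face_corners j z \<subseteq> cball (b z) r"
      using ball_ab[OF z] face_corners_subset(1)[of j z] by blast
    then show "convex_budget \<gamma> (\<lambda>y. - 1 * face_flux j a b z y) ?c" by (rule convex_budget_face_flux[OF _ r]) simp
  qed simp
  have "convex_budget \<gamma> (\<lambda>y. (\<Sum>z\<in>inner_cubes (Suc k) \<Omega> - Z. cube_degree b z y) +
    (\<Sum>j\<in>UNIV. (\<Sum>z\<in>?s j ` Z - Z. 1 * face_flux j a b z y) + (\<Sum>z\<in>Z - ?s j ` Z. - 1 * face_flux j a b z y)))
    (?N * ?c + (\<Sum>j\<in>(UNIV::'n set). ?N * ?c + ?N * ?c))"
    by (intro convex_budget_add convex_budget_sum B1 B2 B3) simp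
  moreover have "AE y in lborel. grid_degree v \<Omega> (Suc k) y - grid_degree v \<Omega> k y =
    (\<Sum>z\<in>inner_cubes (Suc k) \<Omega> - Z. cube_degree b z y) +
    (\<Sum>j\<in>UNIV. (\<Sum>z\<in>?s j ` Z - Z. 1 * face_flux j a b z y) + (\<Sum>z\<in>Z - ?s j ` Z. - 1 * face_flux j a b z y))"
  proof -
    have "AE y in lborel. generic (range a \<union> range b) y" by (rule AE_generic) (simp add: countable_range_vert)
    then show ?thesis
    proof eventually_elim
      case (elim y)
      then show ?case using grid_degree_refine_eq[OF bd, of v k y] unfolding a_def b_def Z_def by blast
    qed
  qed
  ultimately have "convex_budget \<gamma> (\<lambda>y. grid_degree v \<Omega> (Suc k) y - grid_degree v \<Omega> k y)
    (?N * ?c + (\<Sum>j\<in>(UNIV::'n set). ?N * ?c + ?N * ?c))" by (rule convex_budget_AE_eq)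
  then show ?thesis by (rule convex_budget_mono) (simp add: T_def r_def algebra_simps)
qed

text \<open>Telescoping over the scales. The steps are dominated by a geometric series with ratio
  \<open>2 powr (d - \<alpha> * \<gamma>) < 1\<close>, so the bound is uniform in
  \<open>K\<close>.\<close>

lemma convex_budget_grid_degree:
  fixes \<Omega> :: "(real^'n) set"
  assumes bd: "bounded \<Omega>" and \<alpha>: "\<alpha> > 0" and d: "box_dim (frontier \<Omega>) < ereal d" "d < \<alpha> * \<gamma>"
  shows "\<exists>C\<ge>0. \<forall>v M K. M > 0 \<longrightarrow> (\<forall>x\<in>\<Omega>. \<forall>y\<in>\<Omega>. dist (v x) (v y) \<le> M * dist x y powr \<alpha>) \<longrightarrow>
    convex_budget \<gamma> (grid_degree v \<Omega> K) (C * M powr \<gamma>)"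
proof -
  let ?n = "CARD('n)"
  let ?t = "\<lambda>k. real (card (touching_cubes k (frontier \<Omega>)))"
  obtain T where T: "T \<ge> 0" "\<And>k. ?t k \<le> T * 2 powr (real k * d)"
    using box_dim_touching_cubes[OF compact_frontier_bounded[OF bd] d(1)] by blast
  define q where "q = 2 powr (d - \<alpha> * \<gamma>)"
  have q: "0 < q" "q < 1" using d(2) powr_less_mono[of "d - \<alpha> * \<gamma>" 0 2] by (auto simp: q_def)
  define D where "D = (1 + 2 * real ?n) * (2 ^ ?n * fact ?n)"
  define s where "s = real ?n powr (\<alpha> * \<gamma>)"
  \<comment> \<open>Scale 0 has no predecessor; its finitely many unit cubes are charged
    directly.\<close>
  define I0 where "I0 = real (card (inner_cubes 0 \<Omega>)) * (fact ?n * s)"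
  define C where "C = I0 + D * T * s / (1 - q)"
  have pos: "0 \<le> D" "0 \<le> s" "0 \<le> I0" by (auto simp: D_def s_def I0_def)
  have C: "C \<ge> 0" using pos T q by (simp add: C_def)
  have "convex_budget \<gamma> (grid_degree v \<Omega> K) (C * M powr \<gamma>)"
    if M: "M > 0" and hv: "\<And>x y. x \<in> \<Omega> \<Longrightarrow> y \<in> \<Omega> \<Longrightarrow> dist (v x) (v y) \<le> M * dist x y powr \<alpha>" for v M K
  proof -
    let ?r = "\<lambda>k. M * (real ?n / 2^k) powr \<alpha>"
    have rk: "?r k powr \<gamma> = M powr \<gamma> * s * 2 powr (- (real k * (\<alpha> * \<gamma>)))" for k
    proof -
      have "((2 ^ k :: real) powr \<alpha>) powr \<gamma> = 2 powr (real k * (\<alpha> * \<gamma>))"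
        by (simp add: powr_realpow[symmetric] powr_powr mult.assoc)
      then show ?thesis
        unfolding powr_mult powr_divide powr_minus by (simp only: s_def powr_powr divide_inverse mult.assoc)
    qed
    have first: "convex_budget \<gamma> (grid_degree v \<Omega> 0) (I0 * M powr \<gamma>)"
    proof -
      have "convex_budget \<gamma> (\<lambda>y. \<Sum>z\<in>inner_cubes 0 \<Omega>. cube_degree (\<lambda>z. v (vert 0 z)) z y)
        (real (card (inner_cubes 0 \<Omega>)) * (fact ?n * ?r 0 powr \<gamma>))"
      proof (rule convex_budget_sum_le[OF finite_inner_cubes[OF bd] order_refl])
        fix z assume "z \<in> inner_cubes 0 \<Omega>"
        then have z: "dcube 0 z \<subseteq> \<Omega>" by (simp add: inner_cubes_def)
        show "convex_budget \<gamma> (cube_degree (\<lambda>z. v (vert 0 z)) z) (fact ?n * ?r 0 powr \<gamma>)"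
        proof (rule convex_budget_cube_degree)
          show "(\<lambda>z. v (vert 0 z)) ` range (corner z) \<subseteq> cball (v (vert 0 z)) (?r 0)"
          proof
            fix p assume "p \<in> (\<lambda>z. v (vert 0 z)) ` range (corner z)"
            then obtain S where p: "p = v (vert 0 (corner z S))" by blast
            have "dist (v (vert 0 z)) p \<le> M * dist (vert 0 z) (vert 0 (corner z S)) powr \<alpha>"
              unfolding p using z vert_in_dcube vert_corner_in_dcube by (intro hv) blast+
            also have "\<dots> \<le> ?r 0"
              using M \<alpha> dist_dcube[OF vert_in_dcube vert_corner_in_dcube, of 0 z S] by (intro mult_left_mono powr_mono2) auto
            finally show "p \<in> cball (v (vert 0 z)) (?r 0)" by simp
          qed
        qed (use M in simp)
      qed simp
      moreover have "real (card (inner_cubes 0 \<Omega>)) * (fact ?n * ?r 0 powr \<gamma>) = I0 * M powr \<gamma>"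
        unfolding rk by (simp add: I0_def)
      ultimately show ?thesis unfolding grid_degree_def[abs_def] by simp
    qed
    have step: "convex_budget \<gamma> (\<lambda>y. grid_degree v \<Omega> (Suc k) y - grid_degree v \<Omega> k y) (D * T * s * M powr \<gamma> * q ^ k)" for k
    proof (rule convex_budget_mono)
      show "convex_budget \<gamma> (\<lambda>y. grid_degree v \<Omega> (Suc k) y - grid_degree v \<Omega> k y) (D * (?t k * ?r k powr \<gamma>))"
        unfolding D_def by (rule convex_budget_refine[OF bd M \<alpha> hv])
      have "?t k * ?r k powr \<gamma> \<le> T * 2 powr (real k * d) * ?r k powr \<gamma>" using T(2) by (rule mult_right_mono) simp
      also have "\<dots> = T * s * M powr \<gamma> * (2 powr (real k * d) * 2 powr (- (real k * (\<alpha> * \<gamma>))))"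
        unfolding rk by (simp only: mult_ac)
      also have "2 powr (real k * d) * 2 powr (- (real k * (\<alpha> * \<gamma>))) = q ^ k"
        unfolding powr_add[symmetric] q_def by (simp add: powr_power algebra_simps)
      finally have "?t k * ?r k powr \<gamma> \<le> T * s * M powr \<gamma> * q ^ k" .
      then have "D * (?t k * ?r k powr \<gamma>) \<le> D * (T * s * M powr \<gamma> * q ^ k)" using pos(1) by (rule mult_left_mono)
      then show "D * (?t k * ?r k powr \<gamma>) \<le> D * T * s * M powr \<gamma> * q ^ k" by (simp only: mult.assoc)
    qed
    have "convex_budget \<gamma> (\<lambda>y. grid_degree v \<Omega> 0 y + (\<Sum>k<K. grid_degree v \<Omega> (Suc k) y - grid_degree v \<Omega> k y))
      (I0 * M powr \<gamma> + (\<Sum>k<K. D * T * s * M powr \<gamma> * q ^ k))"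
    proof (rule convex_budget_add[OF first])
      show "convex_budget \<gamma> (\<lambda>y. \<Sum>k<K. grid_degree v \<Omega> (Suc k) y - grid_degree v \<Omega> k y) (\<Sum>k<K. D * T * s * M powr \<gamma> * q ^ k)"
        by (rule convex_budget_sum[where f="\<lambda>k y. grid_degree v \<Omega> (Suc k) y - grid_degree v \<Omega> k y", OF finite_lessThan step])
    qed
    then have "convex_budget \<gamma> (grid_degree v \<Omega> K) (I0 * M powr \<gamma> + (\<Sum>k<K. D * T * s * M powr \<gamma> * q ^ k))"
      unfolding sum_lessThan_telescope[of "\<lambda>k. grid_degree v \<Omega> k _"] by simp
    moreover have "(\<Sum>k<K. D * T * s * M powr \<gamma> * q ^ k) \<le> D * T * s * M powr \<gamma> * (1 / (1 - q))"
    proof -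
      have "(\<Sum>k<K. q ^ k) \<le> (\<Sum>k. q ^ k)" using q by (intro sum_le_suminf summable_geometric) auto
      then have "(\<Sum>k<K. q ^ k) \<le> 1 / (1 - q)" using q by (simp add: suminf_geometric)
      then show ?thesis unfolding sum_distrib_left[symmetric] using pos T(1) by (intro mult_left_mono) auto
    qed
    ultimately show ?thesis by (elim convex_budget_mono) (simp add: C_def algebra_simps)
  qed
  note main = this
  show ?thesis
  proof (intro exI[of _ C] conjI allI impI)
    fix v :: "real^'n \<Rightarrow> real^'n" and M K assume "0 < M" "\<forall>x\<in>\<Omega>. \<forall>y\<in>\<Omega>. dist (v x) (v y) \<le> M * dist x y powr \<alpha>"
    then show "convex_budget \<gamma> (grid_degree v \<Omega> K) (C * M powr \<gamma>)" by (intro main) auto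
  qed (rule C)
qed

lemma ennreal_powr_mono: "x \<le> ennreal b \<Longrightarrow> 0 \<le> b \<Longrightarrow> 0 \<le> e \<Longrightarrow> ennreal_powr x e \<le> ennreal (b powr e)"
proof -
  assume x: "x \<le> ennreal b" and b: "0 \<le> b" "0 \<le> e"
  then have "x \<noteq> \<infinity>" by (auto simp: top_unique)
  moreover have "enn2real x \<le> b" using x b(1) by (rule enn2real_leI[rotated])
  ultimately show ?thesis using b by (auto simp: ennreal_powr_def intro!: ennreal_leI powr_mono2)
qed

theorem theorem1p1:
  fixes \<Omega> :: "(real^'n) set" and d \<alpha> \<beta> p :: real
  assumes "open \<Omega>" and "bounded \<Omega>"
    and "box_dim (frontier \<Omega>) = ereal d"
    and "real CARD('n) - 1 \<le> d" and "d < real CARD('n)"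
    and "d / real CARD('n) < \<alpha>" and "\<alpha> \<le> 1"
    and "1 \<le> p" and "0 \<le> \<beta>" and "\<beta> < real CARD('n) / p - d / \<alpha>"
  shows "\<exists>C\<ge>0. \<forall>v::real^'n \<Rightarrow> real^'n. v \<in> holder_space \<alpha> \<Omega> \<longrightarrow>
           sobolev_seminorm \<beta> p (brouwer_degree (closure_extension \<Omega> v) \<Omega>)
             \<le> ennreal (C * enn2real (holder_seminorm \<alpha> \<Omega> v) powr (real CARD('n) / p - \<beta>))"
proof -
  let ?n = "real CARD('n)"
  define \<gamma> where "\<gamma> = ?n / p - \<beta>"
  have n1: "?n \<ge> 1" by (simp add: Suc_le_eq)
  then have d0: "d \<ge> 0" using assms(4) by linarith
  have \<alpha>: "\<alpha> > 0" using assms(6) d0 n1 by (meson divide_nonneg_nonneg le_less_trans of_nat_0_le_iff)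
  have d\<gamma>: "d / \<alpha> < \<gamma>" using assms(10) by (simp add: \<gamma>_def)
  then have d1: "d < \<alpha> * \<gamma>" using \<alpha> by (simp add: pos_divide_less_eq mult.commute)
  have \<gamma>0: "\<gamma> > 0" using d\<gamma> d0 \<alpha> by (meson divide_nonneg_pos le_less_trans)
  have "?n / p \<le> ?n / 1" using assms(8) n1 by (intro divide_left_mono) auto
  then have "\<gamma> \<le> ?n" using assms(9) by (simp add: \<gamma>_def)
  then have \<gamma>n: "\<alpha> * \<gamma> \<le> \<alpha> * ?n" using \<alpha> by simp
  \<comment> \<open>By \<open>\<alpha> \<le> 1\<close>, \<open>p \<ge> 1\<close> and
    \<open>d \<ge> n - 1\<close>:
    \<open>\<beta> * p < n - d * p / \<alpha> \<le> n - d \<le> 1\<close>. In this range the bound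
    for convex indicators holds.\<close>
  have "\<beta> * p < 1"
  proof -
    have "\<beta> * p < (?n / p - d / \<alpha>) * p" using assms(8,10) by (intro mult_strict_right_mono) auto
    also have "\<dots> = ?n - d / \<alpha> * p" using assms(8) by (simp add: field_simps)
    also have "\<dots> \<le> ?n - d"
    proof -
      have "d * 1 \<le> d / \<alpha> * p"
      proof (rule mult_mono)
        show "d \<le> d / \<alpha>" using d0 \<alpha> assms(7) by (simp add: pos_le_divide_eq mult_left_le)
      qed (use assms(8) d0 \<alpha> in auto)
      then show ?thesis by simp
    qed
    finally show ?thesis using assms(4) by linarith
  qed
  \<comment> \<open>The box dimension yields counting bounds for exponents above \<open>d\<close>,
    while the series converges for exponents below \<open>\<alpha> * \<gamma>\<close>; the midpoint
    satisfies both.\<close>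
  define d' where "d' = (d + \<alpha> * \<gamma>) / 2"
  have d': "d < d'" "d' < \<alpha> * \<gamma>" using d1 by (auto simp: d'_def)
  have bdim: "box_dim (frontier \<Omega>) < ereal d'" using d' assms(3) by simp
  obtain C1 where C1: "C1 \<ge> 0" and budget: "\<And>v M K. M > 0 \<Longrightarrow> (\<forall>x\<in>\<Omega>. \<forall>y\<in>\<Omega>. dist (v x) (v y) \<le> M * dist x y powr \<alpha>) \<Longrightarrow>
    convex_budget \<gamma> (grid_degree v \<Omega> K) (C1 * M powr \<gamma>)"
    using convex_budget_grid_degree[OF assms(2) \<alpha> bdim d'(2)] by blast
  obtain C2 where C2: "C2 \<ge> 0" and energy: "\<And>(f :: nat \<Rightarrow> real^'n \<Rightarrow> real) g b.
     (\<forall>k. convex_budget \<gamma> (f k) b) \<Longrightarrow> (AE x in lborel. (\<lambda>k. f k x) \<longlonglongrightarrow> g x) \<Longrightarrow> sobolev_energy \<beta> p g \<le> ennreal (C2 * b powr p)"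
    using convex_budget_energy[OF assms(8,9) \<open>\<beta> * p < 1\<close>, where 'a="real^'n"] unfolding \<gamma>_def by auto
  define C where "C = C2 powr (1 / p) * C1"
  have C: "C \<ge> 0" using C1 by (simp add: C_def)
  \<comment> \<open>\<open>M\<close> is any positive bound of the seminorm, because the radii in a
    budget are positive while the seminorm may vanish.\<close>
  have bound: "sobolev_seminorm \<beta> p (brouwer_degree (closure_extension \<Omega> v) \<Omega>) \<le> ennreal (C * M powr \<gamma>)"
    if v: "v \<in> holder_space \<alpha> \<Omega>" and M: "M > 0" "enn2real (holder_seminorm \<alpha> \<Omega> v) \<le> M" for v :: "real^'n \<Rightarrow> real^'n" and M
  proof -
    let ?g = "closure_extension \<Omega> v"
    have hv: "dist (v x) (v y) \<le> M * dist x y powr \<alpha>" if "x \<in> \<Omega>" "y \<in> \<Omega>" for x y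
      using holder_space_norm_le[OF v that] mult_right_mono[OF M(2), of "dist x y powr \<alpha>"] by simp
    have cg: "continuous_on (closure \<Omega>) ?g"
      and hg: "\<And>x y. x \<in> closure \<Omega> \<Longrightarrow> y \<in> closure \<Omega> \<Longrightarrow> dist (?g x) (?g y) \<le> M * dist x y powr \<alpha>"
      using closure_extension_holder[OF assms(1) \<alpha> less_imp_le[OF M(1)] hv] by blast+
    have fr: "frontier \<Omega> \<subseteq> closure \<Omega>" by (simp add: frontier_def)
    have "?g ` frontier \<Omega> \<in> null_sets lborel"
    proof (rule null_sets_holder_image[OF compact_frontier_bounded[OF assms(2)] bdim _ \<alpha> M(1)])
      \<comment> \<open>Since \<open>\<gamma> \<le> n\<close>, the gap that makes the series
        converge also makes the image of the frontier a null set.\<close>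
      show "d' < \<alpha> * ?n" using d'(2) \<gamma>n by linarith
      show "continuous_on (frontier \<Omega>) ?g" by (rule continuous_on_subset[OF cg fr])
    qed (use hg fr in blast)
    then have "AE y in lborel. y \<notin> ?g ` frontier \<Omega>" by (rule AE_not_in)
    then have lim: "AE y in lborel. (\<lambda>k. grid_degree ?g \<Omega> k y) \<longlonglongrightarrow> brouwer_degree ?g \<Omega> y"
      using grid_degree_tendsto_brouwer[OF assms(2,1) cg] by eventually_elim blast
    have "\<forall>k. convex_budget \<gamma> (grid_degree ?g \<Omega> k) (C1 * M powr \<gamma>)"
      using budget[OF M(1)] hg closure_subset by blast
    from energy[OF this lim] have "sobolev_energy \<beta> p (brouwer_degree ?g \<Omega>) \<le> ennreal (C2 * (C1 * M powr \<gamma>) powr p)" .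
    then have "sobolev_seminorm \<beta> p (brouwer_degree ?g \<Omega>) \<le> ennreal ((C2 * (C1 * M powr \<gamma>) powr p) powr (1 / p))"
      unfolding sobolev_seminorm_energy by (rule ennreal_powr_mono) (use C2 assms(8) in auto)
    also have "(C2 * (C1 * M powr \<gamma>) powr p) powr (1 / p) = C * M powr \<gamma>"
      using assms(8) C1 by (simp add: C_def powr_mult powr_powr)
    finally show ?thesis .
  qed
  have "sobolev_seminorm \<beta> p (brouwer_degree (closure_extension \<Omega> v) \<Omega>)
      \<le> ennreal (C * enn2real (holder_seminorm \<alpha> \<Omega> v) powr \<gamma>)" if v: "v \<in> holder_space \<alpha> \<Omega>" for v :: "real^'n \<Rightarrow> real^'n"
  proof (cases "enn2real (holder_seminorm \<alpha> \<Omega> v) > 0")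
    case True
    then show ?thesis using bound[OF v] by blast
  next
    case False
    then have 0: "enn2real (holder_seminorm \<alpha> \<Omega> v) = 0" by (simp add: not_less antisym)
    \<comment> \<open>For seminorm 0 the bounds with \<open>M = 1 / (k + 1)\<close> tend to 0,
      because \<open>\<gamma> > 0\<close>.\<close>
    have "(\<lambda>k. ennreal (C * inverse (real (Suc k)) powr \<gamma>)) \<longlonglongrightarrow> ennreal (C * 0 powr \<gamma>)"
      using \<gamma>0 by (intro tendsto_ennrealI tendsto_mult tendsto_const tendsto_powr' LIMSEQ_inverse_real_of_nat) auto
    then have "sobolev_seminorm \<beta> p (brouwer_degree (closure_extension \<Omega> v) \<Omega>) \<le> ennreal (C * 0 powr \<gamma>)"
      by (rule LIMSEQ_le_const) (use bound[OF v] 0 in auto)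
    then show ?thesis using 0 by simp
  qed
  then show ?thesis using C unfolding \<gamma>_def by blast
qed

end
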